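(* Suppose LTE uses listen-before-talk with random back-off with $(a,b)=(1,2)$, i.e. AP timers $t_i^W$ are uniform on $[0,1]$ and eNB timers $t_k^L$ are uniform on $[1,2]$, so that the medium access indicators of AP $x_i$ and eNB $y_k$ are $$e_i^W=\prod_{x_j\in\Phi_W\setminus\{x_i\}}\Bigl(\mathbf 1_{\{t_j^W\ge t_i^W\}}+\mathbf 1_{\{t_j^W<t_i^W\}}\mathbf 1_{\{G^W_{j,i}/l(\|x_j-x_i\|)\le\Gamma_{cs}/P_W\}}\Bigr),$$ $$e_k^L=\prod_{x_j\in\Phi_W}\mathbf 1_{\{G^{WL}_{j,k}/l(\|x_j-y_k\|)\le\Gamma^L/P_W\}}\prod_{y_m\in\Phi_L\setminus\{y_k\}}\Bigl(\mathbf 1_{\{t_m^L\ge t_k^L\}}+\mathbf 1_{\{t_m^L<t_k^L\}}\mathbf 1_{\{G^{L}_{m,k}/l(\|y_m-y_k\|)\le\Gamma^L/P_L\}}\Bigr).$$ Let $x_0$ (the tagged AP) and $y_0$ (the tagged eNB) be the points of $\Phi_W$ and of $\Phi_L$, respectively, closest to the origin. Then their medium access probabilities $\hat p^W_{4,\mathrm{MAP}}=\mathbb P(e_0^W=1)$ and $\hat p^L_{4,\mathrm{MAP}}=\mathbb P(e_0^L=1)$ are $$\hat p^W_{4,\mathrm{MAP}}(\lambda_W,\lambda_L)=\int_0^\infty\frac{1-\exp(-N_2^W(r_0))}{N_2^W(r_0)}f_W(r_0)\,dr_0,$$ $$\hat p^L_{4,\mathrm{MAP}}(\lambda_W,\l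ambda_L)=\int_0^\infty\exp(-N_3^W(\Gamma^L))\,\frac{1-\exp(-N_1^L(r_0,\Gamma^L))}{N_1^L(r_0,\Gamma^L)}f_L(r_0)\,dr_0.$$
   Context: Wi-Fi access points (APs) form a homogeneous Poisson point process $\Phi_W=\{x_i\}$ on $\mathbb R^2$ with intensity $\lambda_W>0$; LTE base stations (eNBs) form an independent homogeneous Poisson point process $\Phi_L=\{y_k\}$ on $\mathbb R^2$ with intensity $\lambda_L>0$. Transmit powers are $P_W,P_L>0$. The path loss is $l(d)=(4\pi/\lambda_c)^2 d^{\alpha}$ with wavelength $\lambda_c>0$ and path loss exponent $\alpha>0$. $\Gamma_{cs}>0$ is Wi-Fi's carrier sensing threshold and $\Gamma^L>0$ is the LTE sensing threshold. $G^W_{j,i},G^{WL}_{j,k},G^L_{m,k}$ are the fadings from AP $x_j$ to AP $x_i$, AP $x_j$ to eNB $y_k$, eNB $y_m$ to eNB $y_k$; all fading variables are i.i.d. exponential with $\mathbb P(G>s)=e^{-\mu s}$, $\mu>0$. The point processes, the timers and the fading variables are all mutually independent. $B(0,r)$ is the closed ball of radius $r$ centred at the origin. Define $$N_2^W(r)=\lambda_W\int_{\mathbb R^2\setminus B(0,r)}\exp\Bigl(-\mu\tfrac{\Gamma_{cs}}{P_W}l(\|x-(r,0)\|)\Bigr)dx,\quad N_1^L(r,\Gamma)=\lambda_L\int_{\mathbb R^2\setminus B(0,r)}\exp\Bigl(-\mu\tfrac{\Gamma}{P_L}l(\|x-(r,0)\|)\Bigr)dx,$$ $$N_3^W(\Gamma)=\lambda_W\int_{\mathbb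 R^2}\exp\Bigl(-\mu\tfrac{\Gamma}{P_W}l(\|x\|)\Bigr)dx,$$ $f_W(r)=2\pi\lambda_W r e^{-\lambda_W\pi r^2}$ and $f_L(r)=2\pi\lambda_L r e^{-\lambda_L\pi r^2}$ (the densities of the distances from the origin to the closest AP and closest eNB). *)

theory Defs
  imports "HOL-Probability.Probability"
begin

(* A point process is given by an enumeration X 0, X 1, ... of its points.  Counting indices
   makes X i w the atoms of the counting measure with multiplicity, so the Poisson law below
   forces the points to be almost surely pairwise distinct. *)
definition poisson_point_process ::
  "'a measure \<Rightarrow> real \<Rightarrow> (nat \<Rightarrow> 'a \<Rightarrow> real \<times> real) \<Rightarrow> bool"
where
  "poisson_point_process M lam X \<longleftrightarrow>
     (\<forall>i. X i \<in> borel_measurable M) \<and>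
     (AE \<omega> in M. \<forall>r. finite {i. X i \<omega> \<in> cball 0 r}) \<and>
     (\<forall>A\<in>sets borel. bounded A \<longrightarrow>
        (\<forall>n. measure M {\<omega> \<in> space M. card {i. X i \<omega> \<in> A} = n}
           = (lam * measure lborel A) ^ n / fact n * exp (- (lam * measure lborel A)))) \<and>
     (\<forall>\<A>. finite \<A> \<longrightarrow> disjoint \<A> \<longrightarrow> (\<forall>A\<in>\<A>. A \<in> sets borel \<and> bounded A) \<longrightarrow>
        prob_space.indep_vars M (\<lambda>_. count_space UNIV) (\<lambda>A \<omega>. card {i. X i \<omega> \<in> A}) \<A>)"

(* Ties have probability zero; LEAST rather than an arbitrary choice keeps the index
   measurable in the configuration. *)
definition closest_index :: "(nat \<Rightarrow> real \<times> real) \<Rightarrow> nat" where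
  "closest_index x = (LEAST i. \<forall>j. norm (x i) \<le> norm (x j))"

datatype source =
    W_points | L_points
  | W_timer nat | L_timer nat
  | WW_fading nat nat | WL_fading nat nat | LL_fading nat nat

(* The sigma-algebra on the sample space generated by each source of randomness; a point
   process contributes the sigma-algebra of its whole sequence of points. *)
fun source_events ::
  "'a measure \<Rightarrow> (nat \<Rightarrow> 'a \<Rightarrow> real \<times> real) \<Rightarrow> (nat \<Rightarrow> 'a \<Rightarrow> real \<times> real) \<Rightarrow>
   (nat \<Rightarrow> 'a \<Rightarrow> real) \<Rightarrow> (nat \<Rightarrow> 'a \<Rightarrow> real) \<Rightarrow>
   (nat \<Rightarrow> nat \<Rightarrow> 'a \<Rightarrow> real) \<Rightarrow> (nat \<Rightarrow> nat \<Rightarrow> 'a \<Rightarrow> real) \<Rightarrow> (nat \<Rightarrow> nat \<Rightarrow> 'a \<Rightarrow> real) \<Rightarrow>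
   source \<Rightarrow> 'a set set"
where
  "source_events M x y tW tL GW GWL GL W_points =
     sets (vimage_algebra (space M) (\<lambda>\<omega> i. x i \<omega>) (\<Pi>\<^sub>M i\<in>UNIV. borel))"
| "source_events M x y tW tL GW GWL GL L_points =
     sets (vimage_algebra (space M) (\<lambda>\<omega> k. y k \<omega>) (\<Pi>\<^sub>M k\<in>UNIV. borel))"
| "source_events M x y tW tL GW GWL GL (W_timer i) =
     sets (vimage_algebra (space M) (tW i) borel)"
| "source_events M x y tW tL GW GWL GL (L_timer k) =
     sets (vimage_algebra (space M) (tL k) borel)"
| "source_events M x y tW tL GW GWL GL (WW_fading j i) =
     sets (vimage_algebra (space M) (GW j i) borel)"
| "source_events M x y tW tL GW GWL GL (WL_fading j k) =
     sets (vimage_algebra (space M) (GWL j k) borel)"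
| "source_events M x y tW tL GW GWL GL (LL_fading m k) =
     sets (vimage_algebra (space M) (GL m k) borel)"

(* A transmitter has no fading variable towards itself. *)
definition sources :: "source set" where
  "sources = UNIV - (range (\<lambda>i. WW_fading i i) \<union> range (\<lambda>k. LL_fading k k))"

definition path_loss :: "real \<Rightarrow> real \<Rightarrow> real \<Rightarrow> real" where
  "path_loss lamc \<alpha> d = (4 * pi / lamc)\<^sup>2 * d powr \<alpha>"

(* Limit of the partial products.  It is used for factors in {0,1} only, where it always
   exists and does not depend on the enumeration; prodinf is unspecified when infinitely
   many factors vanish. *)
definition product_over :: "nat set \<Rightarrow> (nat \<Rightarrow> real) \<Rightarrow> real" where
  "product_over J f = lim (\<lambda>n. \<Prod>j\<in>J \<inter> {..<n}. f j)"

(* Contention among the nodes of one network: z are the locations, t the timers, G j i the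
   fading from node j to node i, and c is the threshold divided by the transmit power. *)
definition backoff_indicator ::
  "(real \<Rightarrow> real) \<Rightarrow> real \<Rightarrow> (nat \<Rightarrow> real \<times> real) \<Rightarrow> (nat \<Rightarrow> real) \<Rightarrow> (nat \<Rightarrow> nat \<Rightarrow> real) \<Rightarrow>
   nat \<Rightarrow> real"
where
  "backoff_indicator l c z t G i =
     product_over (UNIV - {i})
       (\<lambda>j. of_bool (t j \<ge> t i)
          + of_bool (t j < t i) * of_bool (G j i / l (norm (z j - z i)) \<le> c))"

definition wifi_access ::
  "(real \<Rightarrow> real) \<Rightarrow> real \<Rightarrow> real \<Rightarrow>
   (nat \<Rightarrow> real \<times> real) \<Rightarrow> (nat \<Rightarrow> real) \<Rightarrow> (nat \<Rightarrow> nat \<Rightarrow> real) \<Rightarrow> nat \<Rightarrow> real"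
where
  "wifi_access l PW \<Gamma>cs x tW GW i = backoff_indicator l (\<Gamma>cs / PW) x tW GW i"

definition lte_access ::
  "(real \<Rightarrow> real) \<Rightarrow> real \<Rightarrow> real \<Rightarrow> real \<Rightarrow>
   (nat \<Rightarrow> real \<times> real) \<Rightarrow> (nat \<Rightarrow> real \<times> real) \<Rightarrow> (nat \<Rightarrow> real) \<Rightarrow>
   (nat \<Rightarrow> nat \<Rightarrow> real) \<Rightarrow> (nat \<Rightarrow> nat \<Rightarrow> real) \<Rightarrow> nat \<Rightarrow> real"
where
  "lte_access l PW PL \<Gamma>L x y tL GWL GL k =
     product_over UNIV (\<lambda>j. of_bool (GWL j k / l (norm (x j - y k)) \<le> \<Gamma>L / PW))
     * backoff_indicator l (\<Gamma>L / PL) y tL GL k"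

definition N2W :: "(real \<Rightarrow> real) \<Rightarrow> real \<Rightarrow> real \<Rightarrow> real \<Rightarrow> real \<Rightarrow> real \<Rightarrow> real" where
  "N2W l lamW \<mu> PW \<Gamma>cs r =
     lamW * (LBINT z:- cball (0 :: real \<times> real) r. exp (- \<mu> * (\<Gamma>cs / PW) * l (norm (z - (r, 0)))))"

definition N1L :: "(real \<Rightarrow> real) \<Rightarrow> real \<Rightarrow> real \<Rightarrow> real \<Rightarrow> real \<Rightarrow> real \<Rightarrow> real" where
  "N1L l lamL \<mu> PL r \<Gamma> =
     lamL * (LBINT z:- cball (0 :: real \<times> real) r. exp (- \<mu> * (\<Gamma> / PL) * l (norm (z - (r, 0)))))"

definition N3W :: "(real \<Rightarrow> real) \<Rightarrow> real \<Rightarrow> real \<Rightarrow> real \<Rightarrow> real \<Rightarrow> real" where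
  "N3W l lamW \<mu> PW \<Gamma> =
     lamW * (LBINT z. exp (- \<mu> * (\<Gamma> / PW) * l (norm (z :: real \<times> real))))"

definition closest_dist_density :: "real \<Rightarrow> real \<Rightarrow> real" where
  "closest_dist_density lam r = 2 * pi * lam * r * exp (- lam * pi * r\<^sup>2)"

end

theory Submission
  imports Defs "HOL-Real_Asymp.Real_Asymp"
begin

text \<open>
  Conditionally on all locations and on the timer \<open>t\<close> of the tagged node \<open>z\<close>, the competitors \<open>b\<close>
  of the same network block it independently of each other with probability \<open>t * q (b - z)\<close>, so the
  conditional access probability is a product over the points of the process.  The expectation of
  such a product is the generating functional \<open>exp (- lam * LBINT b. t * q (b - z))\<close>.

  The other points, given that the closest one is at \<open>z\<close>, form a Poisson process outside the disc of
  radius \<open>norm z\<close>.  Palm theory is avoided as follows: cut the plane into thin rings; if the first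
  nonempty ring has exactly one point, that point is the closest one, and the numbers of points
  in the disc, in the ring and outside of it are independent.  Refining the rings gives the law of the
  closest point jointly with a product over the others (for factors that do not depend on \<open>z\<close>), and
  discretising \<open>z\<close> extends this to factors depending on \<open>z\<close>.  Averaging over \<open>t\<close> turns \<open>exp (- t * N)\<close>
  into \<open>(1 - exp (- N)) / N\<close>, and polar coordinates give the density of the distance.
\<close>

section \<open>Infinite products of factors in the unit interval\<close>

text \<open>Two obstacles shape the argument. Timers and fading variables are attached to node
  numbers, while the number of the tagged node is random. It is a function of the locations alone,
  so expectations are split over its value \<open>k\<close>; with \<open>k\<close> fixed, different
  competitors read disjoint sources and can be averaged separately. Conditioning is expressed by a
  second copy of the sample space: averaging over independent sources means integrating
  \<open>h (w, w')\<close> over \<open>w'\<close>, which avoids conditional distributions.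

  The second obstacle is that the Poisson hypothesis speaks of counts in bounded sets, not of the
  joint law of the enumerated points. Hence statements about locations have to be reduced to counts,
  and even the almost sure uniqueness of the closest point is derived in this way: the density
  produced by the rings has total mass 1.

  Probabilities are computed as nonnegative integrals, so that Tonelli and the exchange with series
  require no integrability.\<close>

text \<open>An infimum instead of a limit: it always exists, is visibly measurable and commutes with
  other infima. For factors at most 1 the partial products decrease, and it is their limit.\<close>

definition iprod :: "nat set \<Rightarrow> (nat \<Rightarrow> ennreal) \<Rightarrow> ennreal" where
  "iprod J f = (INF m. \<Prod>j\<in>J \<inter> {..<m}. f j)"

lemma prod_Int_lessThan_Suc:
  fixes f :: "nat \<Rightarrow> 'a::comm_monoid_mult"
  shows "(\<Prod>j\<in>J \<inter> {..<Suc m}. f j) = (if m \<in> J then f m else 1) * (\<Prod>j\<in>J \<inter> {..<m}. f j)"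
proof -
  have "J \<inter> {..<Suc m} = (if m \<in> J then insert m (J \<inter> {..<m}) else J \<inter> {..<m})"
    by (auto simp: less_Suc_eq)
  then show ?thesis by auto
qed

lemma decseq_prod_Int_lessThan:
  fixes f :: "nat \<Rightarrow> ennreal"
  assumes "\<And>j. j \<in> J \<Longrightarrow> f j \<le> 1"
  shows "decseq (\<lambda>m. \<Prod>j\<in>J \<inter> {..<m}. f j)"
proof (rule decseq_SucI)
  fix m
  show "(\<Prod>j\<in>J \<inter> {..<Suc m}. f j) \<le> (\<Prod>j\<in>J \<inter> {..<m}. f j)"
    unfolding prod_Int_lessThan_Suc using assms mult_right_mono[of "f m" 1] by auto
qed

lemma LIMSEQ_iprod:
  assumes "\<And>j. j \<in> J \<Longrightarrow> f j \<le> 1"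
  shows "(\<lambda>m. \<Prod>j\<in>J \<inter> {..<m}. f j) \<longlonglongrightarrow> iprod J f"
  unfolding iprod_def
  by (intro LIMSEQ_INF decseq_prod_Int_lessThan assms)

lemma iprod_le_1: "iprod J f \<le> 1"
  unfolding iprod_def by (rule INF_lower2[of 0]) auto

lemma iprod_cong: "(\<And>j. j \<in> J \<Longrightarrow> f j = g j) \<Longrightarrow> iprod J f = iprod J g"
  unfolding iprod_def by (auto intro!: INF_cong prod.cong)

lemma iprod_mono: "(\<And>j. j \<in> J \<Longrightarrow> f j \<le> g j) \<Longrightarrow> iprod J f \<le> iprod J g"
  unfolding iprod_def by (intro INF_mono' prod_mono_ennreal) auto

lemma iprod_empty [simp]: "iprod {} f = 1"
  by (simp add: iprod_def)

lemma iprod_eq_prod: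
  assumes "finite F" "F \<subseteq> J" "\<And>j. j \<in> J - F \<Longrightarrow> f j = 1" "\<And>j. j \<in> J \<Longrightarrow> f j \<le> 1"
  shows "iprod J f = (\<Prod>j\<in>F. f j)"
proof -
  obtain n where n: "F \<subseteq> {..<n}"
    using finite_nat_iff_bounded assms(1) by auto
  have "(\<Prod>j\<in>J \<inter> {..<m}. f j) = (\<Prod>j\<in>F. f j)" if "m \<ge> n" for m
    using n assms that by (intro prod.mono_neutral_right) auto
  then have "(\<lambda>m. \<Prod>j\<in>J \<inter> {..<m}. f j) \<longlonglongrightarrow> (\<Prod>j\<in>F. f j)"
    by (intro tendsto_eventually eventually_sequentiallyI[of n])
  with LIMSEQ_iprod[OF assms(4)] show ?thesis
    by (rule LIMSEQ_unique)
qed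

lemma iprod_eq_0:
  assumes "j \<in> J" "f j = 0"
  shows "iprod J f = 0"
proof -
  have "(\<Prod>j\<in>J \<inter> {..<Suc j}. f j) = 0"
    using assms by (intro prod_zero) auto
  then have "iprod J f \<le> 0"
    unfolding iprod_def by (intro INF_lower2[of "Suc j"]) auto
  then show ?thesis by simp
qed

lemma iprod_split:
  assumes "\<And>j. j \<in> J \<Longrightarrow> f j \<le> 1" "i \<in> J" "f i = 1"
  shows "iprod J f = iprod (J - {i}) f"
proof -
  have "(\<Prod>j\<in>J \<inter> {..<m}. f j) = (\<Prod>j\<in>(J-{i}) \<inter> {..<m}. f j)" for m
    using assms by (intro prod.mono_neutral_right) auto
  then show ?thesis unfolding iprod_def by simp
qed

text \<open>Both limits are at most 1, hence finite, and multiplication in \<open>ennreal\<close> is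
  continuous there. Two infinite products thus become one decreasing sequence with a common cutoff
  \<open>m\<close>.\<close>

lemma iprod_mult_iprod:
  assumes "\<And>j. j \<in> J \<Longrightarrow> f j \<le> 1" "\<And>j. j \<in> K \<Longrightarrow> g j \<le> 1"
  shows "iprod J f * iprod K g
    = (INF m. (\<Prod>j\<in>J \<inter> {..<m}. f j) * (\<Prod>j\<in>K \<inter> {..<m}. g j))"
proof -
  have le1: "iprod J f \<noteq> top" "iprod K g \<noteq> top"
    using iprod_le_1[of J f] iprod_le_1[of K g] by (auto simp: top_unique)
  have "(\<lambda>m. (\<Prod>j\<in>J \<inter> {..<m}. f j) * (\<Prod>j\<in>K \<inter> {..<m}. g j)) \<longlonglongrightarrow> iprod J f * iprod K g"
    using le1 assms by (intro tendsto_mult_ennreal LIMSEQ_iprod) auto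
  moreover have "(\<lambda>m. (\<Prod>j\<in>J \<inter> {..<m}. f j) * (\<Prod>j\<in>K \<inter> {..<m}. g j))
      \<longlonglongrightarrow> (INF m. (\<Prod>j\<in>J \<inter> {..<m}. f j) * (\<Prod>j\<in>K \<inter> {..<m}. g j))"
    using decseq_prod_Int_lessThan[of J f] decseq_prod_Int_lessThan[of K g] assms
    by (intro LIMSEQ_INF) (auto simp: decseq_def intro!: mult_mono)
  ultimately show ?thesis by (rule LIMSEQ_unique)
qed

text \<open>The infima over \<open>n\<close> and over the cutoff commute, so only finite products
  matter; there the infimum is a limit of decreasing factors, all of them finite.\<close>

lemma iprod_INF:
  assumes dec: "\<And>j. decseq (\<lambda>n. f n j)" and le1: "\<And>n j. f n j \<le> 1"
  shows "(INF n. iprod J (f n)) = iprod J (\<lambda>j. INF n. f n j)"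
proof -
  have "(\<Prod>j\<in>A. INF n. f n j) = (INF n. \<Prod>j\<in>A. f n j)" if "finite A" for A
  proof -
    have ne: "(INF n. f n j) \<noteq> top" for j
      using order_trans[OF INF_lower[of 0 UNIV "\<lambda>n. f n j"] le1[of 0 j]]
      by (metis UNIV_I ennreal_one_neq_top top_unique)
    have "(\<lambda>n. \<Prod>j\<in>A. f n j) \<longlonglongrightarrow> (\<Prod>j\<in>A. INF n. f n j)"
      using that
    proof induction
      case (insert a A)
      have "(\<Prod>j\<in>A. INF n. f n j) \<le> 1"
        by (intro prod_le_1) (auto intro: INF_lower2[of 0] le1)
      then have "(\<Prod>j\<in>A. INF n. f n j) \<noteq> top" by (auto simp: top_unique)
      then have "(\<lambda>n. f n a * (\<Prod>j\<in>A. f n j)) \<longlonglongrightarrow> (INF n. f n a) * (\<Prod>j\<in>A. INF n. f n j)"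
        using insert.IH ne[of a] by (intro tendsto_mult_ennreal LIMSEQ_INF dec) (auto simp only: infinity_ennreal_def)
      with insert.hyps show ?case by simp
    qed simp
    moreover have "(\<lambda>n. \<Prod>j\<in>A. f n j) \<longlonglongrightarrow> (INF n. \<Prod>j\<in>A. f n j)"
      using dec by (intro LIMSEQ_INF) (auto simp: decseq_def intro!: prod_mono_ennreal)
    ultimately show ?thesis by (rule LIMSEQ_unique)
  qed
  then show ?thesis unfolding iprod_def by (subst INF_commute) auto
qed

lemma borel_measurable_iprod [measurable (raw)]:
  assumes "\<And>j. j \<in> J \<Longrightarrow> f j \<in> borel_measurable N"
  shows "(\<lambda>w. iprod J (\<lambda>j. f j w)) \<in> borel_measurable N"
proof -
  have "(\<lambda>w. \<Prod>j\<in>J \<inter> {..<m}. f j w) \<in> borel_measurable N" for m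
    by (rule borel_measurable_prod_ennreal) (use assms in auto)
  then show ?thesis
    unfolding iprod_def by (intro borel_measurable_INF) auto
qed

section \<open>Products of zero-one factors and the access indicators\<close>

lemma iprod_indicator:
  "iprod J (\<lambda>j. of_bool (P j)) = (of_bool (\<forall>j\<in>J. P j) :: ennreal)"
proof (cases "\<forall>j\<in>J. P j")
  case True
  then show ?thesis by (subst iprod_eq_prod[of "{}"]) auto
next
  case False
  then obtain j where "j \<in> J" "\<not> P j" by auto
  then show ?thesis by (subst iprod_eq_0[of j]) auto
qed

text \<open>A vanishing factor makes all later partial products 0, so the limit in
  \<open>product_over\<close> exists for every index set.\<close>

lemma product_over_of_bool:
  "product_over J (\<lambda>j. of_bool (P j)) = of_bool (\<forall>j\<in>J. P j)"
proof -
  have "(\<lambda>n. \<Prod>j\<in>J \<inter> {..<n}. of_bool (P j) :: real) \<longlonglongrightarrow> of_bool (\<forall>j\<in>J. P j)"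
  proof (cases "\<forall>j\<in>J. P j")
    case False
    then obtain i where i: "i \<in> J" "\<not> P i" by auto
    have "(\<Prod>j\<in>J \<inter> {..<n}. of_bool (P j) :: real) = 0" if "n \<ge> Suc i" for n
      using i that by (intro prod_zero) (auto intro!: bexI[of _ i])
    then show ?thesis
      using False by (auto intro!: tendsto_eventually eventually_sequentiallyI[of "Suc i"])
  qed auto
  then show ?thesis unfolding product_over_def by (rule limI)
qed

lemma backoff_indicator_eq:
  "backoff_indicator l c z t G i
    = of_bool (\<forall>j\<in>UNIV - {i}. t i \<le> t j \<or> G j i / l (norm (z j - z i)) \<le> c)"
proof -
  have "(\<lambda>j. of_bool (t j \<ge> t i) + of_bool (t j < t i) * of_bool (G j i / l (norm (z j - z i)) \<le> c))
    = (\<lambda>j. of_bool (t i \<le> t j \<or> G j i / l (norm (z j - z i)) \<le> c) :: real)"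
    by (auto simp: fun_eq_iff)
  then show ?thesis unfolding backoff_indicator_def by (simp only: product_over_of_bool)
qed

lemma lte_access_eq_1_iff:
  "lte_access l PW PL \<Gamma>L x y tL GWL GL k = 1 \<longleftrightarrow>
     (\<forall>j. GWL j k / l (norm (x j - y k)) \<le> \<Gamma>L / PW) \<and>
     (\<forall>j\<in>UNIV - {k}. tL k \<le> tL j \<or> GL j k / l (norm (y j - y k)) \<le> \<Gamma>L / PL)"
proof -
  have *: "of_bool P * of_bool Q = (1::real) \<longleftrightarrow> P \<and> Q" for P Q
    by simp
  show ?thesis
    unfolding lte_access_def backoff_indicator_eq product_over_of_bool * by blast
qed

lemma measurable_closest_index [measurable (raw)]:
  assumes [measurable]: "\<And>i. x i \<in> borel_measurable N"
  shows "(\<lambda>w. closest_index (\<lambda>i. x i w)) \<in> measurable N (count_space UNIV)"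
proof -
  have "Measurable.pred N (\<lambda>w. \<forall>j. norm (x i w) \<le> norm (x j w))" for i
    by measurable
  then show ?thesis
    unfolding closest_index_def by (rule measurable_Least)
qed

section \<open>Averaging over independent sources\<close>

locale indep_sources = prob_space M for M :: "'a measure" +
  fixes F :: "'s \<Rightarrow> 'a set set" and I :: "'s set"
  assumes indep: "indep_sets F I"
    and Int_stable: "\<And>s. s \<in> I \<Longrightarrow> Int_stable (F s)"
begin

text \<open>Generators outside \<open>I\<close> are dropped, so \<open>S\<close> may be any set,
  such as \<open>UNIV\<close>, although nothing is known of \<open>F\<close> there.\<close>

definition src :: "'s set \<Rightarrow> 'a measure" where
  "src S = sigma (space M) (\<Union>s\<in>S \<inter> I. F s)"

lemma F_subset: "s \<in> I \<Longrightarrow> F s \<subseteq> events"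
  using indep unfolding indep_sets_def by auto

lemma space_src [simp]: "space (src S) = space M"
  unfolding src_def using F_subset sets.sets_into_space by (intro space_measure_of) blast

lemma sets_src: "sets (src S) = sigma_sets (space M) (\<Union>s\<in>S \<inter> I. F s)"
  unfolding src_def using F_subset sets.sets_into_space by (intro sets_measure_of) blast

lemma subalgebra_src: "subalgebra M (src S)"
  unfolding subalgebra_def sets_src using F_subset by (auto intro!: sets.sigma_sets_subset)

lemma measurable_src_mono:
  assumes "f \<in> measurable (src S) N" "S \<subseteq> T"
  shows "f \<in> measurable (src T) N"
proof -
  have "sets (src S) \<subseteq> sets (src T)"
    unfolding sets_src using assms(2) by (intro sigma_sets_mono') auto
  with assms(1) show ?thesis
    using measurable_mono[of N N "src S" "src T"] by auto
qed

lemma measurable_src_imp: "f \<in> measurable (src S) N \<Longrightarrow> f \<in> measurable M N"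
  by (rule measurable_from_subalg[OF subalgebra_src])

lemma measurable_vimage_src:
  assumes "s \<in> S" "s \<in> I" "F s = sets (vimage_algebra (space M) f N)" "f \<in> space M \<rightarrow> space N"
  shows "f \<in> measurable (src S) N"
proof (rule measurableI)
  fix A assume "A \<in> sets N"
  then have "f -` A \<inter> space M \<in> F s"
    unfolding assms(3) by (rule in_vimage_algebra)
  then show "f -` A \<inter> space (src S) \<in> sets (src S)"
    unfolding sets_src using assms(1,2) by (auto intro!: sigma_sets.Basic)
qed (use assms(4) in auto)

text \<open>Independence of two sigma-algebras, recast as a product measure: the law of
  \<open>(w, w)\<close> gives a rectangle the mass of \<open>A \<inter> B\<close>, which factorises.
  In this form Fubini applies without naming any random variables.\<close>

lemma distr_diagonal:
  assumes "S \<inter> T = {}"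
  shows "distr M (src S \<Otimes>\<^sub>M src T) (\<lambda>w. (w, w))
    = restr_to_subalg M (src S) \<Otimes>\<^sub>M restr_to_subalg M (src T)"
proof (rule pair_measure_eqI[symmetric])
  have prob: "prob_space (restr_to_subalg M (src U))" for U
    using prob_space_restr_to_subalg[OF subalgebra_src] prob_space_axioms .
  show "sigma_finite_measure (restr_to_subalg M (src S))" "sigma_finite_measure (restr_to_subalg M (src T))"
    using prob by (simp_all add: prob_space_imp_sigma_finite)
  show "sets (restr_to_subalg M (src S) \<Otimes>\<^sub>M restr_to_subalg M (src T))
      = sets (distr M (src S \<Otimes>\<^sub>M src T) (\<lambda>w. (w, w)))"
    by (simp add: sets_restr_to_subalg[OF subalgebra_src] cong: sets_pair_measure_cong)
  have dis: "disjoint_family_on (case_bool (S \<inter> I) (T \<inter> I)) UNIV"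
    using assms by (auto simp: disjoint_family_on_def split: bool.splits)
  have "indep_sets (\<lambda>b. sigma_sets (space M) (\<Union>s\<in>case_bool (S \<inter> I) (T \<inter> I) b. F s)) UNIV"
    by (rule indep_sets_collect_sigma[OF indep_sets_mono_index[OF _ indep] _ dis])
       (auto intro: Int_stable split: bool.splits)
  then have "indep_sets (case_bool (sets (src S)) (sets (src T))) UNIV"
    by (rule iffD1[OF indep_sets_cong, rotated 2]) (auto simp: sets_src split: bool.splits)
  then have ind: "indep_set (sets (src S)) (sets (src T))"
    by (simp add: indep_set_def)
  fix A B assume "A \<in> sets (restr_to_subalg M (src S))" "B \<in> sets (restr_to_subalg M (src T))"
  then have A: "A \<in> sets (src S)" and B: "B \<in> sets (src T)"
    by (simp_all add: sets_restr_to_subalg[OF subalgebra_src])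
  have [measurable]: "(\<lambda>w. (w, w)) \<in> measurable M (src S \<Otimes>\<^sub>M src T)"
    by (intro measurable_Pair measurable_src_imp[OF measurable_ident_sets]) auto
  have "emeasure (distr M (src S \<Otimes>\<^sub>M src T) (\<lambda>w. (w, w))) (A \<times> B) = emeasure M (A \<inter> B)"
    using A B sets.sets_into_space[OF A] by (subst emeasure_distr) (auto intro!: arg_cong2[where f=emeasure])
  also have "\<dots> = emeasure M A * emeasure M B"
    using indep_setD[OF ind A B] by (simp add: emeasure_eq_measure ennreal_mult)
  finally show "emeasure (restr_to_subalg M (src S)) A * emeasure (restr_to_subalg M (src T)) B
      = emeasure (distr M (src S \<Otimes>\<^sub>M src T) (\<lambda>w. (w, w))) (A \<times> B)"
    by (simp add: emeasure_restr_to_subalg[OF subalgebra_src] A B)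
qed

text \<open>Tonelli under the law of the diagonal. The copy \<open>w'\<close> redraws the sources in
  \<open>T\<close> while those in \<open>S\<close> are kept, so the inner integral plays the role of
  a conditional expectation given \<open>src S\<close>.\<close>

lemma nn_integral_decouple:
  assumes "S \<inter> T = {}" and h: "h \<in> borel_measurable (src S \<Otimes>\<^sub>M src T)"
  shows "(\<integral>\<^sup>+w. h (w, w) \<partial>M) = (\<integral>\<^sup>+w. \<integral>\<^sup>+w'. h (w, w') \<partial>M \<partial>M)"
proof -
  let ?S = "restr_to_subalg M (src S)" and ?T = "restr_to_subalg M (src T)"
  have prob: "prob_space (restr_to_subalg M (src U))" for U
    using prob_space_restr_to_subalg[OF subalgebra_src] prob_space_axioms .
  interpret T: sigma_finite_measure ?T
    using prob by (simp add: prob_space_imp_sigma_finite)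
  have [measurable]: "(\<lambda>w. (w, w)) \<in> measurable M (src S \<Otimes>\<^sub>M src T)"
    by (intro measurable_Pair measurable_src_imp[OF measurable_ident_sets]) auto
  have h': "h \<in> borel_measurable (?S \<Otimes>\<^sub>M ?T)"
    using h by (simp add: sets_restr_to_subalg[OF subalgebra_src] cong: measurable_cong_sets sets_pair_measure_cong)
  have sec: "(\<lambda>w'. h (w, w')) \<in> borel_measurable (src T)" if "w \<in> space M" for w
    using h that by (auto intro: measurable_compose_Pair1)
  have out: "(\<lambda>w. \<integral>\<^sup>+w'. h (w, w') \<partial>?T) \<in> borel_measurable (src S)"
    using T.borel_measurable_nn_integral_fst[OF h']
    by (simp add: sets_restr_to_subalg[OF subalgebra_src] cong: measurable_cong_sets)
  have "(\<integral>\<^sup>+w. h (w, w) \<partial>M) = (\<integral>\<^sup>+p. h p \<partial>distr M (src S \<Otimes>\<^sub>M src T) (\<lambda>w. (w, w)))"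
    using h by (subst nn_integral_distr) auto
  also have "\<dots> = (\<integral>\<^sup>+w. \<integral>\<^sup>+w'. h (w, w') \<partial>?T \<partial>?S)"
    unfolding distr_diagonal[OF assms(1)] by (rule T.nn_integral_fst[OF h', symmetric])
  also have "\<dots> = (\<integral>\<^sup>+w. \<integral>\<^sup>+w'. h (w, w') \<partial>?T \<partial>M)"
    by (rule nn_integral_subalgebra2[OF subalgebra_src out])
  also have "\<dots> = (\<integral>\<^sup>+w. \<integral>\<^sup>+w'. h (w, w') \<partial>M \<partial>M)"
    by (intro nn_integral_cong nn_integral_subalgebra2[OF subalgebra_src sec])
  finally show ?thesis .
qed

lemma borel_measurable_nn_integral_src:
  assumes h: "h \<in> borel_measurable (src S \<Otimes>\<^sub>M src T)"
  shows "(\<lambda>w. \<integral>\<^sup>+w'. h (w, w') \<partial>M) \<in> borel_measurable (src S)"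
proof -
  have "(\<lambda>p. (fst p, snd p)) \<in> measurable (src S \<Otimes>\<^sub>M M) (src S \<Otimes>\<^sub>M src T)"
    by (intro measurable_Pair measurable_fst
        measurable_compose[OF measurable_snd measurable_src_imp[OF measurable_ident_sets[OF refl]]])
  then have "(\<lambda>p. p) \<in> measurable (src S \<Otimes>\<^sub>M M) (src S \<Otimes>\<^sub>M src T)"
    by simp
  then have "h \<in> borel_measurable (src S \<Otimes>\<^sub>M M)"
    using h by (rule measurable_compose)
  then show ?thesis
    by (rule borel_measurable_nn_integral_fst)
qed

text \<open>Factors are averaged one at a time. An averaged factor depends on the sources in
  \<open>S\<close> only and is absorbed into \<open>\<phi>\<close>, which is why the induction
  generalises \<open>\<phi>\<close>.\<close>

lemma nn_integral_decouple_prod: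
  assumes "finite J"
    and "\<phi> \<in> borel_measurable (src S)"
    and "\<And>j. j \<in> J \<Longrightarrow> h j \<in> borel_measurable (src S \<Otimes>\<^sub>M src (T j))"
    and "\<And>j. j \<in> J \<Longrightarrow> S \<inter> T j = {}" "disjoint_family_on T J"
  shows "(\<integral>\<^sup>+w. \<phi> w * (\<Prod>j\<in>J. h j (w, w)) \<partial>M)
    = (\<integral>\<^sup>+w. \<phi> w * (\<Prod>j\<in>J. \<integral>\<^sup>+w'. h j (w, w') \<partial>M) \<partial>M)"
  using assms
proof (induction J arbitrary: \<phi>)
  case (insert k J)
  \<comment> \<open>All sources read by \<open>\<phi>\<close> and the factors in \<open>J\<close>.
    They are disjoint from \<open>T k\<close>, so factor \<open>k\<close> can be averaged while the
    others are still random.\<close>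
  let ?U = "S \<union> (\<Union>j\<in>J. T j)"
  have [measurable]: "\<phi> \<in> borel_measurable (src ?U)"
    using measurable_src_mono insert.prems(1) by blast
  have id1: "(\<lambda>p. fst p) \<in> measurable (src ?U \<Otimes>\<^sub>M N) (src A)" if "A \<subseteq> ?U" for A and N :: "'a measure"
    using measurable_src_mono[OF measurable_id that] measurable_compose[OF measurable_fst] by (auto simp: id_def)
  have hj: "(\<lambda>p. h j (fst p, fst p)) \<in> borel_measurable (src ?U \<Otimes>\<^sub>M src (T k))" if "j \<in> J" for j
    by (rule measurable_compose[OF _ insert.prems(2)[of j]])
       (use that in \<open>auto intro!: measurable_Pair id1\<close>)
  have hk: "h k \<in> borel_measurable (src ?U \<Otimes>\<^sub>M src (T k))"
  proof -
    have "(\<lambda>p. (fst p, snd p)) \<in> measurable (src ?U \<Otimes>\<^sub>M src (T k)) (src S \<Otimes>\<^sub>M src (T k))"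
      by (intro measurable_Pair id1 measurable_snd) auto
    from measurable_compose[OF this insert.prems(2)[of k]] show ?thesis by simp
  qed
  have disj: "?U \<inter> T k = {}"
    using insert.prems(3)[of k] insert.prems(4) insert.hyps
    by (auto simp: disjoint_family_on_def)
  have "(\<integral>\<^sup>+w. \<phi> w * (\<Prod>j\<in>insert k J. h j (w, w)) \<partial>M)
      = (\<integral>\<^sup>+w. (\<lambda>p. \<phi> (fst p) * (\<Prod>j\<in>J. h j (fst p, fst p)) * h k p) (w, w) \<partial>M)"
    using insert.hyps by (simp add: ac_simps)
  also have "\<dots> = (\<integral>\<^sup>+w. \<integral>\<^sup>+w'. (\<phi> w * (\<Prod>j\<in>J. h j (w, w))) * h k (w, w') \<partial>M \<partial>M)"
    by (subst nn_integral_decouple[OF disj])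
       (auto intro!: borel_measurable_times_ennreal borel_measurable_prod_ennreal hj hk)
  also have "\<dots> = (\<integral>\<^sup>+w. (\<phi> w * (\<integral>\<^sup>+w'. h k (w, w') \<partial>M)) * (\<Prod>j\<in>J. h j (w, w)) \<partial>M)"
  proof (intro nn_integral_cong)
    fix w assume "w \<in> space M"
    then have "(\<lambda>w'. h k (w, w')) \<in> borel_measurable (src (T k))"
      by (intro measurable_compose_Pair1[OF _ insert.prems(2)[of k]]) auto
    then have "(\<lambda>w'. h k (w, w')) \<in> borel_measurable M"
      by (rule measurable_src_imp)
    then show "(\<integral>\<^sup>+w'. (\<phi> w * (\<Prod>j\<in>J. h j (w, w))) * h k (w, w') \<partial>M)
       = (\<phi> w * (\<integral>\<^sup>+w'. h k (w, w') \<partial>M)) * (\<Prod>j\<in>J. h j (w, w))"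
      by (subst nn_integral_cmult) (auto simp: ac_simps)
  qed
  also have "\<dots> = (\<integral>\<^sup>+w. (\<phi> w * (\<integral>\<^sup>+w'. h k (w, w') \<partial>M)) * (\<Prod>j\<in>J. \<integral>\<^sup>+w'. h j (w, w') \<partial>M) \<partial>M)"
    using insert.prems insert.hyps
    by (intro insert.IH) (auto intro!: borel_measurable_times_ennreal borel_measurable_nn_integral_src
        simp: disjoint_family_on_def)
  also have "\<dots> = (\<integral>\<^sup>+w. \<phi> w * (\<Prod>j\<in>insert k J. \<integral>\<^sup>+w'. h j (w, w') \<partial>M) \<partial>M)"
    using insert.hyps by (simp add: ac_simps)
  finally show ?case .
qed simp

end

section \<open>The generating functional of a Poisson process\<close>

locale ppp = prob_space M for M :: "'a measure" +
  fixes lam :: real and X :: "nat \<Rightarrow> 'a \<Rightarrow> real \<times> real"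
  assumes poisson: "poisson_point_process M lam X" and lam_pos: "lam > 0"
begin

lemma measurable_X [measurable]: "X i \<in> borel_measurable M"
  using poisson unfolding poisson_point_process_def by blast

lemma AE_locally_finite: "AE w in M. \<forall>r. finite {i. X i w \<in> cball 0 r}"
  using poisson unfolding poisson_point_process_def by blast

definition npoints :: "(real \<times> real) set \<Rightarrow> 'a \<Rightarrow> nat" where
  "npoints A w = card {i. X i w \<in> A}"

lemma indep_npoints:
  assumes "finite \<A>" "disjoint \<A>" "\<And>A. A \<in> \<A> \<Longrightarrow> A \<in> sets borel" "\<And>A. A \<in> \<A> \<Longrightarrow> bounded A"
  shows "indep_vars (\<lambda>_. count_space UNIV) npoints \<A>"
proof -
  have "indep_vars (\<lambda>_. count_space UNIV) (\<lambda>A w. card {i. X i w \<in> A}) \<A>"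
    using poisson assms unfolding poisson_point_process_def by blast
  then show ?thesis unfolding npoints_def[abs_def] .
qed

lemma measurable_npoints:
  assumes "A \<in> sets borel" "bounded A"
  shows "npoints A \<in> measurable M (count_space UNIV)"
  using indep_npoints[of "{A}"] assms by (auto simp: indep_vars_def disjoint_def)

lemma emeasure_npoints:
  assumes "A \<in> sets borel" "bounded A"
  shows "emeasure M {w \<in> space M. npoints A w = n}
    = ennreal ((lam * measure lborel A) ^ n / fact n * exp (- (lam * measure lborel A)))"
proof -
  have "measure M {w \<in> space M. card {i. X i w \<in> A} = n}
    = (lam * measure lborel A) ^ n / fact n * exp (- (lam * measure lborel A))"
    using poisson assms unfolding poisson_point_process_def by blast
  then show ?thesis
    by (simp add: emeasure_eq_measure npoints_def)
qed

lemma nn_integral_npoints: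
  fixes h :: "nat \<Rightarrow> ennreal"
  assumes A: "A \<in> sets borel" "bounded A"
  shows "(\<integral>\<^sup>+w. h (npoints A w) \<partial>M)
    = (\<Sum>n. h n * ennreal ((lam * measure lborel A) ^ n / fact n * exp (- (lam * measure lborel A))))"
proof -
  note [measurable] = measurable_npoints[OF A]
  have "(\<integral>\<^sup>+w. h (npoints A w) \<partial>M)
      = (\<integral>\<^sup>+w. (\<Sum>n. h n * indicator {w \<in> space M. npoints A w = n} w) \<partial>M)"
  proof (intro nn_integral_cong)
    fix w assume "w \<in> space M"
    then have "(\<Sum>n. h n * indicator {w \<in> space M. npoints A w = n} w)
        = (\<Sum>n\<in>{npoints A w}. h n * indicator {w \<in> space M. npoints A w = n} w)"
      by (intro suminf_finite) auto
    then show "h (npoints A w) = (\<Sum>n. h n * indicator {w \<in> space M. npoints A w = n} w)"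
      using \<open>w \<in> space M\<close> by simp
  qed
  also have "\<dots> = (\<Sum>n. h n * emeasure M {w \<in> space M. npoints A w = n})"
    by (simp add: nn_integral_suminf nn_integral_cmult)
  finally show ?thesis by (simp add: emeasure_npoints[OF A])
qed

text \<open>The probability generating function of a Poisson variable, from the exponential series
  at \<open>s * a\<close> with \<open>a = lam * measure lborel A\<close>.\<close>

lemma nn_integral_power_npoints:
  assumes A: "A \<in> sets borel" "bounded A" and "0 \<le> s" "s \<le> 1"
  shows "(\<integral>\<^sup>+w. ennreal s ^ npoints A w \<partial>M) = ennreal (exp (- (lam * measure lborel A * (1 - s))))"
proof -
  let ?a = "lam * measure lborel A"
  have a: "?a \<ge> 0" using lam_pos by simp
  have "(\<lambda>n. (s * ?a) ^ n /\<^sub>R fact n) sums exp (s * ?a)"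
    by (rule exp_converges)
  then have "(\<lambda>n. (s * ?a) ^ n /\<^sub>R fact n * exp (- ?a)) sums (exp (s * ?a) * exp (- ?a))"
    by (rule sums_mult2)
  then have *: "(\<lambda>n. s ^ n * (?a ^ n / fact n * exp (- ?a))) sums exp (- (?a * (1 - s)))"
    by (simp add: power_mult_distrib field_simps flip: exp_add)
  have "(\<integral>\<^sup>+w. ennreal s ^ npoints A w \<partial>M)
      = (\<Sum>n. ennreal (s ^ n * (?a ^ n / fact n * exp (- ?a))))"
    unfolding nn_integral_npoints[OF A, of "\<lambda>n. ennreal s ^ n"]
    using a assms(3) by (subst ennreal_mult) (auto simp: ennreal_power)
  also have "\<dots> = ennreal (exp (- (?a * (1 - s))))"
    using * a assms(3) by (intro suminf_ennreal_eq) auto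
  finally show ?thesis .
qed

text \<open>Grouping the points by the value of \<open>v\<close> turns the product into powers of
  counts in disjoint level sets, which are independent Poisson variables. The factor
  \<open>h (npoints C w)\<close> allows the number of points to be prescribed in a set where
  \<open>v\<close> is 1, as the ring argument requires.\<close>

lemma pgfl_simple:
  fixes h :: "nat \<Rightarrow> ennreal" and v :: "real \<times> real \<Rightarrow> real"
  assumes v [measurable]: "v \<in> borel_measurable borel" and v01: "\<And>z. 0 \<le> v z" "\<And>z. v z \<le> 1"
    and fin: "finite (range v)" and bdd: "bounded {z. v z \<noteq> 1}"
    and C: "C \<in> sets borel" "bounded C" "\<And>z. z \<in> C \<Longrightarrow> v z = 1"
  shows "(\<integral>\<^sup>+w. h (npoints C w) * iprod UNIV (\<lambda>j. ennreal (v (X j w))) \<partial>M)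
    = (\<integral>\<^sup>+w. h (npoints C w) \<partial>M) * ennreal (exp (- (lam * (LBINT z. 1 - v z))))"
proof -
  \<comment> \<open>The level 1 is left out: its points contribute factors 1, and its level set is
    unbounded.\<close>
  define V where "V = range v - {1}"
  define L where "L s = v -` {s}" for s
  \<comment> \<open>Independence is indexed by the sets themselves, so a level has to be recovered
    from its level set by choice. The case \<open>A = C\<close> carries \<open>h\<close>.\<close>
  define G where "G A n = (if A = C then h n else ennreal (v (SOME z. z \<in> A)) ^ n)" for A n
  have finV: "finite V" using fin by (simp add: V_def)
  have L: "L s \<in> sets borel" "bounded (L s)" if "s \<in> V" for s
  proof -
    show "L s \<in> sets borel"
      using measurable_sets[OF v, of "{s}"] by (simp add: L_def)
    have "L s \<subseteq> {z. v z \<noteq> 1}"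
      using that by (auto simp: L_def V_def)
    then show "bounded (L s)"
      by (rule bounded_subset[OF bdd])
  qed
  have Lne: "L s \<noteq> {}" "L s \<noteq> C" if "s \<in> V" for s
    using that C(3) by (auto simp: L_def V_def)
  have GL: "G (L s) n = ennreal s ^ n" if "s \<in> V" for s n
  proof -
    have "(SOME z. z \<in> L s) \<in> L s"
      using Lne[OF that] some_in_eq by blast
    then have "v (SOME z. z \<in> L s) = s" by (simp add: L_def)
    then show ?thesis using Lne[OF that] by (simp add: G_def)
  qed
  have inj: "inj_on L V"
    using Lne(1) by (fastforce simp: inj_on_def L_def)
  have ind: "indep_vars (\<lambda>_. count_space UNIV) npoints (insert C (L ` V))"
  proof (rule indep_npoints)
    show "disjoint (insert C (L ` V))"
      using C(3) by (auto simp: disjoint_def L_def V_def)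
  qed (use finV L C in auto)
  have indG: "indep_vars (\<lambda>_. borel) (\<lambda>A w. G A (npoints A w)) (insert C (L ` V))"
    using indep_vars_compose2[OF ind, of G "\<lambda>_. borel"] by simp
  have "AE w in M. iprod UNIV (\<lambda>j. ennreal (v (X j w))) = (\<Prod>s\<in>V. ennreal s ^ npoints (L s) w)"
    using AE_locally_finite
  proof eventually_elim
    case (elim w)
    define J where "J = {j. v (X j w) \<noteq> 1}"
    obtain r where "{z. v z \<noteq> 1} \<subseteq> cball 0 r"
      using bdd unfolding bounded_iff by fastforce
    then have "J \<subseteq> {j. X j w \<in> cball 0 r}"
      by (auto simp: J_def)
    then have finJ: "finite J"
      using elim finite_subset by blast
    have "iprod UNIV (\<lambda>j. ennreal (v (X j w))) = (\<Prod>j\<in>J. ennreal (v (X j w)))"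
      using finJ v01 by (intro iprod_eq_prod) (auto simp: J_def)
    also have "\<dots> = (\<Prod>s\<in>V. \<Prod>j\<in>{j\<in>J. v (X j w) = s}. ennreal (v (X j w)))"
      using finJ finV by (intro prod.group[symmetric]) (auto simp: J_def V_def)
    also have "\<dots> = (\<Prod>s\<in>V. ennreal s ^ npoints (L s) w)"
    proof (rule prod.cong[OF refl])
      fix s assume "s \<in> V"
      then have "{j\<in>J. v (X j w) = s} = {j. X j w \<in> L s}"
        by (auto simp: J_def V_def L_def)
      then show "(\<Prod>j\<in>{j\<in>J. v (X j w) = s}. ennreal (v (X j w))) = ennreal s ^ npoints (L s) w"
        by (simp add: npoints_def L_def)
    qed
    finally show ?case .
  qed
  then have "(\<integral>\<^sup>+w. h (npoints C w) * iprod UNIV (\<lambda>j. ennreal (v (X j w))) \<partial>M)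
      = (\<integral>\<^sup>+w. h (npoints C w) * (\<Prod>s\<in>V. ennreal s ^ npoints (L s) w) \<partial>M)"
    by (intro nn_integral_cong_AE) auto
  also have "\<dots> = (\<integral>\<^sup>+w. (\<Prod>A\<in>insert C (L ` V). G A (npoints A w)) \<partial>M)"
    using Lne finV by (intro nn_integral_cong, subst prod.insert)
      (auto simp: prod.reindex[OF inj] GL G_def[of C] intro!: prod.cong)
  also have "\<dots> = (\<Prod>A\<in>insert C (L ` V). \<integral>\<^sup>+w. G A (npoints A w) \<partial>M)"
    using finV by (intro indep_vars_nn_integral indG) auto
  also have "\<dots> = (\<integral>\<^sup>+w. h (npoints C w) \<partial>M) * (\<Prod>s\<in>V. \<integral>\<^sup>+w. ennreal s ^ npoints (L s) w \<partial>M)"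
    using Lne finV by (subst prod.insert)
      (auto simp: prod.reindex[OF inj] GL G_def[of C] intro!: prod.cong)
  also have "(\<Prod>s\<in>V. \<integral>\<^sup>+w. ennreal s ^ npoints (L s) w \<partial>M)
      = (\<Prod>s\<in>V. ennreal (exp (- (lam * measure lborel (L s) * (1 - s)))))"
    using L v01 by (intro prod.cong refl nn_integral_power_npoints) (auto simp: V_def)
  also have "\<dots> = ennreal (exp (\<Sum>s\<in>V. - (lam * measure lborel (L s) * (1 - s))))"
    using finV by (simp add: prod_ennreal exp_sum)
  also have "(\<Sum>s\<in>V. - (lam * measure lborel (L s) * (1 - s))) = - (lam * (LBINT z. 1 - v z))"
  proof -
    have int: "integrable lborel (\<lambda>z. (1 - s) * indicator (L s) z :: real)" if "s \<in> V" for s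
      using L[OF that] emeasure_bounded_finite[of "L s"] by auto
    have "(LBINT z. 1 - v z) = (LBINT z. \<Sum>s\<in>V. (1 - s) * indicator (L s) z)"
    proof (intro Bochner_Integration.integral_cong refl)
      fix z
      show "1 - v z = (\<Sum>s\<in>V. (1 - s) * indicator (L s) z)"
      proof (cases "v z = 1")
        case False
        then have "(\<Sum>s\<in>V. (1 - s) * indicator (L s) z) = (\<Sum>s\<in>{v z}. (1 - s) * indicator (L s) z)"
          using finV by (intro sum.mono_neutral_right) (auto simp: V_def L_def)
        then show ?thesis by (simp add: L_def)
      qed (auto simp: V_def L_def intro!: sum.neutral)
    qed
    also have "\<dots> = (\<Sum>s\<in>V. (1 - s) * measure lborel (L s))"
      using int by (subst Bochner_Integration.integral_sum) auto
    finally show ?thesis by (simp add: sum_distrib_left sum_negf mult_ac)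
  qed
  finally show ?thesis .
qed

text \<open>Step functions decreasing to \<open>v\<close> reduce this to the simple case. The
  products pass to the limit by \<open>iprod_INF\<close>, the integral in the exponent by domination
  with \<open>1 - v\<close>.\<close>

lemma pgfl:
  fixes h :: "nat \<Rightarrow> ennreal" and v :: "real \<times> real \<Rightarrow> real"
  assumes v [measurable]: "v \<in> borel_measurable borel" and v01: "\<And>z. 0 \<le> v z" "\<And>z. v z \<le> 1"
    and int: "integrable lborel (\<lambda>z. 1 - v z)"
    and C: "C \<in> sets borel" "bounded C" "\<And>z. z \<in> C \<Longrightarrow> v z = 1"
    and h: "\<And>n. h n \<le> 1"
  shows "(\<integral>\<^sup>+w. h (npoints C w) * iprod UNIV (\<lambda>j. ennreal (v (X j w))) \<partial>M)
    = (\<integral>\<^sup>+w. h (npoints C w) \<partial>M) * ennreal (exp (- (lam * (LBINT z. 1 - v z))))"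
proof -
  note [measurable] = measurable_npoints[OF C(1,2)]
  obtain f :: "nat \<Rightarrow> real \<times> real \<Rightarrow> real" where f: "incseq f" "\<And>i. simple_function borel (f i)"
    "\<And>z. bdd_above (range (\<lambda>i. f i z))" "\<And>i z. 0 \<le> f i z" "(\<lambda>z. 1 - v z) = (SUP i. f i)"
    using borel_measurable_implies_simple_function_sequence_real[of "\<lambda>z. 1 - v z" borel] v01
    by auto
  have f_mono: "f i z \<le> f j z" if "i \<le> j" for i j z
    using incseqD[OF f(1) that] by (rule le_funD)
  have f_sup: "1 - v z = (SUP i. f i z)" for z
    using fun_cong[OF f(5), of z] by (simp add: image_image)
  have f_le: "f i z \<le> 1 - v z" for i z
    unfolding f_sup by (rule cSUP_upper[OF _ f(3)]) simp
  have f_lim: "(\<lambda>i. f i z) \<longlonglongrightarrow> 1 - v z" for z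
    unfolding f_sup by (intro LIMSEQ_incseq_SUP f(3) incseq_SucI f_mono) simp
  \<comment> \<open>The cut-off to a disc makes \<open>u n\<close> equal to 1 outside a bounded set;
    approximating \<open>1 - v\<close> from below makes \<open>u n\<close> decrease to
    \<open>v\<close>.\<close>
  define u where "u n z = 1 - f n z * indicator (cball 0 (real n)) z" for n z
  have fm [measurable]: "f n \<in> borel_measurable borel" for n
    using f(2) by (rule borel_measurable_simple_function)
  have um [measurable]: "u n \<in> borel_measurable borel" for n
    unfolding u_def
    by (intro borel_measurable_diff borel_measurable_times borel_measurable_indicator borel_measurable_const fm) auto
  have u_le: "u n z \<le> 1" "v z \<le> u n z" "0 \<le> u n z" for n z
    using f(4)[of n z] f_le[of n z] v01[of z] by (auto simp: u_def indicator_def)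
  have u_dec: "u m z \<le> u n z" if "n \<le> m" for n m z
    using f_mono[OF that, of z] f(4)[of _ z] that by (auto simp: u_def indicator_def)
  have u_lim: "(\<lambda>n. u n z) \<longlonglongrightarrow> v z" for z
  proof -
    obtain n0 :: nat where "norm z \<le> real n0" using real_arch_simple by blast
    then have "eventually (\<lambda>n. 1 - f n z = u n z) sequentially"
      by (intro eventually_sequentiallyI[of n0]) (auto simp: u_def indicator_def)
    moreover have "(\<lambda>n. 1 - f n z) \<longlonglongrightarrow> 1 - (1 - v z)"
      by (intro tendsto_diff tendsto_const f_lim)
    ultimately show ?thesis
      by (simp add: tendsto_cong)
  qed
  have "(\<lambda>n. \<integral>\<^sup>+w. h (npoints C w) * iprod UNIV (\<lambda>j. ennreal (u n (X j w))) \<partial>M)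
      \<longlonglongrightarrow> (\<integral>\<^sup>+w. h (npoints C w) * iprod UNIV (\<lambda>j. ennreal (v (X j w))) \<partial>M)"
  proof (rule nn_integral_dominated_convergence[where w="\<lambda>_. 1"])
    show "AE w in M. h (npoints C w) * iprod UNIV (\<lambda>j. ennreal (u n (X j w))) \<le> 1" for n
      using h iprod_le_1 by (intro AE_I2 mult_le_one) auto
    have "(\<lambda>n. iprod UNIV (\<lambda>j. ennreal (u n (X j w)))) \<longlonglongrightarrow> iprod UNIV (\<lambda>j. ennreal (v (X j w)))" for w
    proof -
      have dec: "decseq (\<lambda>n. ennreal (u n z))" for z
        using u_dec u_le by (auto simp: decseq_def intro!: ennreal_leI)
      have "(INF n. ennreal (u n z)) = ennreal (v z)" for z
        using u_lim[of z] by (intro LIMSEQ_unique[OF LIMSEQ_INF[OF dec]] tendsto_ennrealI)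
      then have "iprod UNIV (\<lambda>j. ennreal (v (X j w))) = (INF n. iprod UNIV (\<lambda>j. ennreal (u n (X j w))))"
        using dec u_le by (subst iprod_INF) auto
      then show ?thesis
        by (simp only:) (intro LIMSEQ_INF decseq_SucI iprod_mono decseq_SucD[OF dec])
    qed
    moreover have "h (npoints C w) \<noteq> top" for w
      using h[of "npoints C w"] by (auto simp: top_unique)
    ultimately show "AE w in M. (\<lambda>n. h (npoints C w) * iprod UNIV (\<lambda>j. ennreal (u n (X j w))))
        \<longlonglongrightarrow> h (npoints C w) * iprod UNIV (\<lambda>j. ennreal (v (X j w)))"
      by (auto intro!: ennreal_tendsto_cmult simp: less_top)
  qed (auto simp: emeasure_space_1)
  moreover have "(\<integral>\<^sup>+w. h (npoints C w) * iprod UNIV (\<lambda>j. ennreal (u n (X j w))) \<partial>M)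
      = (\<integral>\<^sup>+w. h (npoints C w) \<partial>M) * ennreal (exp (- (lam * (LBINT z. 1 - u n z))))" for n
  proof (rule pgfl_simple)
    have "finite ((\<lambda>(a, b). 1 - a * b) ` (range (f n) \<times> {0, 1}))"
      using f(2)[of n] by (auto simp: simple_function_def)
    then show "finite (range (u n))"
      by (rule finite_subset[rotated]) (force simp: u_def indicator_def)
    have "{z. u n z \<noteq> 1} \<subseteq> cball 0 (real n)"
      by (auto simp: u_def indicator_def)
    then show "bounded {z. u n z \<noteq> 1}"
      using bounded_subset bounded_cball by blast
    show "u n z = 1" if "z \<in> C" for z
      using C(3)[OF that] u_le(1)[of n z] u_le(2)[of z n] by auto
  qed (use u_le C in auto)
  moreover have "(\<lambda>n. (\<integral>\<^sup>+w. h (npoints C w) \<partial>M) * ennreal (exp (- (lam * (LBINT z. 1 - u n z)))))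
      \<longlonglongrightarrow> (\<integral>\<^sup>+w. h (npoints C w) \<partial>M) * ennreal (exp (- (lam * (LBINT z. 1 - v z))))"
  proof (intro ennreal_tendsto_cmult tendsto_ennrealI tendsto_exp tendsto_minus tendsto_mult tendsto_const)
    have "(\<integral>\<^sup>+w. h (npoints C w) \<partial>M) \<le> (\<integral>\<^sup>+w. 1 \<partial>M)"
      using h by (intro nn_integral_mono) auto
    then show "(\<integral>\<^sup>+w. h (npoints C w) \<partial>M) < top"
      by (simp add: emeasure_space_1 le_less_trans)
    show "(\<lambda>n. LBINT z. 1 - u n z) \<longlonglongrightarrow> (LBINT z. 1 - v z)"
    proof (rule integral_dominated_convergence[where w="\<lambda>z. 1 - v z"])
      show "AE z in lborel. (\<lambda>n. 1 - u n z) \<longlonglongrightarrow> 1 - v z"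
        by (intro AE_I2 tendsto_diff tendsto_const u_lim)
      show "AE z in lborel. norm (1 - u n z) \<le> 1 - v z" for n
        using u_le by (intro AE_I2) simp
    qed (simp_all add: int)
  qed
  ultimately show ?thesis
    using LIMSEQ_unique by simp
qed

end

section \<open>Integration over the plane\<close>

lemma emeasure_cball_plane:
  "emeasure lborel (cball (0 :: real \<times> real) r) = ennreal (pi * (max 0 r)\<^sup>2)"
proof (cases "r \<ge> 0")
  case True
  then show ?thesis
    using emeasure_cball[of r "0 :: real \<times> real"] by (simp add: unit_ball_vol_2 power2_eq_square)
qed simp

text \<open>Polar coordinates for radial functions: on half-lines, a generator closed under
  intersection, both measures give the area of a disc.\<close>

lemma distr_norm_plane:
  "distr lborel borel (norm :: real \<times> real \<Rightarrow> real)
    = density lborel (\<lambda>r. ennreal (2 * pi * r) * indicator {0..} r)"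
proof (rule measure_eqI_generator_eq[where E="range atMost" and \<Omega>=UNIV and A="\<lambda>i. {..real i}"])
  show "Int_stable (range (atMost :: real \<Rightarrow> _))"
    by (auto simp: Int_stable_def)
  show "sets (distr lborel borel (norm :: real \<times> real \<Rightarrow> real)) = sigma_sets UNIV (range atMost)"
    "sets (density lborel (\<lambda>r. ennreal (2 * pi * r) * indicator {0..} r)) = sigma_sets UNIV (range atMost)"
    by (simp_all add: borel_eq_atMost)
  show "(\<Union>i. {..real i}) = UNIV"
    by (auto simp: real_arch_simple)
  have *: "emeasure (distr lborel borel (norm :: real \<times> real \<Rightarrow> real)) {..a} = ennreal (pi * (max 0 a)\<^sup>2)" for a
  proof -
    have "norm -` {..a} = cball (0 :: real \<times> real) a"
      by (rule set_eqI) (simp only: vimage_eq atMost_iff mem_cball_0)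
    then show ?thesis by (simp add: emeasure_distr emeasure_cball_plane)
  qed
  show "emeasure (distr lborel borel (norm :: real \<times> real \<Rightarrow> real)) {..real i} \<noteq> \<infinity>" for i
    unfolding * by simp
  fix A :: "real set" assume "A \<in> range atMost"
  then obtain a where A: "A = {..a}" by auto
  have "emeasure (density lborel (\<lambda>r. ennreal (2 * pi * r) * indicator {0..} r)) A
      = (\<integral>\<^sup>+r. ennreal (2 * pi * r) * indicator {0..a} r \<partial>lborel)"
    unfolding A by (subst emeasure_density) (auto intro!: nn_integral_cong simp: indicator_def)
  also have "\<dots> = ennreal (pi * (max 0 a)\<^sup>2)"
  proof (cases "0 \<le> a")
    case True
    then show ?thesis
      by (subst nn_integral_FTC_Icc[where F="\<lambda>r. pi * r\<^sup>2"]) (auto intro!: derivative_eq_intros)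
  qed simp
  finally show "emeasure (distr lborel borel (norm :: real \<times> real \<Rightarrow> real)) A
      = emeasure (density lborel (\<lambda>r. ennreal (2 * pi * r) * indicator {0..} r)) A"
    using * A by simp
qed auto

lemma nn_integral_radial:
  assumes [measurable]: "f \<in> borel_measurable borel"
  shows "(\<integral>\<^sup>+z. f (norm (z :: real \<times> real)) \<partial>lborel)
    = (\<integral>\<^sup>+r. ennreal (2 * pi * r) * indicator {0..} r * f r \<partial>lborel)"
proof -
  have "(\<integral>\<^sup>+z. f (norm (z :: real \<times> real)) \<partial>lborel) = (\<integral>\<^sup>+r. f r \<partial>distr lborel borel (norm :: real \<times> real \<Rightarrow> real))"
    by (subst nn_integral_distr) auto
  also have "\<dots> = (\<integral>\<^sup>+r. ennreal (2 * pi * r) * indicator {0..} r * f r \<partial>lborel)"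
    unfolding distr_norm_plane by (subst nn_integral_density) auto
  finally show ?thesis .
qed

text \<open>The integrand will turn out to be the density of the closest point. Its mass 1 yields
  the almost sure uniqueness of that point, and it also dominates the ring approximations.\<close>

lemma nn_integral_gaussian_plane:
  assumes "lam > 0"
  shows "(\<integral>\<^sup>+z. ennreal (lam * exp (- (lam * (pi * (norm (z :: real \<times> real))\<^sup>2)))) \<partial>lborel) = 1"
proof -
  have "(\<integral>\<^sup>+z. ennreal (lam * exp (- (lam * (pi * (norm (z :: real \<times> real))\<^sup>2)))) \<partial>lborel)
      = (\<integral>\<^sup>+r. ennreal (2 * pi * r * (lam * exp (- (lam * (pi * r\<^sup>2))))) * indicator {0..} r \<partial>lborel)"
    using assms
    by (subst nn_integral_radial[where f="\<lambda>r. ennreal (lam * exp (- (lam * (pi * r\<^sup>2))))"])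
       (auto intro!: nn_integral_cong simp: indicator_def ennreal_mult)
  also have "\<dots> = ennreal (0 - - exp (- (lam * (pi * 0\<^sup>2))))"
  proof (rule nn_integral_FTC_atLeast)
    show "((\<lambda>r. - exp (- (lam * (pi * r\<^sup>2)))) has_real_derivative 2 * pi * r * (lam * exp (- (lam * (pi * r\<^sup>2))))) (at r)" for r
      by (auto intro!: derivative_eq_intros)
    have "lam * pi > 0" using assms by simp
    then show "((\<lambda>r::real. - exp (- (lam * (pi * r\<^sup>2)))) \<longlongrightarrow> 0) at_top"
      using assms by real_asymp
  qed (use assms in auto)
  finally show ?thesis by simp
qed

lemma integrable_exp_powr_plane:
  fixes k \<alpha> :: real
  assumes k: "k > 0" and \<alpha>: "\<alpha> > 0"
  shows "integrable lborel (\<lambda>z :: real \<times> real. exp (- (k * norm z powr \<alpha>)))"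
proof (rule integrableI_nonneg)
  \<comment> \<open>The majorant \<open>1 / (1 + r)\<^sup>2\<close> has no singularity at 0 and an
    elementary antiderivative.\<close>
  have "eventually (\<lambda>r::real. r * exp (- (k * r powr \<alpha>)) \<le> 1 / (1 + r)\<^sup>2) at_top"
    using assms by real_asymp
  then obtain R where R: "\<And>r. r \<ge> R \<Longrightarrow> r * exp (- (k * r powr \<alpha>)) \<le> 1 / (1 + r)\<^sup>2"
    unfolding eventually_at_top_linorder by blast
  define R' where "R' = max 0 R"
  have "(\<integral>\<^sup>+z. ennreal (exp (- (k * norm (z :: real \<times> real) powr \<alpha>))) \<partial>lborel)
      = (\<integral>\<^sup>+r. ennreal (2 * pi * r) * indicator {0..} r * ennreal (exp (- (k * r powr \<alpha>))) \<partial>lborel)"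
    by (rule nn_integral_radial) measurable
  also have "\<dots> \<le> (\<integral>\<^sup>+r. ennreal (2 * pi * R') * indicator {0..R'} r
      + ennreal (2 * pi / (1 + r)\<^sup>2) * indicator {0..} r \<partial>lborel)"
  proof (rule nn_integral_mono)
    fix r :: real
    show "ennreal (2 * pi * r) * indicator {0..} r * ennreal (exp (- (k * r powr \<alpha>)))
      \<le> ennreal (2 * pi * R') * indicator {0..R'} r + ennreal (2 * pi / (1 + r)\<^sup>2) * indicator {0..} r"
    proof (cases "r \<ge> 0")
      case True
      show ?thesis
      proof (cases "r \<le> R'")
        case r: True
        have "r * exp (- (k * r powr \<alpha>)) \<le> R' * 1"
          using True r k by (intro mult_mono) auto
        then have "ennreal (2 * pi * r * exp (- (k * r powr \<alpha>))) \<le> ennreal (2 * pi * R')"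
          by (intro ennreal_leI) simp
        then show ?thesis using True r
          by (simp add: ennreal_mult'[symmetric] add_increasing2)
      next
        case False
        then have "2 * pi * (r * exp (- (k * r powr \<alpha>))) \<le> 2 * pi * (1 / (1 + r)\<^sup>2)"
          using R[of r] by (intro mult_left_mono) (auto simp: R'_def)
        then have "ennreal (2 * pi * r * exp (- (k * r powr \<alpha>))) \<le> ennreal (2 * pi / (1 + r)\<^sup>2)"
          by (intro ennreal_leI) (simp add: mult.assoc)
        then show ?thesis using True
          by (simp add: ennreal_mult'[symmetric] add_increasing)
      qed
    qed simp
  qed
  also have "\<dots> = (\<integral>\<^sup>+r. ennreal (2 * pi * R') * indicator {0..R'} r \<partial>lborel)
      + (\<integral>\<^sup>+r. ennreal (2 * pi / (1 + r)\<^sup>2) * indicator {0..} r \<partial>lborel)"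
    by (rule nn_integral_add) auto
  also have "(\<integral>\<^sup>+r. ennreal (2 * pi / (1 + r)\<^sup>2) * indicator {0..} r \<partial>lborel) = ennreal (0 - - 2 * pi / (1 + 0))"
  proof (rule nn_integral_FTC_atLeast)
    show "((\<lambda>r. - 2 * pi / (1 + r)) has_real_derivative 2 * pi / (1 + r)\<^sup>2) (at r)" if "0 \<le> r" for r :: real
      using that by (auto intro!: derivative_eq_intros simp: power2_eq_square)
    show "((\<lambda>r::real. - 2 * pi / (1 + r)) \<longlongrightarrow> 0) at_top"
      by real_asymp
  qed auto
  also have "(\<integral>\<^sup>+r. ennreal (2 * pi * R') * indicator {0..R'} r \<partial>lborel) + ennreal (0 - - 2 * pi / (1 + 0)) < \<infinity>"
    by (simp add: nn_integral_cmult ennreal_mult_less_top R'_def)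
  finally show "(\<integral>\<^sup>+z. ennreal (exp (- (k * norm (z :: real \<times> real) powr \<alpha>))) \<partial>lborel) < \<infinity>" .
qed auto

section \<open>Rotation invariance of planar Lebesgue measure\<close>

lemma borel_measurable_fst_snd:
  "(fst :: real \<times> real \<Rightarrow> real) \<in> borel_measurable borel"
  "(snd :: real \<times> real \<Rightarrow> real) \<in> borel_measurable borel"
  by (intro borel_measurable_continuous_onI continuous_intros)+

text \<open>By Fubini: on each horizontal line the shear is a translation.\<close>

lemma nn_integral_shear1:
  fixes f :: "real \<times> real \<Rightarrow> ennreal"
  assumes [measurable]: "f \<in> borel_measurable borel"
  shows "(\<integral>\<^sup>+z. f (fst z + k * snd z, snd z) \<partial>lborel) = (\<integral>\<^sup>+z. f z \<partial>lborel)"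
proof -
  note [measurable] = borel_measurable_fst_snd
  have fub: "(\<integral>\<^sup>+z. g z \<partial>lborel) = (\<integral>\<^sup>+y. \<integral>\<^sup>+x. g (x, y) \<partial>lborel \<partial>lborel)"
    if "g \<in> borel_measurable borel" for g :: "real \<times> real \<Rightarrow> ennreal"
    using that by (subst lborel_pair.nn_integral_snd) (auto simp: lborel_prod)
  have "(\<integral>\<^sup>+z. f (fst z + k * snd z, snd z) \<partial>lborel) = (\<integral>\<^sup>+y. \<integral>\<^sup>+x. f (k * y + 1 * x, y) \<partial>lborel \<partial>lborel)"
    by (subst fub, measurable) (simp add: add.commute)
  moreover have "(\<integral>\<^sup>+z. f z \<partial>lborel) = (\<integral>\<^sup>+y. \<integral>\<^sup>+x. f (x, y) \<partial>lborel \<partial>lborel)"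
    by (rule fub) measurable
  moreover have "(\<integral>\<^sup>+x. f (k * y + 1 * x, y) \<partial>lborel) = (\<integral>\<^sup>+x. f (x, y) \<partial>lborel)" for y
    using nn_integral_real_affine[of "\<lambda>x. f (x, y)" 1 "k * y"] by simp
  ultimately show ?thesis by simp
qed

lemma nn_integral_shear2:
  fixes f :: "real \<times> real \<Rightarrow> ennreal"
  assumes [measurable]: "f \<in> borel_measurable borel"
  shows "(\<integral>\<^sup>+z. f (fst z, snd z + k * fst z) \<partial>lborel) = (\<integral>\<^sup>+z. f z \<partial>lborel)"
proof -
  note [measurable] = borel_measurable_fst_snd
  have fub: "(\<integral>\<^sup>+z. g z \<partial>lborel) = (\<integral>\<^sup>+x. \<integral>\<^sup>+y. g (x, y) \<partial>lborel \<partial>lborel)"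
    if "g \<in> borel_measurable borel" for g :: "real \<times> real \<Rightarrow> ennreal"
    using that by (subst lborel.nn_integral_fst) (auto simp: lborel_prod)
  have "(\<integral>\<^sup>+z. f (fst z, snd z + k * fst z) \<partial>lborel) = (\<integral>\<^sup>+x. \<integral>\<^sup>+y. f (x, k * x + 1 * y) \<partial>lborel \<partial>lborel)"
    by (subst fub, measurable) (simp add: add.commute)
  moreover have "(\<integral>\<^sup>+z. f z \<partial>lborel) = (\<integral>\<^sup>+x. \<integral>\<^sup>+y. f (x, y) \<partial>lborel \<partial>lborel)"
    by (rule fub) measurable
  moreover have "(\<integral>\<^sup>+y. f (x, k * x + 1 * y) \<partial>lborel) = (\<integral>\<^sup>+y. f (x, y) \<partial>lborel)" for x
    using nn_integral_real_affine[of "\<lambda>y. f (x, y)" 1 "k * x"] by simp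
  ultimately show ?thesis by simp
qed

text \<open>A rotation by an angle other than \<open>\<pi>\<close> is a product of three shears.\<close>

lemma nn_integral_rotation:
  fixes f :: "real \<times> real \<Rightarrow> ennreal"
  assumes f: "f \<in> borel_measurable borel" and ab: "a\<^sup>2 + b\<^sup>2 = 1"
  shows "(\<integral>\<^sup>+z. f (a * fst z - b * snd z, b * fst z + a * snd z) \<partial>lborel) = (\<integral>\<^sup>+z. f z \<partial>lborel)"
proof -
  note [measurable] = borel_measurable_fst_snd
  have main: "(\<integral>\<^sup>+z. f (a * fst z - b * snd z, b * fst z + a * snd z) \<partial>lborel) = (\<integral>\<^sup>+z. f z \<partial>lborel)"
    if f [measurable]: "f \<in> borel_measurable borel" and ab: "a\<^sup>2 + b\<^sup>2 = 1" and a: "a \<noteq> -1"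
    for f :: "real \<times> real \<Rightarrow> ennreal" and a b
  proof -
    \<comment> \<open>With \<open>a = cos \<theta>\<close> and \<open>b = sin \<theta>\<close> this
      is \<open>- tan (\<theta> / 2)\<close>, which has a pole at the half-turn.\<close>
    define m where "m = - b / (1 + a)"
    have a1: "1 + a \<noteq> 0" using a by (auto simp: add_eq_0_iff)
    have "- (b\<^sup>2) = (a - 1) * (1 + a)"
      using ab by (simp add: algebra_simps power2_eq_square)
    moreover have m1: "m * (1 + a) = - b" using a1 by (simp add: m_def)
    then have "b * m * (1 + a) = - (b\<^sup>2)" by (simp add: mult.assoc power2_eq_square)
    ultimately have bm: "b * m = a - 1" using a1 by simp
    have x: "x + m * y + m * (b * x + a * y) = a * x - b * y" for x y
    proof -
      have "x + m * y + m * (b * x + a * y) = (1 + b * m) * x + (m * (1 + a)) * y"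
        by (simp add: algebra_simps)
      then show ?thesis by (simp add: bm m1)
    qed
    have y: "y + b * (x + m * y) = b * x + a * y" for x y
    proof -
      have "y + b * (x + m * y) = b * x + (1 + b * m) * y" by (simp add: algebra_simps)
      then show ?thesis by (simp add: bm)
    qed
    have "(\<integral>\<^sup>+z. f z \<partial>lborel) = (\<integral>\<^sup>+z. f (fst z + m * snd z, snd z) \<partial>lborel)"
      by (rule nn_integral_shear1[symmetric]) measurable
    also have "\<dots> = (\<integral>\<^sup>+z. (\<lambda>z. f (fst z + m * snd z, snd z)) (fst z, snd z + b * fst z) \<partial>lborel)"
      by (rule nn_integral_shear2[symmetric]) measurable
    also have "\<dots> = (\<integral>\<^sup>+z. (\<lambda>z. (\<lambda>z. f (fst z + m * snd z, snd z)) (fst z, snd z + b * fst z))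
        (fst z + m * snd z, snd z) \<partial>lborel)"
      by (rule nn_integral_shear1[symmetric]) measurable
    finally show ?thesis by (simp add: x y)
  qed
  show ?thesis
  proof (cases "a = -1")
    case False
    then show ?thesis using main f ab by simp
  next
    case True
    then have b: "b = 0" using ab by simp
    note [measurable] = f
    \<comment> \<open>The half-turn is the square of a quarter-turn, to which the previous case
      applies.\<close>
    define g where "g z = f (- snd z, fst z)" for z
    have g [measurable]: "g \<in> borel_measurable borel" unfolding g_def by measurable
    have "(\<integral>\<^sup>+z. f z \<partial>lborel) = (\<integral>\<^sup>+z. g z \<partial>lborel)"
      using main[OF f, of 0 1] by (simp add: g_def)
    also have "\<dots> = (\<integral>\<^sup>+z. g (- snd z, fst z) \<partial>lborel)"
      using main[OF g, of 0 1] by simp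
    finally show ?thesis by (simp add: True b g_def)
  qed
qed

text \<open>The rotation taking \<open>(norm z, 0)\<close> to \<open>z\<close> preserves area, norms
  and hence the exterior of the disc.\<close>

lemma nn_integral_outside_ball_rotate:
  fixes q :: "real \<Rightarrow> ennreal" and z :: "real \<times> real"
  assumes [measurable]: "q \<in> borel_measurable borel"
  shows "(\<integral>\<^sup>+y. indicator {y. norm y > norm z} y * q (norm (y - z)) \<partial>lborel)
    = (\<integral>\<^sup>+y. indicator {y. norm y > norm z} y * q (norm (y - (norm z, 0 :: real))) \<partial>lborel)"
proof -
  note [measurable] = borel_measurable_fst_snd
  obtain a b where ab: "a\<^sup>2 + b\<^sup>2 = 1" and z: "z = (norm z * a, norm z * b)"
  proof (cases "z = 0")
    case True
    then show ?thesis using that[of 1 0] by (simp add: zero_prod_def)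
  next
    case False
    have "(fst z)\<^sup>2 + (snd z)\<^sup>2 = (norm z)\<^sup>2"
      by (simp add: norm_prod_def)
    then have "(fst z / norm z)\<^sup>2 + (snd z / norm z)\<^sup>2 = 1"
      using False by (simp add: power_divide flip: add_divide_distrib)
    then show ?thesis
      using that[of "fst z / norm z" "snd z / norm z"] False by simp
  qed
  define R :: "real \<times> real \<Rightarrow> real \<times> real" where "R y = (a * fst y - b * snd y, b * fst y + a * snd y)" for y
  have norm_R: "norm (R y) = norm y" for y
  proof -
    have "(a * fst y - b * snd y)\<^sup>2 + (b * fst y + a * snd y)\<^sup>2 = (a\<^sup>2 + b\<^sup>2) * ((fst y)\<^sup>2 + (snd y)\<^sup>2)"
      by (simp add: power2_eq_square algebra_simps)
    then show ?thesis by (simp add: norm_prod_def R_def ab)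
  qed
  have "R (y - (norm z, 0 :: real)) = R y - z" for y
    by (subst (2) z) (simp add: R_def algebra_simps)
  then have *: "norm (R y - z) = norm (y - (norm z, 0 :: real))" for y
    using norm_R by metis
  have "(\<integral>\<^sup>+y. indicator {y. norm y > norm z} y * q (norm (y - z)) \<partial>lborel)
      = (\<integral>\<^sup>+y. indicator {y. norm y > norm z} (R y) * q (norm (R y - z)) \<partial>lborel)"
    unfolding R_def by (rule nn_integral_rotation[OF _ ab, symmetric]) measurable
  then show ?thesis by (simp add: * norm_R indicator_def)
qed

section \<open>The point closest to the origin\<close>

context ppp
begin

definition ring :: "nat \<Rightarrow> nat \<Rightarrow> (real \<times> real) set" where
  "ring n k = {z. real k / 2 ^ n \<le> norm z \<and> norm z < (real k + 1) / 2 ^ n}"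

text \<open>The value 0 forbids points up to the outer radius of the ring, except in
  \<open>C \<inter> ring n k\<close>, where a separate factor demands exactly one. Thus a single
  product encodes both the empty disc and the weights \<open>v\<close> of the outer points.\<close>

definition ring_weight :: "(real \<times> real) set \<Rightarrow> (real \<times> real \<Rightarrow> real) \<Rightarrow> nat \<Rightarrow> nat \<Rightarrow> real \<times> real \<Rightarrow> real" where
  "ring_weight C v n k z =
     (if z \<in> C \<inter> ring n k then 1 else if norm z < (real k + 1) / 2 ^ n then 0 else v z)"

definition ring_approx :: "(real \<times> real) set \<Rightarrow> (real \<times> real \<Rightarrow> real) \<Rightarrow> nat \<Rightarrow> 'a \<Rightarrow> ennreal" where
  "ring_approx C v n w =
     (\<Sum>k. of_bool (npoints (C \<inter> ring n k) w = 1) * iprod UNIV (\<lambda>j. ennreal (ring_weight C v n k (X j w))))"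

text \<open>The probability that the disc of radius \<open>s\<close> is empty, times the generating
  functional of the points outside. The integrands in \<open>ring_void\<close> and
  \<open>void\<close> differ only on the circle; the strict inequality in \<open>void\<close> suits
  a limit of radii from above.\<close>

definition ring_void :: "(real \<times> real \<Rightarrow> real) \<Rightarrow> real \<Rightarrow> real" where
  "ring_void v s = exp (- (lam * (pi * s\<^sup>2 + (LBINT z. if s \<le> norm z then 1 - v z else 0))))"

definition void :: "(real \<times> real \<Rightarrow> real) \<Rightarrow> real \<Rightarrow> real" where
  "void v s = exp (- (lam * (pi * s\<^sup>2 + (LBINT z. if s < norm z then 1 - v z else 0))))"

lemma mem_ring_iff: "z \<in> ring n k \<longleftrightarrow> k = nat \<lfloor>2 ^ n * norm z\<rfloor>"
proof -
  have "z \<in> ring n k \<longleftrightarrow> real k \<le> 2 ^ n * norm z \<and> 2 ^ n * norm z < real k + 1"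
    by (simp add: ring_def field_simps)
  also have "\<dots> \<longleftrightarrow> \<lfloor>2 ^ n * norm z\<rfloor> = int k"
    by (simp add: floor_eq_iff)
  also have "\<dots> \<longleftrightarrow> k = nat \<lfloor>2 ^ n * norm z\<rfloor>"
  proof -
    have "0 \<le> \<lfloor>2 ^ n * norm z\<rfloor>" by simp
    then show ?thesis by linarith
  qed
  finally show ?thesis .
qed

lemma sets_ring [measurable]: "ring n k \<in> sets borel"
  unfolding ring_def by measurable

lemma bounded_ring: "bounded (C \<inter> ring n k)"
  unfolding bounded_iff by (intro exI[of _ "(real k + 1) / 2 ^ n"]) (auto simp: ring_def)

lemma measure_disc: "b \<ge> 0 \<Longrightarrow> measure lborel {z :: real \<times> real. norm z < b} = pi * b\<^sup>2"
  "{z :: real \<times> real. norm z < b} \<in> sets lborel"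
  "emeasure lborel {z :: real \<times> real. norm z < b} < \<infinity>"
proof -
  have eq: "{z :: real \<times> real. norm z < b} = ball 0 b"
    by (rule set_eqI) (simp only: mem_Collect_eq mem_ball_0)
  show "b \<ge> 0 \<Longrightarrow> measure lborel {z :: real \<times> real. norm z < b} = pi * b\<^sup>2"
    unfolding eq using content_ball[of b "0 :: real \<times> real"] by (simp add: unit_ball_vol_2 power2_eq_square)
  show "{z :: real \<times> real. norm z < b} \<in> sets lborel"
    unfolding eq by simp
  show "emeasure lborel {z :: real \<times> real. norm z < b} < \<infinity>"
    unfolding eq by (rule emeasure_bounded_finite) (rule bounded_ball)
qed

text \<open>With \<open>m\<close> the area of \<open>C \<inter> ring n k\<close>, exactly one point
  there has probability \<open>lam * m * exp (- (lam * m))\<close>. The weight leaves this set out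
  of the void region, and the exponential fills the gap, so that the full disc appears in
  \<open>ring_void\<close>. The factor \<open>m\<close> becomes the integral of an
  indicator.\<close>

lemma nn_integral_ring_term:
  assumes v [measurable]: "v \<in> borel_measurable borel" and v01: "\<And>z. 0 \<le> v z" "\<And>z. v z \<le> 1"
    and int: "integrable lborel (\<lambda>z. 1 - v z)" and C [measurable]: "C \<in> sets borel"
  shows "(\<integral>\<^sup>+w. of_bool (npoints (C \<inter> ring n k) w = 1)
        * iprod UNIV (\<lambda>j. ennreal (ring_weight C v n k (X j w))) \<partial>M)
    = (\<integral>\<^sup>+z. indicator (C \<inter> ring n k) z * ennreal (lam * ring_void v ((real k + 1) / 2 ^ n)) \<partial>lborel)"
proof -
  define b where "b = (real k + 1) / 2 ^ n"
  define A where "A = C \<inter> ring n k"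
  have b: "b \<ge> 0" by (simp add: b_def)
  have A [measurable]: "A \<in> sets borel" "bounded A" unfolding A_def using bounded_ring by auto
  have Afin: "emeasure lborel A < \<infinity>" by (rule emeasure_bounded_finite[OF A(2)])
  have A_disc: "norm z < b" if "z \<in> A" for z
    using that by (simp add: A_def ring_def b_def)
  let ?w = "ring_weight C v n k"
  have [measurable]: "?w \<in> borel_measurable borel"
    unfolding ring_weight_def by measurable
  have "integrable lborel (\<lambda>z. indicator {z. b \<le> norm z} z * (1 - v z))"
    by (rule Bochner_Integration.integrable_bound[OF int]) (use v01 in \<open>auto simp: indicator_def\<close>)
  then have int_b: "integrable lborel (\<lambda>z. if b \<le> norm z then 1 - v z else 0)"
    by (rule Bochner_Integration.integrable_cong[THEN iffD1, rotated 2]) (auto simp: indicator_def)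
  have split: "1 - ?w z = indicator {z. norm z < b} z - indicator A z + (if b \<le> norm z then 1 - v z else 0)" for z
    using A_disc[of z] by (auto simp: ring_weight_def A_def[symmetric] b_def[symmetric] indicator_def)
  have int_ind: "integrable lborel (\<lambda>z. indicator {z :: real \<times> real. norm z < b} z :: real)"
    "integrable lborel (\<lambda>z. indicator A z :: real)"
    using measure_disc(2,3) Afin by auto
  have int_w: "integrable lborel (\<lambda>z. 1 - ?w z)"
    unfolding split by (intro Bochner_Integration.integrable_add Bochner_Integration.integrable_diff int_ind int_b)
  have Iw: "(LBINT z. 1 - ?w z) = pi * b\<^sup>2 - measure lborel A + (LBINT z. if b \<le> norm z then 1 - v z else 0)"
  proof -
    have "(LBINT z. 1 - ?w z) = (LBINT z. (indicator {z :: real \<times> real. norm z < b} z :: real)) - (LBINT z. indicator A z)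
        + (LBINT z. if b \<le> norm z then 1 - v z else 0)"
      unfolding split
      using int_ind int_b by (simp only: Bochner_Integration.integral_add Bochner_Integration.integral_diff
        Bochner_Integration.integrable_diff)
    then show ?thesis
      using measure_disc(1)[OF b] by simp
  qed
  let ?m = "measure lborel A"
  note [measurable] = measurable_npoints[OF A]
  have one: "(\<integral>\<^sup>+w. of_bool (npoints A w = 1) \<partial>M) = ennreal (lam * ?m * exp (- (lam * ?m)))"
  proof -
    have "(\<integral>\<^sup>+w. of_bool (npoints A w = 1) \<partial>M) = (\<integral>\<^sup>+w. indicator {w \<in> space M. npoints A w = 1} w \<partial>M)"
      by (intro nn_integral_cong) (auto simp: indicator_def)
    then show ?thesis
      using emeasure_npoints[OF A, of 1] by simp
  qed
  have "(\<integral>\<^sup>+w. of_bool (npoints A w = 1) * iprod UNIV (\<lambda>j. ennreal (?w (X j w))) \<partial>M)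
      = (\<integral>\<^sup>+w. of_bool (npoints A w = 1) \<partial>M) * ennreal (exp (- (lam * (LBINT z. 1 - ?w z))))"
    by (rule pgfl[where h="\<lambda>m. of_bool (m = 1)"])
       (use v01 int_w A in \<open>auto simp: ring_weight_def A_def\<close>)
  also have "\<dots> = ennreal ((lam * ?m * exp (- (lam * ?m))) * exp (- (lam * (LBINT z. 1 - ?w z))))"
    using lam_pos unfolding one by (intro ennreal_mult[symmetric]) auto
  also have "(lam * ?m * exp (- (lam * ?m))) * exp (- (lam * (LBINT z. 1 - ?w z))) = (lam * ring_void v b) * ?m"
    unfolding Iw ring_void_def mult.assoc by (simp add: algebra_simps flip: exp_add)
  also have "ennreal ((lam * ring_void v b) * ?m) = (\<integral>\<^sup>+z. indicator A z * ennreal (lam * ring_void v b) \<partial>lborel)"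
    using lam_pos Afin
    by (simp add: nn_integral_multc ennreal_mult' emeasure_eq_ennreal_measure mult.commute ring_void_def less_top)
  finally show ?thesis unfolding A_def b_def .
qed

text \<open>The outer radius of the ring containing the points at distance \<open>s\<close>.\<close>

definition ring_radius :: "nat \<Rightarrow> real \<Rightarrow> real" where
  "ring_radius n s = (real (nat \<lfloor>2 ^ n * s\<rfloor>) + 1) / 2 ^ n"

lemma borel_measurable_ring_void [measurable]:
  assumes [measurable]: "v \<in> borel_measurable borel"
  shows "ring_void v \<in> borel_measurable borel" "void v \<in> borel_measurable borel"
  unfolding ring_void_def void_def by measurable

lemma borel_measurable_ring_radius [measurable]: "ring_radius n \<in> borel_measurable borel"
  unfolding ring_radius_def by measurable

lemma measurable_ring_approx [measurable]:
  assumes [measurable]: "v \<in> borel_measurable borel" "C \<in> sets borel"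
  shows "ring_approx C v n \<in> borel_measurable M"
proof -
  have [measurable]: "npoints (C \<inter> ring n k) \<in> measurable M (count_space UNIV)" for k
    by (rule measurable_npoints) (auto intro: bounded_ring)
  have [measurable]: "ring_weight C v n k \<in> borel_measurable borel" for k
    unfolding ring_weight_def by measurable
  show ?thesis unfolding ring_approx_def by measurable
qed

text \<open>Each \<open>z\<close> lies in exactly one ring, so the series of densities collapses to
  the term of that ring.\<close>

lemma nn_integral_ring_approx:
  assumes v [measurable]: "v \<in> borel_measurable borel" and v01: "\<And>z. 0 \<le> v z" "\<And>z. v z \<le> 1"
    and int: "integrable lborel (\<lambda>z. 1 - v z)" and C [measurable]: "C \<in> sets borel"
  shows "(\<integral>\<^sup>+w. ring_approx C v n w \<partial>M)
    = (\<integral>\<^sup>+z. indicator C z * ennreal (lam * ring_void v (ring_radius n (norm z))) \<partial>lborel)"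
proof -
  have [measurable]: "npoints (C \<inter> ring n k) \<in> measurable M (count_space UNIV)" for k
    by (rule measurable_npoints) (auto intro: bounded_ring)
  have [measurable]: "ring_weight C v n k \<in> borel_measurable borel" for k
    unfolding ring_weight_def by measurable
  have "(\<integral>\<^sup>+w. ring_approx C v n w \<partial>M) = (\<Sum>k. \<integral>\<^sup>+w. of_bool (npoints (C \<inter> ring n k) w = 1)
        * iprod UNIV (\<lambda>j. ennreal (ring_weight C v n k (X j w))) \<partial>M)"
    unfolding ring_approx_def by (rule nn_integral_suminf) measurable
  also have "\<dots> = (\<Sum>k. \<integral>\<^sup>+z. indicator (C \<inter> ring n k) z * ennreal (lam * ring_void v ((real k + 1) / 2 ^ n)) \<partial>lborel)"
    by (simp only: nn_integral_ring_term[OF assms])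
  also have "\<dots> = (\<integral>\<^sup>+z. (\<Sum>k. indicator (C \<inter> ring n k) z * ennreal (lam * ring_void v ((real k + 1) / 2 ^ n))) \<partial>lborel)"
    by (rule nn_integral_suminf[symmetric]) measurable
  also have "\<dots> = (\<integral>\<^sup>+z. indicator C z * ennreal (lam * ring_void v (ring_radius n (norm z))) \<partial>lborel)"
  proof (rule nn_integral_cong)
    fix z :: "real \<times> real"
    let ?k = "nat \<lfloor>2 ^ n * norm z\<rfloor>"
    have "(\<Sum>k. indicator (C \<inter> ring n k) z * ennreal (lam * ring_void v ((real k + 1) / 2 ^ n)))
      = (\<Sum>k\<in>{?k}. indicator (C \<inter> ring n k) z * ennreal (lam * ring_void v ((real k + 1) / 2 ^ n)))"
      by (intro suminf_finite) (auto simp: indicator_def mem_ring_iff)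
    then show "(\<Sum>k. indicator (C \<inter> ring n k) z * ennreal (lam * ring_void v ((real k + 1) / 2 ^ n)))
        = indicator C z * ennreal (lam * ring_void v (ring_radius n (norm z)))"
      by (simp add: indicator_def mem_ring_iff ring_radius_def)
  qed
  finally show ?thesis .
qed

lemma ring_radius_bounds:
  assumes "s \<ge> 0"
  shows "s < ring_radius n s" "ring_radius n s \<le> s + 1 / 2 ^ n"
proof -
  have fl: "real (nat \<lfloor>2 ^ n * s\<rfloor>) = of_int \<lfloor>2 ^ n * s\<rfloor>"
    using assms by simp
  have "2 ^ n * s < of_int \<lfloor>2 ^ n * s\<rfloor> + 1" "of_int \<lfloor>2 ^ n * s\<rfloor> \<le> 2 ^ n * s"
    by linarith+
  then show "s < ring_radius n s" "ring_radius n s \<le> s + 1 / 2 ^ n"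
    unfolding ring_radius_def fl by (simp_all add: field_simps)
qed

lemma ring_radius_tendsto:
  assumes "s \<ge> 0"
  shows "(\<lambda>n. ring_radius n s) \<longlonglongrightarrow> s"
proof (rule tendsto_sandwich[of "\<lambda>_. s" _ _ "\<lambda>n. s + 1 / 2 ^ n"])
  have "(\<lambda>n. s + (1 / 2) ^ n) \<longlonglongrightarrow> s + 0"
    by (intro tendsto_add tendsto_const LIMSEQ_realpow_zero) auto
  then show "(\<lambda>n. s + 1 / 2 ^ n) \<longlonglongrightarrow> s"
    by (simp add: power_divide)
  show "\<forall>\<^sub>F n in sequentially. s \<le> ring_radius n s"
    "\<forall>\<^sub>F n in sequentially. ring_radius n s \<le> s + 1 / 2 ^ n"
    using ring_radius_bounds[OF assms] by (auto intro!: always_eventually less_imp_le)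
qed auto

text \<open>The radii approach \<open>s\<close> strictly from above, so at distance \<open>s\<close>
  the integrand is 0 for every \<open>n\<close>; farther out it is eventually
  \<open>1 - v\<close>.\<close>

lemma ring_void_tendsto:
  assumes v [measurable]: "v \<in> borel_measurable borel" and v01: "\<And>z. 0 \<le> v z" "\<And>z. v z \<le> 1"
    and int: "integrable lborel (\<lambda>z. 1 - v z)" and s: "s \<ge> 0"
  shows "(\<lambda>n. ring_void v (ring_radius n s)) \<longlonglongrightarrow> void v s"
proof -
  have "(\<lambda>n. LBINT z. if ring_radius n s \<le> norm z then 1 - v z else 0)
      \<longlonglongrightarrow> (LBINT z. if s < norm z then 1 - v z else 0)"
  proof (rule integral_dominated_convergence[where w="\<lambda>z. 1 - v z"])
    show "AE z in lborel. (\<lambda>n. if ring_radius n s \<le> norm z then 1 - v z else 0)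
        \<longlonglongrightarrow> (if s < norm z then 1 - v z else 0)"
    proof (intro AE_I2 tendsto_eventually)
      fix z :: "real \<times> real"
      show "\<forall>\<^sub>F n in sequentially. (if ring_radius n s \<le> norm z then 1 - v z else 0)
          = (if s < norm z then 1 - v z else 0)"
      proof (cases "s < norm z")
        case True
        then show ?thesis
          by (intro eventually_mono[OF order_tendstoD(2)[OF ring_radius_tendsto[OF s] True]]) simp
      next
        case False
        then show ?thesis
          using ring_radius_bounds(1)[OF s] by (intro always_eventually allI) (smt (verit))
      qed
    qed
    show "AE z in lborel. norm (if ring_radius n s \<le> norm z then 1 - v z else 0) \<le> 1 - v z" for n
      using v01 by (intro AE_I2) auto
  qed (simp_all add: int)
  then show ?thesis
    unfolding ring_void_def void_def
    by (intro tendsto_exp tendsto_minus tendsto_mult tendsto_add tendsto_const tendsto_power ring_radius_tendsto[OF s])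
qed

lemma nn_integral_ring_approx_tendsto:
  assumes v [measurable]: "v \<in> borel_measurable borel" and v01: "\<And>z. 0 \<le> v z" "\<And>z. v z \<le> 1"
    and int: "integrable lborel (\<lambda>z. 1 - v z)" and C [measurable]: "C \<in> sets borel"
  shows "(\<lambda>n. \<integral>\<^sup>+w. ring_approx C v n w \<partial>M)
    \<longlonglongrightarrow> (\<integral>\<^sup>+z. indicator C z * ennreal (lam * void v (norm z)) \<partial>lborel)"
  unfolding nn_integral_ring_approx[OF assms]
proof (rule nn_integral_dominated_convergence[where w="\<lambda>z. ennreal (lam * exp (- (lam * (pi * (norm z)\<^sup>2))))"])
  show "(\<integral>\<^sup>+z. ennreal (lam * exp (- (lam * (pi * (norm (z :: real \<times> real))\<^sup>2)))) \<partial>lborel) < \<infinity>"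
    using nn_integral_gaussian_plane[OF lam_pos] by simp
  show "AE z in lborel. indicator C z * ennreal (lam * ring_void v (ring_radius n (norm z)))
      \<le> ennreal (lam * exp (- (lam * (pi * (norm z)\<^sup>2))))" for n
  proof (rule AE_I2)
    fix z :: "real \<times> real"
    have "(norm z)\<^sup>2 \<le> (ring_radius n (norm z))\<^sup>2"
      using ring_radius_bounds(1)[of "norm z" n] by (intro power_mono) auto
    moreover have "0 \<le> (LBINT y. if ring_radius n (norm z) \<le> norm y then 1 - v y else 0)"
      using v01 by (intro integral_nonneg_AE AE_I2) auto
    ultimately have "pi * (norm z)\<^sup>2 \<le> pi * (ring_radius n (norm z))\<^sup>2
        + (LBINT y. if ring_radius n (norm z) \<le> norm y then 1 - v y else 0)"
      by (intro add_increasing2) auto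
    then have "lam * ring_void v (ring_radius n (norm z)) \<le> lam * exp (- (lam * (pi * (norm z)\<^sup>2)))"
      unfolding ring_void_def using lam_pos by (intro mult_left_mono) auto
    then show "indicator C z * ennreal (lam * ring_void v (ring_radius n (norm z)))
      \<le> ennreal (lam * exp (- (lam * (pi * (norm z)\<^sup>2))))"
      by (auto simp: indicator_def intro: ennreal_leI)
  qed
  show "AE z in lborel. (\<lambda>n. indicator C z * ennreal (lam * ring_void v (ring_radius n (norm z))))
      \<longlonglongrightarrow> indicator C z * ennreal (lam * void v (norm z))"
    using ring_void_tendsto[OF v v01 int]
    by (intro AE_I2 ennreal_tendsto_cmult tendsto_ennrealI tendsto_mult tendsto_const) (auto simp: indicator_def)
qed measurable

section \<open>Almost sure uniqueness of the closest point\<close>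

definition unique_nearest :: "'a \<Rightarrow> bool" where
  "unique_nearest w \<longleftrightarrow> (\<exists>i. \<forall>j. j \<noteq> i \<longrightarrow> norm (X i w) < norm (X j w))"

lemma measurable_unique_nearest [measurable]: "Measurable.pred M unique_nearest"
  unfolding unique_nearest_def by measurable

lemma ring_term_neq_0:
  assumes "of_bool (npoints (C \<inter> ring n k) w = 1) * iprod UNIV (\<lambda>j. ennreal (ring_weight C v n k (X j w))) \<noteq> 0"
  obtains i where "X i w \<in> C" "X i w \<in> ring n k" "\<And>j. j \<noteq> i \<Longrightarrow> (real k + 1) / 2 ^ n \<le> norm (X j w)"
proof -
  have one: "card {i. X i w \<in> C \<inter> ring n k} = 1" and ne: "iprod UNIV (\<lambda>j. ennreal (ring_weight C v n k (X j w))) \<noteq> 0"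
    using assms by (auto simp: npoints_def)
  obtain i where i: "{i. X i w \<in> C \<inter> ring n k} = {i}"
    using one card_1_singletonE by metis
  have "(real k + 1) / 2 ^ n \<le> norm (X j w)" if "j \<noteq> i" for j
  proof (rule ccontr)
    assume "\<not> (real k + 1) / 2 ^ n \<le> norm (X j w)"
    moreover have "X j w \<notin> C \<inter> ring n k" using i that by blast
    ultimately have "ring_weight C v n k (X j w) = 0"
      by (simp add: ring_weight_def)
    then show False using ne iprod_eq_0[of j UNIV "\<lambda>j. ennreal (ring_weight C v n k (X j w))"] by simp
  qed
  then show thesis using that[of i] i by blast
qed

text \<open>A nonzero summand exhibits a point strictly closer than all others, and this point
  determines the ring. Hence at most one summand is nonzero, and it is at most 1.\<close>

lemma ring_approx_le: "ring_approx C v n w \<le> of_bool (unique_nearest w)"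
proof -
  let ?t = "\<lambda>k. of_bool (npoints (C \<inter> ring n k) w = 1) * iprod UNIV (\<lambda>j. ennreal (ring_weight C v n k (X j w)))"
  show ?thesis
  proof (cases "\<exists>k. ?t k \<noteq> 0")
    case True
    then obtain k where k: "?t k \<noteq> 0" by blast
    obtain i where i: "X i w \<in> ring n k" "\<And>j. j \<noteq> i \<Longrightarrow> (real k + 1) / 2 ^ n \<le> norm (X j w)"
      using ring_term_neq_0[OF k] by blast
    have "norm (X i w) < (real k + 1) / 2 ^ n" using i(1) by (simp add: ring_def)
    then have i': "norm (X i w) < norm (X j w)" if "j \<noteq> i" for j
      using i(2)[OF that] by linarith
    then have un: "unique_nearest w" unfolding unique_nearest_def by blast
    have "?t k' = 0" if "k' \<noteq> k" for k'
    proof (rule ccontr)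
      assume k': "?t k' \<noteq> 0"
      obtain i2 where i2: "X i2 w \<in> ring n k'" "\<And>j. j \<noteq> i2 \<Longrightarrow> (real k' + 1) / 2 ^ n \<le> norm (X j w)"
        using ring_term_neq_0[OF k'] by blast
      have "norm (X i2 w) < (real k' + 1) / 2 ^ n" using i2(1) by (simp add: ring_def)
      then have "norm (X i2 w) < norm (X j w)" if "j \<noteq> i2" for j
        using i2(2)[OF that] by linarith
      with i' have "i2 = i" by (metis less_asym)
      with i(1) i2(1) that show False by (simp add: mem_ring_iff)
    qed
    then have "ring_approx C v n w = ?t k"
      unfolding ring_approx_def by (subst suminf_finite[of "{k}"]) auto
    also have "\<dots> \<le> 1" by (intro mult_le_one iprod_le_1) auto
    finally show ?thesis using un by simp
  next
    case False
    then have "ring_approx C v n w = 0"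
      unfolding ring_approx_def by (subst suminf_finite[of "{}"]) auto
    then show ?thesis by simp
  qed
qed

text \<open>With \<open>C = UNIV\<close> and \<open>v = 1\<close> the ring sums stay below the
  indicator of uniqueness, while their expectations tend to the Gaussian mass 1. Ties are thus
  excluded without a computation on pairs of points.\<close>

lemma AE_unique_nearest: "AE w in M. unique_nearest w"
proof -
  have "(\<integral>\<^sup>+z. indicator UNIV z * ennreal (lam * void (\<lambda>_. 1) (norm z)) \<partial>(lborel :: (real \<times> real) measure)) = 1"
    using nn_integral_gaussian_plane[OF lam_pos] by (simp add: void_def cong: if_cong)
  then have lim: "(\<lambda>n. \<integral>\<^sup>+w. ring_approx UNIV (\<lambda>_. 1) n w \<partial>M) \<longlonglongrightarrow> 1"
    using nn_integral_ring_approx_tendsto[of "\<lambda>_. 1" UNIV] by simp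
  have "(\<integral>\<^sup>+w. ring_approx UNIV (\<lambda>_. 1) n w \<partial>M) \<le> emeasure M {w \<in> space M. unique_nearest w}" for n
  proof -
    have "(\<integral>\<^sup>+w. ring_approx UNIV (\<lambda>_. 1) n w \<partial>M) \<le> (\<integral>\<^sup>+w. indicator {w \<in> space M. unique_nearest w} w \<partial>M)"
      by (intro nn_integral_mono order_trans[OF ring_approx_le]) (auto simp: indicator_def)
    then show ?thesis by simp
  qed
  then have "1 \<le> emeasure M {w \<in> space M. unique_nearest w}"
    by (intro LIMSEQ_le_const2[OF lim]) auto
  then have "emeasure M {w \<in> space M. unique_nearest w} = 1"
    using emeasure_le_1[of "{w \<in> space M. unique_nearest w}"] by (intro antisym) auto
  then have "prob {w \<in> space M. unique_nearest w} = 1"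
    by (simp add: measure_def)
  then show ?thesis by (subst (asm) prob_Collect_eq_1) auto
qed

definition nearest :: "'a \<Rightarrow> nat" where
  "nearest w = closest_index (\<lambda>i. X i w)"

lemma measurable_nearest [measurable]: "nearest \<in> measurable M (count_space UNIV)"
  unfolding nearest_def[abs_def] by measurable

lemma nearest_less:
  assumes "unique_nearest w" "j \<noteq> nearest w"
  shows "norm (X (nearest w) w) < norm (X j w)"
proof -
  obtain i where i: "\<And>j. j \<noteq> i \<Longrightarrow> norm (X i w) < norm (X j w)"
    using assms(1) unfolding unique_nearest_def by blast
  have "nearest w = i"
    unfolding nearest_def closest_index_def
  proof (rule Least_equality)
    show "\<forall>j. norm (X i w) \<le> norm (X j w)"
      using i by (metis less_imp_le order_refl)
    show "i \<le> k" if "\<forall>j. norm (X k w) \<le> norm (X j w)" for k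
      using i that by (metis leD order_refl)
  qed
  then show ?thesis using i assms(2) by simp
qed

text \<open>Local finiteness leaves a gap between the closest point and all others. Once the ring
  width is below the gap, the ring of the closest point holds no other point and the approximation
  is exact.\<close>

lemma ring_approx_eventually:
  assumes lf: "\<forall>r. finite {i. X i w \<in> cball 0 r}" and un: "unique_nearest w"
    and v1: "\<And>z. v z \<le> 1"
  shows "eventually (\<lambda>n. ring_approx C v n w
    = indicator C (X (nearest w) w) * iprod (UNIV - {nearest w}) (\<lambda>j. ennreal (v (X j w)))) sequentially"
proof -
  define i where "i = nearest w"
  define s where "s = norm (X i w)"
  have less: "s < norm (X j w)" if "j \<noteq> i" for j
    using nearest_less[OF un] that by (simp add: i_def s_def)
  define J where "J = {j. X j w \<in> cball 0 (s + 1)} - {i}"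
  have finJ: "finite J" using lf by (simp add: J_def)
  obtain \<epsilon> where \<epsilon>: "\<epsilon> > 0" "\<And>j. j \<noteq> i \<Longrightarrow> s + \<epsilon> \<le> norm (X j w)"
  proof -
    \<comment> \<open>Only finitely many points lie within distance \<open>s + 1\<close> of the
      origin; the inserted 1 accounts for all the others and keeps the set nonempty.\<close>
    define \<epsilon> where "\<epsilon> = Min (insert 1 ((\<lambda>j. norm (X j w) - s) ` J))"
    have "\<epsilon> > 0" using finJ less by (auto simp: \<epsilon>_def J_def)
    moreover have "s + \<epsilon> \<le> norm (X j w)" if "j \<noteq> i" for j
    proof (cases "j \<in> J")
      case True
      then have "\<epsilon> \<le> norm (X j w) - s" using finJ by (auto simp: \<epsilon>_def)
      then show ?thesis by simp
    next
      case False
      then have "s + 1 < norm (X j w)" using that by (simp add: J_def mem_cball_0)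
      moreover have "\<epsilon> \<le> 1" using finJ by (auto simp: \<epsilon>_def)
      ultimately show ?thesis by simp
    qed
    ultimately show thesis by (rule that)
  qed
  have "(\<lambda>n. (1 / 2 :: real) ^ n) \<longlonglongrightarrow> 0"
    by (intro LIMSEQ_realpow_zero) auto
  from order_tendstoD(2)[OF this \<epsilon>(1)] show ?thesis
  proof eventually_elim
    case (elim n)
    let ?t = "\<lambda>k. of_bool (npoints (C \<inter> ring n k) w = 1) * iprod UNIV (\<lambda>j. ennreal (ring_weight C v n k (X j w)))"
    define k where "k = nat \<lfloor>2 ^ n * s\<rfloor>"
    have ik: "X i w \<in> ring n k" by (simp add: mem_ring_iff k_def s_def)
    have rad: "(real k + 1) / 2 ^ n < s + \<epsilon>"
      using ring_radius_bounds(2)[of s n] elim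
      by (simp add: ring_radius_def k_def s_def power_divide)
    have far: "(real k + 1) / 2 ^ n < norm (X j w)" if "j \<noteq> i" for j
      using rad \<epsilon>(2)[OF that] by linarith
    have "?t k' = 0" if "k' \<noteq> k" for k'
    proof (rule ccontr)
      assume "?t k' \<noteq> 0"
      then obtain i2 where i2: "X i2 w \<in> ring n k'" "\<And>j. j \<noteq> i2 \<Longrightarrow> (real k' + 1) / 2 ^ n \<le> norm (X j w)"
        by (rule ring_term_neq_0) blast
      have "i2 \<noteq> i" using i2(1) ik that by (auto simp: mem_ring_iff)
      then have "s < norm (X i2 w)" "(real k' + 1) / 2 ^ n \<le> s"
        using less i2(2)[of i] by (auto simp: s_def)
      then show False using i2(1) by (simp add: ring_def)
    qed
    then have "ring_approx C v n w = ?t k"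
      unfolding ring_approx_def by (subst suminf_finite[of "{k}"]) auto
    also have "\<dots> = indicator C (X i w) * iprod (UNIV - {i}) (\<lambda>j. ennreal (v (X j w)))"
    proof -
      have only: "{j. X j w \<in> C \<inter> ring n k} = (if X i w \<in> C then {i} else {})"
      proof -
        have "X j w \<notin> ring n k" if "j \<noteq> i" for j
          using far[OF that] by (simp add: ring_def)
        then have "X j w \<in> C \<inter> ring n k \<longleftrightarrow> j = i \<and> X i w \<in> C" for j
          using ik by (cases "j = i") simp_all
        then show ?thesis by simp
      qed
      show ?thesis
      proof (cases "X i w \<in> C")
        case True
        then have "ring_weight C v n k (X i w) = 1"
          using ik by (simp add: ring_weight_def)
        then have "iprod UNIV (\<lambda>j. ennreal (ring_weight C v n k (X j w)))
            = iprod (UNIV - {i}) (\<lambda>j. ennreal (ring_weight C v n k (X j w)))"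
          using v1 by (intro iprod_split) (auto simp: ring_weight_def)
        also have "\<dots> = iprod (UNIV - {i}) (\<lambda>j. ennreal (v (X j w)))"
        proof (intro iprod_cong)
          fix j assume "j \<in> UNIV - {i}"
          then have "(real k + 1) / 2 ^ n < norm (X j w)" using far by simp
          then show "ennreal (ring_weight C v n k (X j w)) = ennreal (v (X j w))"
            by (simp add: ring_weight_def ring_def)
        qed
        finally show ?thesis using True only by (simp add: npoints_def)
      next
        case False
        then show ?thesis unfolding npoints_def only by simp
      qed
    qed
    finally show ?case by (simp add: i_def)
  qed
qed

lemma nearest_pgfl:
  assumes v [measurable]: "v \<in> borel_measurable borel" and v01: "\<And>z. 0 \<le> v z" "\<And>z. v z \<le> 1"
    and int: "integrable lborel (\<lambda>z. 1 - v z)" and C [measurable]: "C \<in> sets borel"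
  shows "(\<integral>\<^sup>+w. indicator C (X (nearest w) w) * iprod (UNIV - {nearest w}) (\<lambda>j. ennreal (v (X j w))) \<partial>M)
    = (\<integral>\<^sup>+z. indicator C z * ennreal (lam * void v (norm z)) \<partial>lborel)"
proof (rule LIMSEQ_unique[OF _ nn_integral_ring_approx_tendsto[OF assms]])
  have meas: "(\<lambda>w. indicator C (X (nearest w) w) * iprod (UNIV - {nearest w}) (\<lambda>j. ennreal (v (X j w))) :: ennreal)
      \<in> borel_measurable M"
    by (rule measurable_compose_countable'[OF _ measurable_nearest, of "\<lambda>i w. indicator C (X i w) * iprod (UNIV - {i}) (\<lambda>j. ennreal (v (X j w)))"])
       (auto intro!: borel_measurable_times_ennreal borel_measurable_iprod)
  show "(\<lambda>n. \<integral>\<^sup>+w. ring_approx C v n w \<partial>M)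
    \<longlonglongrightarrow> (\<integral>\<^sup>+w. indicator C (X (nearest w) w) * iprod (UNIV - {nearest w}) (\<lambda>j. ennreal (v (X j w))) \<partial>M)"
  proof (rule nn_integral_dominated_convergence[where w="\<lambda>_. 1"])
    show "AE w in M. ring_approx C v n w \<le> 1" for n
      by (intro AE_I2 order_trans[OF ring_approx_le]) simp
    show "AE w in M. (\<lambda>n. ring_approx C v n w)
        \<longlonglongrightarrow> indicator C (X (nearest w) w) * iprod (UNIV - {nearest w}) (\<lambda>j. ennreal (v (X j w)))"
      using AE_locally_finite AE_unique_nearest
      by eventually_elim (intro tendsto_eventually ring_approx_eventually v01)
  qed (use meas in \<open>auto simp: emeasure_space_1\<close>)
qed

section \<open>Factors depending on the location of the closest point\<close>

lemma void_le:
  assumes "\<And>z. v z \<le> 1"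
  shows "void v s \<le> exp (- (lam * (pi * s\<^sup>2)))"
proof -
  have "0 \<le> (LBINT y. if s < norm y then 1 - v y else 0)"
    using assms by (intro integral_nonneg_AE AE_I2) auto
  then show ?thesis
    unfolding void_def using lam_pos by simp
qed

lemma void_tendsto:
  assumes "\<And>n. v n \<in> borel_measurable borel" "v' \<in> borel_measurable borel"
    and "integrable lborel w" "\<And>n b. \<bar>1 - v n b\<bar> \<le> w b"
    and "AE b in lborel. (\<lambda>n. v n b) \<longlonglongrightarrow> v' b"
  shows "(\<lambda>n. void (v n) s) \<longlonglongrightarrow> void v' s"
proof -
  note [measurable] = assms(1,2)
  have w0: "0 \<le> w b" for b
    using assms(4)[of 0 b] by simp
  have "(\<lambda>n. LBINT b. if s < norm b then 1 - v n b else 0) \<longlonglongrightarrow> (LBINT b. if s < norm b then 1 - v' b else 0)"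
  proof (rule integral_dominated_convergence[where w=w])
    show "AE b in lborel. (\<lambda>n. if s < norm b then 1 - v n b else 0) \<longlonglongrightarrow> (if s < norm b then 1 - v' b else 0)"
      using assms(5) by eventually_elim (auto intro: tendsto_diff tendsto_const)
    show "AE b in lborel. norm (if s < norm b then 1 - v n b else 0) \<le> w b" for n
      using assms(4) w0 by (intro AE_I2) simp
  qed (use assms(3) in simp_all)
  then show ?thesis
    unfolding void_def by (intro tendsto_exp tendsto_minus tendsto_mult tendsto_add tendsto_const)
qed

lemma nn_integral_void_tendsto:
  fixes v :: "nat \<Rightarrow> real \<times> real \<Rightarrow> real \<times> real \<Rightarrow> real"
  assumes "\<And>n z b. v n z b \<le> 1"
    and [measurable]: "\<And>n. (\<lambda>z. void (v n z) (norm z)) \<in> borel_measurable borel"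
      "(\<lambda>z. void (v' z) (norm z)) \<in> borel_measurable borel"
    and lim: "\<And>z. (\<lambda>n. void (v n z) (norm z)) \<longlonglongrightarrow> void (v' z) (norm z)"
  shows "(\<lambda>n. \<integral>\<^sup>+z. ennreal (lam * void (v n z) (norm z)) \<partial>lborel)
    \<longlonglongrightarrow> (\<integral>\<^sup>+z. ennreal (lam * void (v' z) (norm z)) \<partial>lborel)"
proof (rule nn_integral_dominated_convergence[where w="\<lambda>z. ennreal (lam * exp (- (lam * (pi * (norm z)\<^sup>2))))"])
  show "(\<integral>\<^sup>+z. ennreal (lam * exp (- (lam * (pi * (norm (z :: real \<times> real))\<^sup>2)))) \<partial>lborel) < \<infinity>"
    using nn_integral_gaussian_plane[OF lam_pos] by simp
  show "AE z in lborel. ennreal (lam * void (v n z) (norm z)) \<le> ennreal (lam * exp (- (lam * (pi * (norm z)\<^sup>2))))" for n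
    using assms(1) lam_pos by (intro AE_I2 ennreal_leI mult_left_mono void_le) auto
  show "AE z in lborel. (\<lambda>n. ennreal (lam * void (v n z) (norm z))) \<longlonglongrightarrow> ennreal (lam * void (v' z) (norm z))"
    using lim by (intro AE_I2 tendsto_ennrealI tendsto_mult tendsto_const)
qed measurable

lemma measurable_at_nearest:
  assumes "\<And>i. (\<lambda>w. f i w) \<in> borel_measurable M"
  shows "(\<lambda>w. f (nearest w) w) \<in> borel_measurable M"
  by (rule measurable_compose_countable[OF assms measurable_nearest])

text \<open>On the cell where \<open>idx\<close> equals \<open>p\<close> the factor no longer varies
  with the closest point, so \<open>nearest_pgfl\<close> applies with this cell as \<open>C\<close>;
  then the cells are summed.\<close>

lemma nearest_pgfl_countable:
  fixes v :: "nat \<Rightarrow> real \<times> real \<Rightarrow> real"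
  assumes v [measurable]: "\<And>p. v p \<in> borel_measurable borel"
    and v01: "\<And>p z. 0 \<le> v p z" "\<And>p z. v p z \<le> 1"
    and int: "\<And>p. integrable lborel (\<lambda>z. 1 - v p z)"
    and idx [measurable]: "idx \<in> measurable borel (count_space UNIV)"
  shows "(\<integral>\<^sup>+w. iprod (UNIV - {nearest w}) (\<lambda>j. ennreal (v (idx (X (nearest w) w)) (X j w))) \<partial>M)
    = (\<integral>\<^sup>+z. ennreal (lam * void (v (idx z)) (norm z)) \<partial>lborel)"
proof -
  have cell [measurable]: "idx -` {p} \<in> sets borel" for p
    using measurable_sets[OF idx, of "{p}"] by simp
  have expand: "f (idx z) = (\<Sum>p. indicator (idx -` {p}) z * f p)" for f :: "nat \<Rightarrow> ennreal" and z
  proof -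
    have "(\<Sum>p. indicator (idx -` {p}) z * f p) = (\<Sum>p\<in>{idx z}. indicator (idx -` {p}) z * f p)"
      by (intro suminf_finite) (auto simp: indicator_def)
    then show ?thesis by simp
  qed
  have meas: "(\<lambda>w. indicator (idx -` {p}) (X (nearest w) w) * iprod (UNIV - {nearest w}) (\<lambda>j. ennreal (v p (X j w))) :: ennreal)
      \<in> borel_measurable M" for p
    by (rule measurable_at_nearest[where f="\<lambda>i w. indicator (idx -` {p}) (X i w) * iprod (UNIV - {i}) (\<lambda>j. ennreal (v p (X j w)))"])
       measurable
  have "(\<integral>\<^sup>+w. iprod (UNIV - {nearest w}) (\<lambda>j. ennreal (v (idx (X (nearest w) w)) (X j w))) \<partial>M)
      = (\<integral>\<^sup>+w. (\<Sum>p. indicator (idx -` {p}) (X (nearest w) w)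
          * iprod (UNIV - {nearest w}) (\<lambda>j. ennreal (v p (X j w)))) \<partial>M)"
    by (subst expand[symmetric]) (rule refl)
  also have "\<dots> = (\<Sum>p. \<integral>\<^sup>+w. indicator (idx -` {p}) (X (nearest w) w)
          * iprod (UNIV - {nearest w}) (\<lambda>j. ennreal (v p (X j w))) \<partial>M)"
    using meas by (rule nn_integral_suminf)
  also have "\<dots> = (\<Sum>p. \<integral>\<^sup>+z. indicator (idx -` {p}) z * ennreal (lam * void (v p) (norm z)) \<partial>lborel)"
    by (simp only: nearest_pgfl[OF v v01 int cell])
  also have "\<dots> = (\<integral>\<^sup>+z. (\<Sum>p. indicator (idx -` {p}) z * ennreal (lam * void (v p) (norm z))) \<partial>lborel)"
    by (rule nn_integral_suminf[symmetric]) measurable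
  also have "\<dots> = (\<integral>\<^sup>+z. ennreal (lam * void (v (idx z)) (norm z)) \<partial>lborel)"
    by (subst expand[symmetric]) (rule refl)
  finally show ?thesis .
qed

end

text \<open>Cells are coded by natural numbers to fit \<open>nearest_pgfl_countable\<close>;
  \<open>grid_point\<close> decodes a cell to its lower left corner.\<close>

definition grid_index :: "nat \<Rightarrow> real \<times> real \<Rightarrow> nat" where
  "grid_index n a = to_nat (\<lfloor>2 ^ n * fst a\<rfloor>, \<lfloor>2 ^ n * snd a\<rfloor>)"

definition grid_point :: "nat \<Rightarrow> nat \<Rightarrow> real \<times> real" where
  "grid_point n p = (of_int (fst (from_nat p :: int \<times> int)) / 2 ^ n, of_int (snd (from_nat p :: int \<times> int)) / 2 ^ n)"

lemma measurable_grid_index [measurable]: "grid_index n \<in> measurable borel (count_space UNIV)"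
proof -
  note [measurable] = borel_measurable_fst_snd
  have "(\<lambda>a :: real \<times> real. (\<lfloor>2 ^ n * fst a\<rfloor>, \<lfloor>2 ^ n * snd a\<rfloor>)) \<in> measurable borel (count_space UNIV)"
    by measurable
  from measurable_compose[OF this, of to_nat "count_space UNIV"] show ?thesis
    unfolding grid_index_def by simp
qed

lemma grid_point_tendsto: "(\<lambda>n. grid_point n (grid_index n a)) \<longlonglongrightarrow> a"
proof -
  have lim: "(\<lambda>n. of_int \<lfloor>2 ^ n * t\<rfloor> / 2 ^ n) \<longlonglongrightarrow> (t :: real)" for t
  proof (rule tendsto_sandwich[of "\<lambda>n. t - (1 / 2) ^ n" _ _ "\<lambda>_. t"])
    have "(\<lambda>n. t - (1 / 2) ^ n) \<longlonglongrightarrow> t - 0"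
      by (intro tendsto_diff tendsto_const LIMSEQ_realpow_zero) auto
    then show "(\<lambda>n. t - (1 / 2) ^ n) \<longlonglongrightarrow> t" by simp
    have "t - (1 / 2) ^ n \<le> of_int \<lfloor>2 ^ n * t\<rfloor> / 2 ^ n" "of_int \<lfloor>2 ^ n * t\<rfloor> / 2 ^ n \<le> t" for n
    proof -
      have "2 ^ n * t < of_int \<lfloor>2 ^ n * t\<rfloor> + 1" "of_int \<lfloor>2 ^ n * t\<rfloor> \<le> 2 ^ n * t"
        by linarith+
      then have "(2 ^ n * t - 1) / 2 ^ n \<le> of_int \<lfloor>2 ^ n * t\<rfloor> / 2 ^ n" "of_int \<lfloor>2 ^ n * t\<rfloor> / 2 ^ n \<le> (2 ^ n * t) / 2 ^ n"
        by (intro divide_right_mono; simp)+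
      then show "t - (1 / 2) ^ n \<le> of_int \<lfloor>2 ^ n * t\<rfloor> / 2 ^ n" "of_int \<lfloor>2 ^ n * t\<rfloor> / 2 ^ n \<le> t"
        by (simp_all add: diff_divide_distrib power_divide)
    qed
    then show "\<forall>\<^sub>F n in sequentially. t - (1 / 2) ^ n \<le> of_int \<lfloor>2 ^ n * t\<rfloor> / 2 ^ n"
      "\<forall>\<^sub>F n in sequentially. of_int \<lfloor>2 ^ n * t\<rfloor> / 2 ^ n \<le> t"
      by (auto intro: always_eventually)
  qed simp
  have "grid_point n (grid_index n a) = (of_int \<lfloor>2 ^ n * fst a\<rfloor> / 2 ^ n, of_int \<lfloor>2 ^ n * snd a\<rfloor> / 2 ^ n)" for n
    by (simp add: grid_point_def grid_index_def)
  then show ?thesis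
    using tendsto_Pair[OF lim[of "fst a"] lim[of "snd a"]] by simp
qed

context ppp
begin

text \<open>The closest point is replaced by the corner of its grid cell, and the grid is refined.
  Infinite products need not converge under this change, and \<open>int\<close> gives no bound
  uniform in the first argument; so the factors are first truncated to a disc, which leaves finite
  products almost surely.\<close>

theorem nearest_pgfl_kernel:
  fixes v :: "real \<times> real \<Rightarrow> real \<times> real \<Rightarrow> real"
  assumes v: "case_prod v \<in> borel_measurable (borel \<Otimes>\<^sub>M borel)"
    and v01: "\<And>a b. 0 \<le> v a b" "\<And>a b. v a b \<le> 1"
    and int: "\<And>a. integrable lborel (\<lambda>b. 1 - v a b)"
    and cont: "\<And>a b. a \<noteq> b \<Longrightarrow> isCont (\<lambda>a. v a b) a"
  shows "(\<integral>\<^sup>+w. iprod (UNIV - {nearest w}) (\<lambda>j. ennreal (v (X (nearest w) w) (X j w))) \<partial>M)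
    = (\<integral>\<^sup>+z. ennreal (lam * void (v z) (norm z)) \<partial>lborel)"
proof -
  have v_meas [measurable (raw)]: "(\<lambda>x. v (f x) (g x)) \<in> borel_measurable N"
    if "f \<in> borel_measurable N" "g \<in> borel_measurable N" for f g and N :: "'b measure"
    using measurable_compose[OF measurable_Pair[OF that] v] by simp
  have v_meas' [measurable]: "v a \<in> borel_measurable borel" for a
    by (rule v_meas) auto
  define u where "u K a b = (if norm b \<le> real K then v a b else 1)" for K :: nat and a b
  have u01: "0 \<le> u K a b" "u K a b \<le> 1" for K a b
    using v01 by (auto simp: u_def)
  have u_meas [measurable]: "u K a \<in> borel_measurable borel" for K a
    unfolding u_def by measurable
  have void_meas: "(\<lambda>z. void (f z) (norm z)) \<in> borel_measurable borel"
    if "case_prod f \<in> borel_measurable (borel \<Otimes>\<^sub>M borel)" for f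
  proof -
    have [measurable]: "(\<lambda>p. f (fst p) (snd p)) \<in> borel_measurable (borel \<Otimes>\<^sub>M borel)"
      using that by (simp add: case_prod_beta')
    have "(\<lambda>p. if norm (fst p) < norm (snd p) then 1 - f (fst p) (snd p) else 0) \<in> borel_measurable (borel \<Otimes>\<^sub>M borel)"
      by measurable
    then have "(\<lambda>p. if norm (fst p) < norm (snd p) then 1 - f (fst p) (snd p) else 0) \<in> borel_measurable (borel \<Otimes>\<^sub>M lborel)"
      by (simp cong: measurable_cong_sets sets_pair_measure_cong)
    then have "(\<lambda>z. LBINT b. if norm z < norm b then 1 - f z b else 0) \<in> borel_measurable borel"
      by (intro lborel.borel_measurable_lebesgue_integral) (simp add: case_prod_beta')
    then show ?thesis unfolding void_def by measurable
  qed
  have u_meas2: "case_prod (u K) \<in> borel_measurable (borel \<Otimes>\<^sub>M borel)" for K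
    unfolding u_def case_prod_beta by measurable
  have u_int: "integrable lborel (\<lambda>b. 1 - u K a b)" for K a
    by (rule Bochner_Integration.integrable_bound[OF int[of a]]) (use v01 in \<open>auto simp: u_def\<close>)
  have trunc: "(\<integral>\<^sup>+w. iprod (UNIV - {nearest w}) (\<lambda>j. ennreal (u K (X (nearest w) w) (X j w))) \<partial>M)
      = (\<integral>\<^sup>+z. ennreal (lam * void (u K z) (norm z)) \<partial>lborel)" for K
  proof -
    let ?c = "\<lambda>n a. grid_point n (grid_index n a)"
    have u_cont: "(\<lambda>n. u K (?c n a) b) \<longlonglongrightarrow> u K a b" if "a \<noteq> b" for a b
      using isCont_tendsto_compose[OF cont[OF that] grid_point_tendsto[of a]] by (simp add: u_def)
    have "(\<lambda>n. \<integral>\<^sup>+w. iprod (UNIV - {nearest w}) (\<lambda>j. ennreal (u K (?c n (X (nearest w) w)) (X j w))) \<partial>M)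
        \<longlonglongrightarrow> (\<integral>\<^sup>+w. iprod (UNIV - {nearest w}) (\<lambda>j. ennreal (u K (X (nearest w) w) (X j w))) \<partial>M)"
    proof (rule nn_integral_dominated_convergence[where w="\<lambda>_. 1"])
      have c_meas: "?c n \<in> borel_measurable borel" for n
        by (rule measurable_compose[OF measurable_grid_index]) simp
      have gm: "(\<lambda>w. iprod (UNIV - {nearest w}) (\<lambda>j. ennreal (u K (g (X (nearest w) w)) (X j w)))) \<in> borel_measurable M"
        if [measurable]: "g \<in> borel_measurable borel" for g
        by (rule measurable_at_nearest[where f="\<lambda>i w. iprod (UNIV - {i}) (\<lambda>j. ennreal (u K (g (X i w)) (X j w)))"])
           (unfold u_def, measurable)
      show "(\<lambda>w. iprod (UNIV - {nearest w}) (\<lambda>j. ennreal (u K (?c n (X (nearest w) w)) (X j w)))) \<in> borel_measurable M" for n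
        by (rule gm[OF c_meas])
      show "(\<lambda>w. iprod (UNIV - {nearest w}) (\<lambda>j. ennreal (u K (X (nearest w) w) (X j w)))) \<in> borel_measurable M"
        using gm[of "\<lambda>a. a"] by simp
      show "AE w in M. (\<lambda>n. iprod (UNIV - {nearest w}) (\<lambda>j. ennreal (u K (?c n (X (nearest w) w)) (X j w))))
          \<longlonglongrightarrow> iprod (UNIV - {nearest w}) (\<lambda>j. ennreal (u K (X (nearest w) w) (X j w)))"
        using AE_locally_finite AE_unique_nearest
      proof eventually_elim
        case (elim w)
        define i where "i = nearest w"
        define J where "J = {j. X j w \<in> cball 0 (real K)} - {i}"
        have finJ: "finite J" using elim by (simp add: J_def)
        \<comment> \<open>Continuity is known off the diagonal only; the strictly larger norms keep
          the other points away from it.\<close>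
        have ne: "X i w \<noteq> X j w" if "j \<in> J" for j
          using nearest_less[OF elim(2), of j] that by (auto simp: J_def i_def)
        have fin: "iprod (UNIV - {i}) (\<lambda>j. ennreal (u K a (X j w))) = ennreal (\<Prod>j\<in>J. u K a (X j w))" for a
        proof -
          have "iprod (UNIV - {i}) (\<lambda>j. ennreal (u K a (X j w))) = (\<Prod>j\<in>J. ennreal (u K a (X j w)))"
            using finJ u01 by (intro iprod_eq_prod) (auto simp: J_def u_def mem_cball_0)
          then show ?thesis using u01 by (simp add: prod_ennreal)
        qed
        have "(\<lambda>n. ennreal (\<Prod>j\<in>J. u K (?c n (X i w)) (X j w))) \<longlonglongrightarrow> ennreal (\<Prod>j\<in>J. u K (X i w) (X j w))"
          using ne by (intro tendsto_ennrealI tendsto_prod u_cont) auto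
        then show ?case unfolding i_def[symmetric] fin .
      qed
      show "AE w in M. iprod (UNIV - {nearest w}) (\<lambda>j. ennreal (u K (?c n (X (nearest w) w)) (X j w))) \<le> 1" for n
        by (intro AE_I2 iprod_le_1)
    qed (auto simp: emeasure_space_1)
    moreover have "(\<integral>\<^sup>+w. iprod (UNIV - {nearest w}) (\<lambda>j. ennreal (u K (?c n (X (nearest w) w)) (X j w))) \<partial>M)
        = (\<integral>\<^sup>+z. ennreal (lam * void (u K (?c n z)) (norm z)) \<partial>lborel)" for n
      using nearest_pgfl_countable[of "\<lambda>p. u K (grid_point n p)" "grid_index n"] u01 u_int by simp
    moreover have "(\<lambda>n. \<integral>\<^sup>+z. ennreal (lam * void (u K (?c n z)) (norm z)) \<partial>lborel)
        \<longlonglongrightarrow> (\<integral>\<^sup>+z. ennreal (lam * void (u K z) (norm z)) \<partial>lborel)"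
    proof (rule nn_integral_void_tendsto)
      have c_meas [measurable]: "?c n \<in> borel_measurable borel" for n
        by (rule measurable_compose[OF measurable_grid_index]) simp
      show "(\<lambda>z. void (u K (?c n z)) (norm z)) \<in> borel_measurable borel" for n
        by (rule void_meas) (unfold u_def case_prod_beta, measurable)
      show "(\<lambda>z. void (u K z) (norm z)) \<in> borel_measurable borel"
        by (rule void_meas[OF u_meas2])
      show "(\<lambda>n. void (u K (?c n z)) (norm z)) \<longlonglongrightarrow> void (u K z) (norm z)" for z
      \<comment> \<open>A majorant common to all grid corners, provided by the truncation.\<close>
      proof (rule void_tendsto[where w="indicator (cball 0 (real K))"])
        show "integrable lborel (indicator (cball 0 (real K)) :: real \<times> real \<Rightarrow> real)"
          using emeasure_bounded_finite[OF bounded_cball, of "0 :: real \<times> real" "real K"]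
          by (intro integrable_real_indicator) auto
        show "\<bar>1 - u K (?c n z) b\<bar> \<le> indicator (cball 0 (real K)) b" for n b
          using v01 by (auto simp: u_def indicator_def mem_cball_0)
        have "AE b in lborel. b \<noteq> z"
          by (rule AE_lborel_singleton)
        then show "AE b in lborel. (\<lambda>n. u K (?c n z) b) \<longlonglongrightarrow> u K z b"
          by eventually_elim (rule u_cont, simp)
      qed measurable
    qed (use u01 in auto)
    ultimately show ?thesis
      using LIMSEQ_unique by simp
  qed
  \<comment> \<open>Removing the truncation: as \<open>K\<close> grows the factors decrease to
    \<open>v\<close>, so \<open>iprod_INF\<close> covers the infinite products.\<close>
  have "(\<lambda>K. \<integral>\<^sup>+w. iprod (UNIV - {nearest w}) (\<lambda>j. ennreal (u K (X (nearest w) w) (X j w))) \<partial>M)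
      \<longlonglongrightarrow> (\<integral>\<^sup>+w. iprod (UNIV - {nearest w}) (\<lambda>j. ennreal (v (X (nearest w) w) (X j w))) \<partial>M)"
  proof (rule nn_integral_dominated_convergence[where w="\<lambda>_. 1"])
    show "(\<lambda>w. iprod (UNIV - {nearest w}) (\<lambda>j. ennreal (u K (X (nearest w) w) (X j w)))) \<in> borel_measurable M" for K
      by (rule measurable_at_nearest[where f="\<lambda>i w. iprod (UNIV - {i}) (\<lambda>j. ennreal (u K (X i w) (X j w)))"])
         (unfold u_def, measurable)
    show "(\<lambda>w. iprod (UNIV - {nearest w}) (\<lambda>j. ennreal (v (X (nearest w) w) (X j w)))) \<in> borel_measurable M"
      by (rule measurable_at_nearest[where f="\<lambda>i w. iprod (UNIV - {i}) (\<lambda>j. ennreal (v (X i w) (X j w)))"])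
         measurable
    have dec: "decseq (\<lambda>K. ennreal (u K a b))" for a b
      using v01 by (intro decseq_SucI ennreal_leI) (auto simp: u_def)
    have lim: "(INF K. ennreal (u K a b)) = ennreal (v a b)" for a b
    proof (rule LIMSEQ_unique[OF LIMSEQ_INF[OF dec]])
      obtain K0 :: nat where "norm b \<le> real K0" using real_arch_simple by blast
      then show "(\<lambda>K. ennreal (u K a b)) \<longlonglongrightarrow> ennreal (v a b)"
        by (intro tendsto_eventually eventually_sequentiallyI[of K0]) (simp add: u_def)
    qed
    have "(\<lambda>K. iprod J (\<lambda>j. ennreal (u K a (X j w)))) \<longlonglongrightarrow> iprod J (\<lambda>j. ennreal (v a (X j w)))" for J a w
    proof -
      have "iprod J (\<lambda>j. ennreal (v a (X j w))) = (INF K. iprod J (\<lambda>j. ennreal (u K a (X j w))))"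
        using dec u01 by (subst iprod_INF) (auto simp: lim)
      then show ?thesis
        by (simp only:) (intro LIMSEQ_INF decseq_SucI iprod_mono decseq_SucD[OF dec])
    qed
    then show "AE w in M. (\<lambda>K. iprod (UNIV - {nearest w}) (\<lambda>j. ennreal (u K (X (nearest w) w) (X j w))))
        \<longlonglongrightarrow> iprod (UNIV - {nearest w}) (\<lambda>j. ennreal (v (X (nearest w) w) (X j w)))"
      by (intro AE_I2)
    show "AE w in M. iprod (UNIV - {nearest w}) (\<lambda>j. ennreal (u K (X (nearest w) w) (X j w))) \<le> 1" for K
      by (intro AE_I2 iprod_le_1)
  qed (auto simp: emeasure_space_1)
  moreover have "(\<lambda>K. \<integral>\<^sup>+z. ennreal (lam * void (u K z) (norm z)) \<partial>lborel)
      \<longlonglongrightarrow> (\<integral>\<^sup>+z. ennreal (lam * void (v z) (norm z)) \<partial>lborel)"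
  proof (rule nn_integral_void_tendsto)
    show "(\<lambda>K. void (u K z) (norm z)) \<longlonglongrightarrow> void (v z) (norm z)" for z
    proof (rule void_tendsto[OF _ _ int[of z]])
      show "\<bar>1 - u K z b\<bar> \<le> 1 - v z b" for K b
        using v01 by (auto simp: u_def)
      show "AE b in lborel. (\<lambda>K. u K z b) \<longlonglongrightarrow> v z b"
      proof (rule AE_I2)
        fix b :: "real \<times> real"
        obtain K0 :: nat where "norm b \<le> real K0" using real_arch_simple by blast
        then show "(\<lambda>K. u K z b) \<longlonglongrightarrow> v z b"
          by (intro tendsto_eventually eventually_sequentiallyI[of K0]) (simp add: u_def)
      qed
    qed measurable
  qed (use u01 in \<open>auto intro!: void_meas[OF u_meas2] void_meas[OF v]\<close>)
  ultimately show ?thesis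
    unfolding trunc by (rule LIMSEQ_unique)
qed

end

section \<open>Access of the tagged node\<close>

text \<open>At \<open>z = 0\<close> the interference \<open>G / l 0 = G / 0 = 0\<close> is always tolerated.\<close>

definition tolerance :: "(real \<Rightarrow> real) \<Rightarrow> real \<Rightarrow> real \<Rightarrow> real \<times> real \<Rightarrow> real" where
  "tolerance l \<mu> c z = (if z = 0 then 1 else 1 - exp (- \<mu> * c * l (norm z)))"

text \<open>The tagged node belongs to the second network \<open>y\<close>; \<open>c\<close> and
  \<open>c'\<close> are the normalised thresholds towards its own and the other network. The timer
  interval may start at any \<open>a\<close>, and the path loss is abstract, so the setting can be
  instantiated for either network.\<close>

locale tagged_access =
  indep_sources M "source_events M x y tW tL GW GWL GL" sources
  for M :: "'a measure" and x y tW tL GW GWL GL +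
  fixes lamW lamL a \<mu> c c' :: real and l :: "real \<Rightarrow> real"
  assumes poisson_x: "poisson_point_process M lamW x" and lamW: "lamW > 0"
    and poisson_y: "poisson_point_process M lamL y" and lamL: "lamL > 0"
    and timer: "\<And>k. distributed M lborel (tL k) (\<lambda>s. indicator {a..a + 1} s / measure lborel {a..a + 1})"
    and GWL: "\<And>j k. distributed M lborel (GWL j k) (exponential_density \<mu>)"
    and GL: "\<And>m k. m \<noteq> k \<Longrightarrow> distributed M lborel (GL m k) (exponential_density \<mu>)"
    and \<mu>: "\<mu> > 0" and c: "c > 0" "c' > 0"
    and l: "l 0 = 0" "\<And>d. d > 0 \<Longrightarrow> l d > 0" "continuous_on {0..} l"
    and integrable_l: "\<And>c. c > 0 \<Longrightarrow> integrable lborel (\<lambda>z :: real \<times> real. exp (- \<mu> * c * l (norm z)))"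
begin

sublocale Px: ppp M lamW x
  using poisson_x lamW by unfold_locales
sublocale Py: ppp M lamL y
  using poisson_y lamL by unfold_locales

lemma borel_measurable_l_norm [measurable]: "(\<lambda>z :: real \<times> real. l (norm z)) \<in> borel_measurable borel"
  by (intro borel_measurable_continuous_onI continuous_on_compose2[OF l(3)] continuous_intros) auto

lemma borel_measurable_l_norm_diff [measurable (raw)]:
  fixes f g :: "'b \<Rightarrow> real \<times> real"
  assumes "f \<in> borel_measurable N" "g \<in> borel_measurable N"
  shows "(\<lambda>u. l (norm (f u - g u))) \<in> borel_measurable N"
  by (rule measurable_compose[OF borel_measurable_diff[OF assms] borel_measurable_l_norm])

lemma l_norm_nonneg: "0 \<le> l (norm (z :: real \<times> real))"
  using l(1) l(2)[of "norm z"] by (cases "z = 0") (auto intro: less_imp_le)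

lemma tolerance_bounds:
  assumes "d > 0"
  shows "0 \<le> tolerance l \<mu> d z" "tolerance l \<mu> d z \<le> 1"
  using \<mu> assms l_norm_nonneg[of z] by (auto simp: tolerance_def)

lemma borel_measurable_tolerance [measurable]: "tolerance l \<mu> d \<in> borel_measurable borel"
  unfolding tolerance_def by measurable

lemma borel_measurable_tolerance_diff [measurable (raw)]:
  fixes f g :: "'b \<Rightarrow> real \<times> real"
  assumes "f \<in> borel_measurable N" "g \<in> borel_measurable N"
  shows "(\<lambda>u. tolerance l \<mu> d (f u - g u)) \<in> borel_measurable N"
  by (rule measurable_compose[OF borel_measurable_diff[OF assms] borel_measurable_tolerance])

section \<open>Averages given the locations and the tagged timer\<close>

lemma nn_integral_fading:
  assumes G: "distributed M lborel G (exponential_density \<mu>)" and d: "d > 0"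
  shows "(\<integral>\<^sup>+w. of_bool (G w / l (norm z) \<le> d) \<partial>M) = ennreal (tolerance l \<mu> d z)"
    "(\<integral>\<^sup>+w. of_bool (\<not> G w / l (norm z) \<le> d) \<partial>M) = ennreal (1 - tolerance l \<mu> d z)"
proof -
  have [measurable]: "G \<in> borel_measurable M"
    using distributed_measurable[OF G] by simp
  have prob: "prob {w \<in> space M. G w / l (norm z) \<le> d} = tolerance l \<mu> d z"
  proof (cases "z = 0")
    case True
    then show ?thesis using d l(1) by (simp add: tolerance_def prob_space)
  next
    case False
    then have pos: "l (norm z) > 0" by (intro l(2)) simp
    then have "{w \<in> space M. G w / l (norm z) \<le> d} = {w \<in> space M. G w \<le> d * l (norm z)}"
      by (simp add: pos_divide_le_eq)
    then show ?thesis
      using exponential_distributedD_le[OF G _ \<mu>, of "d * l (norm z)"] pos d False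
      by (simp add: tolerance_def mult_ac)
  qed
  have "(\<integral>\<^sup>+w. of_bool (G w / l (norm z) \<le> d) \<partial>M) = (\<integral>\<^sup>+w. indicator {w \<in> space M. G w / l (norm z) \<le> d} w \<partial>M)"
    by (intro nn_integral_cong) (auto simp: indicator_def)
  then show "(\<integral>\<^sup>+w. of_bool (G w / l (norm z) \<le> d) \<partial>M) = ennreal (tolerance l \<mu> d z)"
    using prob by (simp add: emeasure_eq_measure)
  have "(\<integral>\<^sup>+w. of_bool (\<not> G w / l (norm z) \<le> d) \<partial>M) = (\<integral>\<^sup>+w. indicator {w \<in> space M. \<not> G w / l (norm z) \<le> d} w \<partial>M)"
    by (intro nn_integral_cong) (auto simp: indicator_def)
  moreover have "prob {w \<in> space M. \<not> G w / l (norm z) \<le> d} = 1 - tolerance l \<mu> d z"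
    unfolding prob[symmetric] by (rule prob_neg) measurable
  ultimately show "(\<integral>\<^sup>+w. of_bool (\<not> G w / l (norm z) \<le> d) \<partial>M) = ennreal (1 - tolerance l \<mu> d z)"
    by (simp add: emeasure_eq_measure)
qed

lemma src_x: "W_points \<in> S \<Longrightarrow> x j \<in> borel_measurable (src S)"
proof -
  assume "W_points \<in> S"
  then have "(\<lambda>w i. x i w) \<in> measurable (src S) (\<Pi>\<^sub>M i\<in>UNIV. borel)"
    by (rule measurable_vimage_src[where s=W_points]) (auto simp: sources_def space_PiM)
  from measurable_compose[OF this measurable_component_singleton[of j]] show ?thesis by simp
qed

lemma src_y: "L_points \<in> S \<Longrightarrow> y j \<in> borel_measurable (src S)"
proof -
  assume "L_points \<in> S"
  then have "(\<lambda>w i. y i w) \<in> measurable (src S) (\<Pi>\<^sub>M i\<in>UNIV. borel)"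
    by (rule measurable_vimage_src[where s=L_points]) (auto simp: sources_def space_PiM)
  from measurable_compose[OF this measurable_component_singleton[of j]] show ?thesis by simp
qed

lemma src_tL: "L_timer k \<in> S \<Longrightarrow> tL k \<in> borel_measurable (src S)"
  by (rule measurable_vimage_src[where s="L_timer k"]) (auto simp: sources_def)

lemma src_GWL: "WL_fading j k \<in> S \<Longrightarrow> GWL j k \<in> borel_measurable (src S)"
  by (rule measurable_vimage_src[where s="WL_fading j k"]) (auto simp: sources_def)

lemma src_GL: "LL_fading j k \<in> S \<Longrightarrow> j \<noteq> k \<Longrightarrow> GL j k \<in> borel_measurable (src S)"
  by (rule measurable_vimage_src[where s="LL_fading j k"]) (auto simp: sources_def)

lemma measurable_sources_M:
  "x j \<in> borel_measurable M" "y j \<in> borel_measurable M" "tL k \<in> borel_measurable M"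
  "GWL j k \<in> borel_measurable M" "j \<noteq> k \<Longrightarrow> GL j k \<in> borel_measurable M"
  using src_x[of UNIV] src_y[of UNIV] src_tL[of k UNIV] src_GWL[of j k UNIV] src_GL[of j k UNIV]
  by (auto intro: measurable_src_imp)

lemma nn_integral_timer:
  assumes [measurable]: "g \<in> borel_measurable borel"
  shows "(\<integral>\<^sup>+w. g (tL k w) \<partial>M) = (\<integral>\<^sup>+s. indicator {a..a + 1} s * g s \<partial>lborel)"
proof -
  have "(\<integral>\<^sup>+w. g (tL k w) \<partial>M) = (\<integral>\<^sup>+s. ennreal (indicator {a..a + 1} s / measure lborel {a..a + 1}) * g s \<partial>lborel)"
    by (rule distributed_nn_integral[OF timer, symmetric]) simp
  then show ?thesis by (simp add: ennreal_indicator)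
qed

definition timer_cdf :: "real \<Rightarrow> real" where
  "timer_cdf s = max 0 (min 1 (s - a))"

lemma timer_cdf_bounds: "0 \<le> timer_cdf s" "timer_cdf s \<le> 1"
  by (auto simp: timer_cdf_def)

lemma nn_integral_timer_less: "(\<integral>\<^sup>+w. of_bool (tL k w < s) \<partial>M) = ennreal (timer_cdf s)"
proof -
  have "(\<integral>\<^sup>+w. of_bool (tL k w < s) \<partial>M) = (\<integral>\<^sup>+u. indicator {a..a + 1} u * of_bool (u < s) \<partial>lborel)"
    by (rule nn_integral_timer) measurable
  also have "\<dots> = (\<integral>\<^sup>+u. indicator ({a..a + 1} \<inter> {..<s}) u \<partial>lborel)"
    by (intro nn_integral_cong) (auto simp: indicator_def)
  also have "\<dots> = emeasure lborel ({a..a + 1} \<inter> {..<s})"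
    by simp
  also have "\<dots> = ennreal (timer_cdf s)"
  proof (cases "s \<le> a + 1")
    case True
    then have "{a..a + 1} \<inter> {..<s} = {a..<s}" by auto
    then show ?thesis using True by (cases "a \<le> s") (auto simp: timer_cdf_def)
  next
    case False
    then have "{a..a + 1} \<inter> {..<s} = {a..a + 1}" by auto
    then show ?thesis using False by (auto simp: timer_cdf_def max_def min_def)
  qed
  finally show ?thesis .
qed

text \<open>The conditional probability that a competitor displaced by \<open>z\<close> does not
  block a node whose timer is \<open>s\<close>.\<close>

definition contention :: "real \<Rightarrow> real \<times> real \<Rightarrow> real" where
  "contention s z = 1 - timer_cdf s * (1 - tolerance l \<mu> c z)"

lemma contention_bounds: "0 \<le> contention s z" "contention s z \<le> 1"
proof -
  have "timer_cdf s * (1 - tolerance l \<mu> c z) \<le> 1 * 1"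
    using timer_cdf_bounds tolerance_bounds[OF c(1)] by (intro mult_mono) auto
  then show "0 \<le> contention s z" by (simp add: contention_def)
  show "contention s z \<le> 1"
    using timer_cdf_bounds tolerance_bounds[OF c(1)] by (simp add: contention_def)
qed

lemma borel_measurable_timer_cdf [measurable]: "timer_cdf \<in> borel_measurable borel"
  unfolding timer_cdf_def by measurable

lemma borel_measurable_contention [measurable (raw)]:
  fixes f g :: "'b \<Rightarrow> real \<times> real"
  assumes [measurable]: "h \<in> borel_measurable N" "f \<in> borel_measurable N" "g \<in> borel_measurable N"
  shows "(\<lambda>u. contention (h u) (f u - g u)) \<in> borel_measurable N"
  unfolding contention_def by measurable

text \<open>Computed through the complement: blocking requires an earlier timer and a strong signal,
  and these two events are independent.\<close>

lemma nn_integral_contention: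
  assumes "j \<noteq> k"
  shows "(\<integral>\<^sup>+w. of_bool (s \<le> tL j w \<or> GL j k w / l (norm z) \<le> c) \<partial>M) = ennreal (contention s z)"
proof -
  note [measurable] = measurable_sources_M(3)[of j] measurable_sources_M(5)[OF assms]
  let ?S = "{L_timer j}" and ?T = "{LL_fading j k}"
  have prod: "(\<integral>\<^sup>+w. of_bool (tL j w < s) * of_bool (\<not> GL j k w / l (norm z) \<le> c) \<partial>M)
      = ennreal (timer_cdf s * (1 - tolerance l \<mu> c z))"
  proof -
    have [measurable]: "tL j \<in> borel_measurable (src ?S)" "GL j k \<in> borel_measurable (src ?T)"
      using src_tL src_GL assms by auto
    have "(\<integral>\<^sup>+w. of_bool (tL j w < s) * of_bool (\<not> GL j k w / l (norm z) \<le> c) \<partial>M)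
        = (\<integral>\<^sup>+w. \<integral>\<^sup>+w'. of_bool (tL j w < s) * of_bool (\<not> GL j k w' / l (norm z) \<le> c) \<partial>M \<partial>M)"
      using nn_integral_decouple[of ?S ?T "\<lambda>p. of_bool (tL j (fst p) < s) * of_bool (\<not> GL j k (snd p) / l (norm z) \<le> c)"]
      by simp
    also have "\<dots> = ennreal (timer_cdf s) * ennreal (1 - tolerance l \<mu> c z)"
      using nn_integral_fading(2)[OF GL[OF assms] c(1)]
      by (simp add: nn_integral_cmult nn_integral_multc nn_integral_timer_less)
    finally show ?thesis
      using timer_cdf_bounds tolerance_bounds[OF c(1)] by (simp add: ennreal_mult)
  qed
  let ?P = "\<lambda>w. tL j w < s \<and> \<not> GL j k w / l (norm z) \<le> c"
  have "(\<integral>\<^sup>+w. of_bool (tL j w < s) * of_bool (\<not> GL j k w / l (norm z) \<le> c) \<partial>M)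
      = (\<integral>\<^sup>+w. indicator {w \<in> space M. ?P w} w \<partial>M)"
    by (intro nn_integral_cong) (auto simp: indicator_def)
  then have "ennreal (prob {w \<in> space M. ?P w}) = ennreal (timer_cdf s * (1 - tolerance l \<mu> c z))"
    using prod by (simp add: emeasure_eq_measure)
  then have P: "prob {w \<in> space M. ?P w} = timer_cdf s * (1 - tolerance l \<mu> c z)"
    using timer_cdf_bounds tolerance_bounds[OF c(1)] by (subst (asm) ennreal_inj) auto
  have "(\<integral>\<^sup>+w. of_bool (s \<le> tL j w \<or> GL j k w / l (norm z) \<le> c) \<partial>M)
      = (\<integral>\<^sup>+w. indicator {w \<in> space M. \<not> ?P w} w \<partial>M)"
    by (intro nn_integral_cong) (auto simp: indicator_def)
  also have "\<dots> = ennreal (1 - prob {w \<in> space M. ?P w})"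
  proof -
    have "prob {w \<in> space M. \<not> ?P w} = 1 - prob {w \<in> space M. ?P w}"
      by (rule prob_neg) measurable
    then show ?thesis by (simp add: emeasure_eq_measure)
  qed
  finally show ?thesis unfolding P contention_def .
qed

text \<open>\<open>J\<close> lists the nodes of the other network that can block: all of them for an
  eNB, none for an AP.\<close>

definition access :: "nat set \<Rightarrow> nat \<Rightarrow> 'a \<Rightarrow> bool" where
  "access J k w \<longleftrightarrow> (\<forall>j\<in>J. GWL j k w / l (norm (x j w - y k w)) \<le> c') \<and>
     (\<forall>j\<in>UNIV - {k}. tL k w \<le> tL j w \<or> GL j k w / l (norm (y j w - y k w)) \<le> c)"

lemma measurable_access [measurable]: "Measurable.pred M (access J k)"
proof -
  note [measurable] = measurable_sources_M
  have "Measurable.pred M (\<lambda>w. j \<in> UNIV - {k} \<longrightarrow> tL k w \<le> tL j w \<or> GL j k w / l (norm (y j w - y k w)) \<le> c)" for j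
  proof (cases "j = k")
    case False
    note [measurable] = measurable_sources_M(5)[OF False]
    show ?thesis by measurable
  qed simp
  then have [measurable]: "Measurable.pred M (\<lambda>w. \<forall>j. j \<in> UNIV - {k} \<longrightarrow> tL k w \<le> tL j w \<or> GL j k w / l (norm (y j w - y k w)) \<le> c)"
    by measurable
  show ?thesis unfolding access_def Ball_def by measurable
qed

text \<open>\<open>\<phi>\<close> will be the indicator that \<open>k\<close> is the index of the
  closest node. The locations and the timer of \<open>k\<close> are held fixed; every other factor
  reads sources of its own, so \<open>nn_integral_decouple_prod\<close> averages them
  separately.\<close>

lemma nn_integral_access_given_timer:
  assumes \<phi>: "\<phi> \<in> borel_measurable (src {L_points})" "\<And>w. \<phi> w \<le> 1"
  shows "(\<integral>\<^sup>+w. \<phi> w * of_bool (access J k w) \<partial>M)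
    = (\<integral>\<^sup>+w. \<phi> w * (iprod J (\<lambda>j. ennreal (tolerance l \<mu> c' (x j w - y k w)))
        * iprod (UNIV - {k}) (\<lambda>j. ennreal (contention (tL k w) (y j w - y k w)))) \<partial>M)"
proof -
  define S where "S = {W_points, L_points, L_timer k}"
  \<comment> \<open>The sum type indexes both networks at once, so all factors are averaged in one
    application. A competitor in the own network brings two sources, its timer and its
    fading.\<close>
  define T where "T = case_sum (\<lambda>j. {WL_fading j k}) (\<lambda>j. {L_timer j, LL_fading j k})"
  define h :: "nat + nat \<Rightarrow> 'a \<times> 'a \<Rightarrow> ennreal" where
    "h = case_sum (\<lambda>j p. of_bool (GWL j k (snd p) / l (norm (x j (fst p) - y k (fst p))) \<le> c'))
      (\<lambda>j p. of_bool (tL k (fst p) \<le> tL j (snd p) \<or> GL j k (snd p) / l (norm (y j (fst p) - y k (fst p))) \<le> c))"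
  let ?K = "UNIV - {k}"
  let ?I = "\<lambda>m. (J \<inter> {..<m}) <+> (?K \<inter> {..<m})"
  let ?p = "\<lambda>w j. ennreal (tolerance l \<mu> c' (x j w - y k w))"
  let ?q = "\<lambda>w j. ennreal (contention (tL k w) (y j w - y k w))"
  let ?A = "\<lambda>w j. of_bool (GWL j k w / l (norm (x j w - y k w)) \<le> c') :: ennreal"
  let ?B = "\<lambda>w j. of_bool (tL k w \<le> tL j w \<or> GL j k w / l (norm (y j w - y k w)) \<le> c) :: ennreal"
  have \<phi>_meas [measurable]: "\<phi> \<in> borel_measurable M"
    using \<phi>(1) by (rule measurable_src_imp)
  note [measurable] = measurable_sources_M(1-4)
  \<comment> \<open>The diagonal variable \<open>GL k k\<close> is not among the sources, so
    measurability is available only for \<open>j \<noteq> k\<close>.\<close>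
  have B_meas: "(\<lambda>w. ?B w j) \<in> borel_measurable M" if "j \<in> ?K" for j
  proof -
    have "j \<noteq> k" using that by simp
    note [measurable] = measurable_sources_M(5)[OF this]
    show ?thesis by measurable
  qed
  have step: "(\<integral>\<^sup>+w. \<phi> w * ((\<Prod>j\<in>J \<inter> {..<m}. ?A w j) * (\<Prod>j\<in>?K \<inter> {..<m}. ?B w j)) \<partial>M)
      = (\<integral>\<^sup>+w. \<phi> w * ((\<Prod>j\<in>J \<inter> {..<m}. ?p w j) * (\<Prod>j\<in>?K \<inter> {..<m}. ?q w j)) \<partial>M)" for m
  proof -
    have "(\<integral>\<^sup>+w. \<phi> w * (\<Prod>i\<in>?I m. h i (w, w)) \<partial>M) = (\<integral>\<^sup>+w. \<phi> w * (\<Prod>i\<in>?I m. \<integral>\<^sup>+w'. h i (w, w') \<partial>M) \<partial>M)"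
    proof (rule nn_integral_decouple_prod)
      show "\<phi> \<in> borel_measurable (src S)"
        by (rule measurable_src_mono[OF \<phi>(1)]) (simp add: S_def)
      show "h i \<in> borel_measurable (src S \<Otimes>\<^sub>M src (T i))" if "i \<in> ?I m" for i
      proof -
        have [measurable]: "x j \<in> borel_measurable (src S)" "y j \<in> borel_measurable (src S)" "tL k \<in> borel_measurable (src S)" for j
          by (auto intro!: src_x src_y src_tL simp: S_def)
        show ?thesis
        proof (cases i)
          case (Inl j)
          have [measurable]: "GWL j k \<in> borel_measurable (src (T i))"
            by (rule src_GWL) (simp add: T_def Inl)
          show ?thesis unfolding h_def Inl sum.case by (measurable, simp add: Inl[symmetric])
        next
          case (Inr j)
          then have jk: "j \<noteq> k" using that by auto
          have [measurable]: "GL j k \<in> borel_measurable (src (T i))" "tL j \<in> borel_measurable (src (T i))"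
            using jk by (auto intro!: src_GL src_tL simp: T_def Inr)
          show ?thesis unfolding h_def Inr sum.case by (measurable, simp_all add: Inr[symmetric])
        qed
      qed
      show "S \<inter> T i = {}" if "i \<in> ?I m" for i
        using that by (auto simp: S_def T_def split: sum.splits)
      show "disjoint_family_on T (?I m)"
        by (auto simp: disjoint_family_on_def T_def split: sum.splits)
    qed simp
    moreover have "(\<Prod>i\<in>?I m. h i (w, w)) = (\<Prod>j\<in>J \<inter> {..<m}. ?A w j) * (\<Prod>j\<in>?K \<inter> {..<m}. ?B w j)" for w
      by (subst prod.Plus) (simp_all add: h_def)
    moreover have "(\<Prod>i\<in>?I m. \<integral>\<^sup>+w'. h i (w, w') \<partial>M) = (\<Prod>j\<in>J \<inter> {..<m}. ?p w j) * (\<Prod>j\<in>?K \<inter> {..<m}. ?q w j)" for w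
      by (subst prod.Plus)
         (auto simp: h_def nn_integral_fading(1)[OF GWL c(2)] nn_integral_contention intro!: arg_cong2[where f="(*)"] prod.cong)
    ultimately show ?thesis by simp
  qed
  \<comment> \<open>Stated for arbitrary factors, since the passage from finite to infinite products
    is made once before and once after averaging.\<close>
  have lim: "(\<lambda>m. \<integral>\<^sup>+w. \<phi> w * ((\<Prod>j\<in>J \<inter> {..<m}. f w j) * (\<Prod>j\<in>?K \<inter> {..<m}. g w j)) \<partial>M)
      \<longlonglongrightarrow> (\<integral>\<^sup>+w. \<phi> w * (iprod J (f w) * iprod ?K (g w)) \<partial>M)"
    if f: "\<And>j. (\<lambda>w. f w j) \<in> borel_measurable M" and g: "\<And>j. j \<in> ?K \<Longrightarrow> (\<lambda>w. g w j) \<in> borel_measurable M"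
      and le1: "\<And>w j. f w j \<le> 1" "\<And>w j. g w j \<le> 1" for f g :: "'a \<Rightarrow> nat \<Rightarrow> ennreal"
  proof (rule nn_integral_dominated_convergence[where w="\<lambda>_. 1"])
    show "(\<lambda>w. \<phi> w * ((\<Prod>j\<in>J \<inter> {..<m}. f w j) * (\<Prod>j\<in>?K \<inter> {..<m}. g w j))) \<in> borel_measurable M" for m
      using f g \<phi>_meas by (intro borel_measurable_times_ennreal borel_measurable_prod_ennreal) auto
    show "(\<lambda>w. \<phi> w * (iprod J (f w) * iprod ?K (g w))) \<in> borel_measurable M"
      using f g \<phi>_meas by (intro borel_measurable_times_ennreal borel_measurable_iprod) auto
    show "AE w in M. \<phi> w * ((\<Prod>j\<in>J \<inter> {..<m}. f w j) * (\<Prod>j\<in>?K \<inter> {..<m}. g w j)) \<le> 1" for m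
      using \<phi>(2) le1 by (intro AE_I2 mult_le_one prod_le_1) auto
    have "(\<lambda>m. \<phi> w * ((\<Prod>j\<in>J \<inter> {..<m}. f w j) * (\<Prod>j\<in>?K \<inter> {..<m}. g w j)))
        \<longlonglongrightarrow> \<phi> w * (iprod J (f w) * iprod ?K (g w))" for w
    proof (rule ennreal_tendsto_cmult)
      show "\<phi> w < top"
        using \<phi>(2)[of w] by (simp add: le_less_trans)
      have "decseq (\<lambda>m. (\<Prod>j\<in>J \<inter> {..<m}. f w j) * (\<Prod>j\<in>?K \<inter> {..<m}. g w j))"
        using decseq_prod_Int_lessThan[of J "f w"] decseq_prod_Int_lessThan[of ?K "g w"] le1
        by (auto simp: decseq_def intro!: mult_mono)
      then show "(\<lambda>m. (\<Prod>j\<in>J \<inter> {..<m}. f w j) * (\<Prod>j\<in>?K \<inter> {..<m}. g w j)) \<longlonglongrightarrow> iprod J (f w) * iprod ?K (g w)"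
        unfolding iprod_mult_iprod[OF le1] by (rule LIMSEQ_INF)
    qed
    then show "AE w in M. (\<lambda>m. \<phi> w * ((\<Prod>j\<in>J \<inter> {..<m}. f w j) * (\<Prod>j\<in>?K \<inter> {..<m}. g w j)))
        \<longlonglongrightarrow> \<phi> w * (iprod J (f w) * iprod ?K (g w))"
      by (intro AE_I2)
  qed (auto simp: emeasure_space_1)
  have "(\<integral>\<^sup>+w. \<phi> w * of_bool (access J k w) \<partial>M) = (\<integral>\<^sup>+w. \<phi> w * (iprod J (?A w) * iprod ?K (?B w)) \<partial>M)"
    unfolding iprod_indicator access_def by (intro nn_integral_cong) simp
  also have "\<dots> = (\<integral>\<^sup>+w. \<phi> w * (iprod J (?p w) * iprod ?K (?q w)) \<partial>M)"
  proof (rule LIMSEQ_unique)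
    show "(\<lambda>m. \<integral>\<^sup>+w. \<phi> w * ((\<Prod>j\<in>J \<inter> {..<m}. ?A w j) * (\<Prod>j\<in>?K \<inter> {..<m}. ?B w j)) \<partial>M)
        \<longlonglongrightarrow> (\<integral>\<^sup>+w. \<phi> w * (iprod J (?A w) * iprod ?K (?B w)) \<partial>M)"
    proof (rule lim)
      show "(\<lambda>w. ?A w j) \<in> borel_measurable M" for j by measurable
    qed (auto intro: B_meas)
    show "(\<lambda>m. \<integral>\<^sup>+w. \<phi> w * ((\<Prod>j\<in>J \<inter> {..<m}. ?A w j) * (\<Prod>j\<in>?K \<inter> {..<m}. ?B w j)) \<partial>M)
        \<longlonglongrightarrow> (\<integral>\<^sup>+w. \<phi> w * (iprod J (?p w) * iprod ?K (?q w)) \<partial>M)"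
      unfolding step
    proof (rule lim)
      show "(\<lambda>w. ?p w j) \<in> borel_measurable M" "(\<lambda>w. ?q w j) \<in> borel_measurable M" for j by measurable
    qed (use tolerance_bounds[OF c(2)] contention_bounds in auto)
  qed
  finally show ?thesis .
qed

end

lemma integral_translate_plane:
  fixes f :: "real \<times> real \<Rightarrow> real"
  assumes [measurable]: "f \<in> borel_measurable borel"
  shows "(LBINT b. f (b - z)) = (LBINT b. f b)"
    and "integrable lborel f \<Longrightarrow> integrable lborel (\<lambda>b. f (b - z))"
proof -
  have d: "distr lborel borel ((+) (- z)) = (lborel :: (real \<times> real) measure)"
    by (rule lborel_distr_plus)
  have "(LBINT b. f b) = (\<integral>b. f b \<partial>distr lborel borel ((+) (- z)))" by (simp only: d)
  also have "\<dots> = (LBINT b. f (- z + b))"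
    by (rule integral_distr) measurable
  finally show "(LBINT b. f (b - z)) = (LBINT b. f b)" by (simp add: algebra_simps)
  assume "integrable lborel f"
  then have "integrable (distr lborel borel ((+) (- z))) f" by (simp only: d)
  then have "integrable lborel (\<lambda>b. f (- z + b))"
    by (subst (asm) integrable_distr_eq) measurable
  then show "integrable lborel (\<lambda>b. f (b - z))" by (simp add: algebra_simps)
qed

lemma nn_integral_exp_unit_interval:
  fixes N :: real
  assumes "N > 0"
  shows "(\<integral>\<^sup>+t. indicator {0..1} t * ennreal (exp (- (t * N))) \<partial>lborel) = ennreal ((1 - exp (- N)) / N)"
proof -
  have "(\<integral>\<^sup>+t. indicator {0..1} t * ennreal (exp (- (t * N))) \<partial>lborel)
      = (\<integral>\<^sup>+t. ennreal (exp (- (t * N))) * indicator {0..1} t \<partial>lborel)"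
    by (simp add: mult.commute)
  also have "\<dots> = ennreal (- exp (- (1 * N)) / N - - exp (- (0 * N)) / N)"
    by (rule nn_integral_FTC_Icc) (use assms in \<open>auto intro!: derivative_eq_intros\<close>)
  finally show ?thesis using assms by (simp add: field_simps)
qed

section \<open>Averages over the tagged timer, the other network and the locations\<close>

context tagged_access
begin

abbreviation "near \<equiv> Py.nearest"

lemma near_src: "L_points \<in> S \<Longrightarrow> near \<in> measurable (src S) (count_space UNIV)"
  unfolding Py.nearest_def[abs_def] by (rule measurable_closest_index) (rule src_y)

text \<open>The mean number of competitors outside the disc whose signal at \<open>z\<close> exceeds
  the threshold.\<close>

definition load :: "real \<times> real \<Rightarrow> real" where
  "load z = lamL * (LBINT b. if norm z < norm b then 1 - tolerance l \<mu> c (b - z) else 0)"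

lemma one_minus_tolerance:
  "AE b in lborel. 1 - tolerance l \<mu> d (b - z) = exp (- \<mu> * d * l (norm (b - z)))"
  using AE_lborel_singleton[of z] by eventually_elim (simp add: tolerance_def)

lemma integrable_tolerance:
  assumes "d > 0"
  shows "integrable lborel (\<lambda>b. 1 - tolerance l \<mu> d (b - z))"
proof -
  have "integrable lborel (\<lambda>b. exp (- \<mu> * d * l (norm (b - z))))"
    by (rule integral_translate_plane(2)[of "\<lambda>b. exp (- \<mu> * d * l (norm b))"]) (use integrable_l[OF assms] in measurable)
  then show ?thesis
    using one_minus_tolerance[of d z] by (subst integrable_cong_AE) auto
qed

lemma integral_tolerance:
  "(LBINT b. 1 - tolerance l \<mu> d (b - z)) = (LBINT b. exp (- \<mu> * d * l (norm (b :: real \<times> real))))"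
proof -
  have "(LBINT b. 1 - tolerance l \<mu> d (b - z)) = (LBINT b. exp (- \<mu> * d * l (norm (b - z))))"
    using one_minus_tolerance by (intro integral_cong_AE) auto
  also have "\<dots> = (LBINT b. exp (- \<mu> * d * l (norm (b :: real \<times> real))))"
    by (rule integral_translate_plane(1)[of "\<lambda>b. exp (- \<mu> * d * l (norm b))"]) measurable
  finally show ?thesis .
qed

text \<open>Translation invariance removes \<open>z\<close>: the other network contributes the same
  constant wherever the tagged node is.\<close>

lemma nn_integral_all_tolerance:
  "(\<integral>\<^sup>+w. iprod UNIV (\<lambda>j. ennreal (tolerance l \<mu> c' (x j w - z))) \<partial>M)
    = ennreal (exp (- (lamW * (LBINT b. exp (- \<mu> * c' * l (norm (b :: real \<times> real)))))))"
  using Px.pgfl[of "\<lambda>b. tolerance l \<mu> c' (b - z)" "{}" "\<lambda>_. 1"] tolerance_bounds[OF c(2)] integrable_tolerance[OF c(2)]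
  by (simp add: integral_tolerance emeasure_space_1)

text \<open>Here \<open>t\<close> stands for the tagged timer minus \<open>a\<close>, which is
  uniform on the unit interval.\<close>

definition survive :: "nat \<Rightarrow> real \<Rightarrow> 'a \<Rightarrow> ennreal" where
  "survive k t w = iprod (UNIV - {k}) (\<lambda>j. ennreal (1 - t * (1 - tolerance l \<mu> c (y j w - y k w))))"

lemma measurable_survive:
  assumes "f \<in> borel_measurable N" "g \<in> measurable N (src S)" "L_points \<in> S"
  shows "(\<lambda>u. survive k (f u) (g u)) \<in> borel_measurable N"
proof -
  have [measurable]: "(\<lambda>u. y j (g u)) \<in> borel_measurable N" for j
    by (rule measurable_compose[OF assms(2) src_y[OF assms(3)]])
  note [measurable] = assms(1)
  show ?thesis unfolding survive_def by measurable
qed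

lemma measurable_survive_near:
  assumes f: "f \<in> borel_measurable N" and g: "g \<in> measurable N (src S)" and S: "L_points \<in> S"
  shows "(\<lambda>u. survive (near (g u)) (f u) (g u)) \<in> borel_measurable N"
  by (rule measurable_compose_countable[OF measurable_survive[OF f g S] measurable_compose[OF g near_src[OF S]]])

lemma measurable_mark_near:
  assumes f: "f \<in> measurable N (src {W_points})" and g: "g \<in> measurable N (src {L_points})"
  shows "(\<lambda>u. iprod J (\<lambda>j. ennreal (tolerance l \<mu> c' (x j (f u) - y (near (g u)) (g u))))) \<in> borel_measurable N"
proof (rule measurable_compose_countable[OF _ measurable_compose[OF g near_src],
      where f="\<lambda>k u. iprod J (\<lambda>j. ennreal (tolerance l \<mu> c' (x j (f u) - y k (g u))))"])
  fix k
  have [measurable]: "(\<lambda>u. y j (g u)) \<in> borel_measurable N" "(\<lambda>u. x j (f u)) \<in> borel_measurable N" for j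
    using measurable_compose[OF g src_y] measurable_compose[OF f src_x] by auto
  show "(\<lambda>u. iprod J (\<lambda>j. ennreal (tolerance l \<mu> c' (x j (f u) - y k (g u))))) \<in> borel_measurable N"
    by measurable
qed simp

text \<open>The shift by \<open>a\<close> carries the timer interval to the unit interval, where the
  distribution function is the identity.\<close>

lemma timer_average:
  "(\<integral>\<^sup>+w'. iprod (UNIV - {k}) (\<lambda>j. ennreal (contention (tL k w') (y j w - y k w))) \<partial>M)
    = (\<integral>\<^sup>+t. indicator {0..1} t * survive k t w \<partial>lborel)"
proof -
  let ?g = "\<lambda>s. iprod (UNIV - {k}) (\<lambda>j. ennreal (contention s (y j w - y k w)))"
  have g [measurable]: "?g \<in> borel_measurable borel" by measurable
  have "(\<integral>\<^sup>+w'. ?g (tL k w') \<partial>M) = (\<integral>\<^sup>+s. indicator {a..a + 1} s * ?g s \<partial>lborel)"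
    by (rule nn_integral_timer[OF g])
  also have "\<dots> = (\<integral>\<^sup>+t. indicator {a..a + 1} (a + 1 * t) * ?g (a + 1 * t) \<partial>lborel)"
    by (subst nn_integral_real_affine[where c=1 and t=a]) auto
  also have "\<dots> = (\<integral>\<^sup>+t. indicator {0..1} t * survive k t w \<partial>lborel)"
    by (intro nn_integral_cong) (auto simp: indicator_def survive_def contention_def timer_cdf_def)
  finally show ?thesis .
qed

lemma expand_near:
  fixes f :: "nat \<Rightarrow> ennreal"
  shows "f (near w) = (\<Sum>k. of_bool (near w = k) * f k)"
proof -
  have "(\<Sum>k. of_bool (near w = k) * f k) = (\<Sum>k\<in>{near w}. of_bool (near w = k) * f k)"
    by (intro suminf_finite) auto
  then show ?thesis by simp
qed

text \<open>The event \<open>near w = k\<close> depends on \<open>L_points\<close> only. For fixed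
  \<open>k\<close> the competitors are averaged first, and then the timer of \<open>k\<close>, which
  is independent of all locations; summing over \<open>k\<close> restores the random index.\<close>

lemma nn_integral_access_near:
  "(\<integral>\<^sup>+w. of_bool (access J (near w) w) \<partial>M)
    = (\<integral>\<^sup>+w. iprod J (\<lambda>j. ennreal (tolerance l \<mu> c' (x j w - y (near w) w)))
        * (\<integral>\<^sup>+t. indicator {0..1} t * survive (near w) t w \<partial>lborel) \<partial>M)"
proof -
  let ?p = "\<lambda>k w. iprod J (\<lambda>j. ennreal (tolerance l \<mu> c' (x j w - y k w)))"
  let ?q = "\<lambda>k w. \<integral>\<^sup>+t. indicator {0..1} t * survive k t w \<partial>lborel"
  note [measurable] = measurable_sources_M(1-4)
  have near_M [measurable]: "near \<in> measurable M (count_space UNIV)" by measurable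
  have id: "(\<lambda>w. w) \<in> measurable M (src {L_points})"
    using measurable_src_imp[OF measurable_ident_sets[OF refl]] .
  have q_meas: "?q k \<in> borel_measurable M" for k
  proof (rule lborel.borel_measurable_nn_integral)
    have "(\<lambda>p. snd p) \<in> borel_measurable (M \<Otimes>\<^sub>M lborel)" "(\<lambda>p. fst p) \<in> measurable (M \<Otimes>\<^sub>M lborel) (src {L_points})"
      using measurable_compose[OF measurable_fst id] by auto
    from measurable_survive[OF this] show "(\<lambda>(w, t). indicator {0..1} t * survive k t w) \<in> borel_measurable (M \<Otimes>\<^sub>M lborel)"
      by (auto simp: case_prod_beta' intro!: borel_measurable_times_ennreal)
  qed
  have "(\<integral>\<^sup>+w. of_bool (access J (near w) w) \<partial>M) = (\<integral>\<^sup>+w. (\<Sum>k. of_bool (near w = k) * of_bool (access J k w)) \<partial>M)"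
    by (intro nn_integral_cong) (rule expand_near[where f="\<lambda>k. of_bool (access J k w)" for w])
  also have "\<dots> = (\<Sum>k. \<integral>\<^sup>+w. of_bool (near w = k) * of_bool (access J k w) \<partial>M)"
    by (rule nn_integral_suminf) measurable
  also have "\<dots> = (\<Sum>k. \<integral>\<^sup>+w. of_bool (near w = k) * (?p k w * ?q k w) \<partial>M)"
  proof (rule arg_cong[where f=suminf], rule ext)
    fix k
    let ?S = "{W_points, L_points}" and ?T = "{L_timer k}"
    let ?h = "\<lambda>u v. of_bool (near u = k) * (?p k u
        * iprod (UNIV - {k}) (\<lambda>j. ennreal (contention (tL k v) (y j u - y k u)))) :: ennreal"
    have "(\<integral>\<^sup>+w. of_bool (near w = k) * of_bool (access J k w) \<partial>M) = (\<integral>\<^sup>+w. ?h w w \<partial>M)"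
    proof (rule nn_integral_access_given_timer)
      have [measurable]: "near \<in> measurable (src {L_points}) (count_space UNIV)" by (rule near_src) simp
      show "(\<lambda>w. of_bool (near w = k)) \<in> borel_measurable (src {L_points})" by measurable
    qed simp
    also have "\<dots> = (\<integral>\<^sup>+w. (\<lambda>p. ?h (fst p) (snd p)) (w, w) \<partial>M)" by simp
    also have "\<dots> = (\<integral>\<^sup>+w. \<integral>\<^sup>+w'. (\<lambda>p. ?h (fst p) (snd p)) (w, w') \<partial>M \<partial>M)"
    proof (rule nn_integral_decouple[of ?S ?T])
      have [measurable]: "x j \<in> borel_measurable (src ?S)" "y j \<in> borel_measurable (src ?S)"
        "tL k \<in> borel_measurable (src ?T)" "near \<in> measurable (src ?S) (count_space UNIV)" for j
        by (auto intro!: src_x src_y src_tL near_src)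
      show "(\<lambda>p. ?h (fst p) (snd p)) \<in> borel_measurable (src ?S \<Otimes>\<^sub>M src ?T)"
        by measurable
    qed auto
    also have "\<dots> = (\<integral>\<^sup>+w. of_bool (near w = k) * (?p k w * ?q k w) \<partial>M)"
      by (simp add: nn_integral_cmult timer_average)
    finally show "(\<integral>\<^sup>+w. of_bool (near w = k) * of_bool (access J k w) \<partial>M)
      = (\<integral>\<^sup>+w. of_bool (near w = k) * (?p k w * ?q k w) \<partial>M)" .
  qed
  also have "\<dots> = (\<integral>\<^sup>+w. (\<Sum>k. of_bool (near w = k) * (?p k w * ?q k w)) \<partial>M)"
    by (intro nn_integral_suminf[symmetric] borel_measurable_times_ennreal q_meas) measurable
  also have "\<dots> = (\<integral>\<^sup>+w. ?p (near w) w * ?q (near w) w \<partial>M)"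
    by (intro nn_integral_cong) (rule expand_near[where f="\<lambda>k. ?p k w * ?q k w" for w, symmetric])
  finally show ?thesis .
qed

text \<open>The two point processes are independent. Averaging over the other network yields
  \<open>K\<close> for every tagged location, so the constant factors out, and the two remaining
  integrals commute.\<close>

lemma nn_integral_access_factor:
  assumes K: "\<And>z. (\<integral>\<^sup>+w. iprod J (\<lambda>j. ennreal (tolerance l \<mu> c' (x j w - z))) \<partial>M) = K"
  shows "(\<integral>\<^sup>+w. of_bool (access J (near w) w) \<partial>M)
    = K * (\<integral>\<^sup>+t. indicator {0..1} t * (\<integral>\<^sup>+w. survive (near w) t w \<partial>M) \<partial>lborel)"
proof -
  let ?S = "{L_points}" and ?T = "{W_points}"
  let ?p = "\<lambda>u v. iprod J (\<lambda>j. ennreal (tolerance l \<mu> c' (x j v - y (near u) u)))"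
  let ?q = "\<lambda>w. \<integral>\<^sup>+t. indicator {0..1} t * survive (near w) t w \<partial>lborel"
  interpret MT: pair_sigma_finite M lborel ..
  have joint: "(\<lambda>(w, t). indicator {0..1} t * survive (near w) t w) \<in> borel_measurable (N \<Otimes>\<^sub>M lborel)"
    if "(\<lambda>w. w) \<in> measurable N (src ?S)" for N
  proof -
    have "(\<lambda>p. snd p) \<in> borel_measurable (N \<Otimes>\<^sub>M lborel)" "(\<lambda>p. fst p) \<in> measurable (N \<Otimes>\<^sub>M lborel) (src ?S)"
      using measurable_compose[OF measurable_fst that] by auto
    from measurable_survive_near[OF this] show ?thesis
      by (auto simp: case_prod_beta' intro!: borel_measurable_times_ennreal)
  qed
  have id: "(\<lambda>w. w) \<in> measurable M (src ?S)"
    using measurable_src_imp[OF measurable_ident_sets[OF refl]] .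
  have q_meas: "?q \<in> borel_measurable (src ?S)"
    by (rule lborel.borel_measurable_nn_integral[OF joint]) simp
  have p_meas: "(\<lambda>p. ?p (fst p) (snd p)) \<in> borel_measurable (src ?S \<Otimes>\<^sub>M src ?T)"
    by (rule measurable_mark_near) auto
  have "(\<integral>\<^sup>+w. of_bool (access J (near w) w) \<partial>M) = (\<integral>\<^sup>+w. (\<lambda>p. ?p (fst p) (snd p) * ?q (fst p)) (w, w) \<partial>M)"
    unfolding nn_integral_access_near by simp
  also have "\<dots> = (\<integral>\<^sup>+w. \<integral>\<^sup>+w'. (\<lambda>p. ?p (fst p) (snd p) * ?q (fst p)) (w, w') \<partial>M \<partial>M)"
    by (rule nn_integral_decouple[of ?S ?T])
       (auto intro!: borel_measurable_times_ennreal p_meas measurable_compose[OF measurable_fst q_meas])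
  also have "\<dots> = (\<integral>\<^sup>+w. K * ?q w \<partial>M)"
  proof (intro nn_integral_cong)
    fix w
    note [measurable] = measurable_sources_M(1)
    have "(\<integral>\<^sup>+w'. ?p w w' * ?q w \<partial>M) = (\<integral>\<^sup>+w'. ?p w w' \<partial>M) * ?q w"
      by (rule nn_integral_multc) measurable
    then show "(\<integral>\<^sup>+w'. (\<lambda>p. ?p (fst p) (snd p) * ?q (fst p)) (w, w') \<partial>M) = K * ?q w"
      by (simp add: K)
  qed
  also have "\<dots> = K * (\<integral>\<^sup>+w. ?q w \<partial>M)"
    using q_meas by (intro nn_integral_cmult measurable_src_imp)
  also have "(\<integral>\<^sup>+w. ?q w \<partial>M) = (\<integral>\<^sup>+t. \<integral>\<^sup>+w. indicator {0..1} t * survive (near w) t w \<partial>M \<partial>lborel)"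
    by (rule MT.Fubini'[OF joint[OF id], symmetric])
  also have "\<dots> = (\<integral>\<^sup>+t. indicator {0..1} t * (\<integral>\<^sup>+w. survive (near w) t w \<partial>M) \<partial>lborel)"
    by (intro nn_integral_cong nn_integral_cmult measurable_survive_near[OF _ id]) auto
  finally show ?thesis .
qed

text \<open>\<open>tolerance\<close> jumps at 0, where its value is 1; away from that point it
  agrees locally with a continuous expression.\<close>

lemma isCont_tolerance:
  assumes "b \<noteq> u"
  shows "isCont (\<lambda>u. tolerance l \<mu> d (b - u)) u"
proof -
  have "isCont (\<lambda>u. 1 - exp (- \<mu> * d * l (norm (b - u)))) u"
  proof (intro continuous_intros)
    have "continuous_on UNIV (\<lambda>u. l (norm (b - u)))"
      by (intro continuous_on_compose2[OF l(3)] continuous_intros) auto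
    then show "isCont (\<lambda>u. l (norm (b - u))) u"
      by (rule continuous_on_interior) simp
  qed
  moreover have "\<forall>\<^sub>F v in nhds u. tolerance l \<mu> d (b - v) = 1 - exp (- \<mu> * d * l (norm (b - v)))"
    by (rule eventually_mono[OF t1_space_nhds[of u b]]) (use assms in \<open>auto simp: tolerance_def\<close>)
  ultimately show ?thesis
    by (subst isCont_cong)
qed

text \<open>The exponent of \<open>void\<close> is linear in \<open>1 - v\<close>, so
  \<open>t\<close> comes out as a factor of \<open>load z\<close>, and the probability of the empty
  disc splits off.\<close>

lemma nn_integral_survive:
  assumes t: "0 \<le> t" "t \<le> 1"
  shows "(\<integral>\<^sup>+w. survive (near w) t w \<partial>M)
    = (\<integral>\<^sup>+z. ennreal (lamL * exp (- (lamL * (pi * (norm z)\<^sup>2)))) * ennreal (exp (- (t * load z))) \<partial>lborel)"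
proof -
  define v where "v u b = 1 - t * (1 - tolerance l \<mu> c (b - u))" for u b :: "real \<times> real"
  have "(\<integral>\<^sup>+w. survive (near w) t w \<partial>M)
      = (\<integral>\<^sup>+w. iprod (UNIV - {near w}) (\<lambda>j. ennreal (v (y (near w) w) (y j w))) \<partial>M)"
    by (simp add: survive_def v_def)
  also have "\<dots> = (\<integral>\<^sup>+z. ennreal (lamL * Py.void (v z) (norm z)) \<partial>lborel)"
  proof (rule Py.nearest_pgfl_kernel)
    show "case_prod v \<in> borel_measurable (borel \<Otimes>\<^sub>M borel)"
      unfolding v_def case_prod_beta' by measurable
    show "0 \<le> v u b" for u b
    proof -
      have "t * (1 - tolerance l \<mu> c (b - u)) \<le> 1 * 1"
        using t tolerance_bounds[OF c(1)] by (intro mult_mono) auto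
      then show ?thesis by (simp add: v_def)
    qed
    show "v u b \<le> 1" for u b
      using t tolerance_bounds[OF c(1)] by (simp add: v_def)
    show "integrable lborel (\<lambda>b. 1 - v u b)" for u
      using integrable_tolerance[OF c(1), of u] by (simp add: v_def)
    show "isCont (\<lambda>u. v u b) u" if "u \<noteq> b" for u b
      unfolding v_def using that by (intro continuous_intros isCont_tolerance) auto
  qed
  also have "\<dots> = (\<integral>\<^sup>+z. ennreal (lamL * exp (- (lamL * (pi * (norm z)\<^sup>2)))) * ennreal (exp (- (t * load z))) \<partial>lborel)"
  proof (intro nn_integral_cong)
    fix z :: "real \<times> real"
    have "(LBINT b. if norm z < norm b then 1 - v z b else 0)
        = (LBINT b. t * (if norm z < norm b then 1 - tolerance l \<mu> c (b - z) else 0))"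
      by (intro Bochner_Integration.integral_cong) (auto simp: v_def)
    also have "\<dots> = t * (LBINT b. if norm z < norm b then 1 - tolerance l \<mu> c (b - z) else 0)"
      by simp
    finally have "Py.void (v z) (norm z) = exp (- (lamL * (pi * (norm z)\<^sup>2))) * exp (- (t * load z))"
      by (simp add: Py.void_def load_def algebra_simps flip: exp_add)
    then show "ennreal (lamL * Py.void (v z) (norm z))
        = ennreal (lamL * exp (- (lamL * (pi * (norm z)\<^sup>2)))) * ennreal (exp (- (t * load z)))"
      using lamL by (simp add: ennreal_mult' mult.assoc)
  qed
  finally show ?thesis .
qed

text \<open>Written in the shape shared by \<open>N2W\<close> and \<open>N1L\<close>, which makes
  the final identification a mere unfolding.\<close>

definition radial_load :: "real \<Rightarrow> real" where
  "radial_load r = lamL * (LBINT b:- cball (0 :: real \<times> real) r. exp (- \<mu> * c * l (norm (b - (r, 0)))))"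

text \<open>A rotation moves \<open>z\<close> to the positive first axis. Rotation invariance is
  available for nonnegative integrals, hence the detour through \<open>enn2real\<close>.\<close>

lemma load_eq: "load z = radial_load (norm z)"
proof -
  \<comment> \<open>\<open>l\<close> is known to be continuous only on nonnegative arguments; the
    absolute value makes it a Borel function on the whole line and changes nothing at norms.\<close>
  let ?f = "\<lambda>d. exp (- \<mu> * c * l \<bar>d\<bar>)"
  have "continuous_on UNIV (\<lambda>d. l \<bar>d :: real\<bar>)"
    by (intro continuous_on_compose2[OF l(3)] continuous_intros) auto
  then have [measurable]: "(\<lambda>d. l \<bar>d :: real\<bar>) \<in> borel_measurable borel"
    by (rule borel_measurable_continuous_onI)
  have f: "(\<lambda>d. ennreal (?f d)) \<in> borel_measurable borel" by measurable
  have "(LBINT b. if norm z < norm b then 1 - tolerance l \<mu> c (b - z) else 0)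
      = (LBINT b. indicator {b. norm b > norm z} b * ?f (norm (b - z)))"
    using one_minus_tolerance[of c z]
    by (intro integral_cong_AE) (measurable, auto elim!: eventually_mono simp: indicator_def)
  also have "\<dots> = enn2real (\<integral>\<^sup>+b. indicator {b. norm b > norm z} b * ennreal (?f (norm (b - z))) \<partial>lborel)"
    by (subst integral_eq_nn_integral)
       (measurable, auto intro!: arg_cong[where f=enn2real] nn_integral_cong simp: indicator_def)
  also have "\<dots> = enn2real (\<integral>\<^sup>+b. indicator {b. norm b > norm z} b * ennreal (?f (norm (b - (norm z, 0 :: real)))) \<partial>lborel)"
    by (subst nn_integral_outside_ball_rotate[OF f]) (rule refl)
  also have "\<dots> = (LBINT b. indicator {b. norm b > norm z} b * ?f (norm (b - (norm z, 0 :: real))))"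
    by (subst integral_eq_nn_integral)
       (measurable, auto intro!: arg_cong[where f=enn2real] nn_integral_cong simp: indicator_def)
  also have "\<dots> = (LBINT b:- cball (0 :: real \<times> real) (norm z). exp (- \<mu> * c * l (norm (b - (norm z, 0 :: real)))))"
    unfolding set_lebesgue_integral_def
    by (intro Bochner_Integration.integral_cong) (auto simp: indicator_def mem_cball_0 not_le)
  finally show ?thesis unfolding load_def radial_load_def by simp
qed

text \<open>This justifies dividing by the load. The exponential is positive everywhere, and the
  exterior of a disc is not a null set because the plane has infinite area.\<close>

lemma load_pos: "load z > 0"
proof -
  let ?f = "\<lambda>b. if norm z < norm b then exp (- \<mu> * c * l (norm (b - z))) else 0"
  have eq: "(LBINT b. if norm z < norm b then 1 - tolerance l \<mu> c (b - z) else 0) = integral\<^sup>L lborel ?f"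
    using one_minus_tolerance[of c z] by (intro integral_cong_AE) (measurable, auto elim!: eventually_mono)
  have int: "integrable lborel ?f"
    by (rule Bochner_Integration.integrable_bound[OF integrable_tolerance[OF c(1), of z]])
       (use one_minus_tolerance[of c z] in \<open>measurable, auto elim!: eventually_mono\<close>)
  have ne: "integral\<^sup>L lborel ?f \<noteq> 0"
  proof
    assume "integral\<^sup>L lborel ?f = 0"
    then have "AE b in lborel. ?f b = 0"
      using integral_nonneg_eq_0_iff_AE[OF int] by auto
    then have "AE b in lborel. b \<in> cball (0 :: real \<times> real) (norm z)"
      by eventually_elim (auto simp: mem_cball_0 not_less split: if_splits)
    then have "emeasure lborel (UNIV :: (real \<times> real) set) \<le> emeasure lborel (cball (0 :: real \<times> real) (norm z))"
      by (intro emeasure_mono_AE) auto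
    then show False
      by (simp add: emeasure_lborel_UNIV emeasure_cball_plane top_unique)
  qed
  have nonneg: "0 \<le> integral\<^sup>L lborel ?f"
    by (intro integral_nonneg_AE AE_I2) auto
  from le_neq_trans[OF nonneg ne[symmetric]] show ?thesis
    unfolding load_def eq using lamL by (rule mult_pos_pos[rotated])
qed

text \<open>Serves both networks: \<open>K\<close> is the contribution of the other network to the
  access probability.\<close>

theorem prob_access_near:
  assumes K: "\<And>z. (\<integral>\<^sup>+w. iprod J (\<lambda>j. ennreal (tolerance l \<mu> c' (x j w - z))) \<partial>M) = ennreal K" "K \<ge> 0"
  shows "prob {w \<in> space M. access J (near w) w}
    = (LBINT r:{0..}. K * ((1 - exp (- radial_load r)) / radial_load r) * closest_dist_density lamL r)"
proof -
  let ?g = "\<lambda>z :: real \<times> real. ennreal (lamL * exp (- (lamL * (pi * (norm z)\<^sup>2))))"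
  let ?F = "\<lambda>r. (1 - exp (- radial_load r)) / radial_load r"
  have rl_pos: "radial_load r > 0" if "r \<ge> 0" for r
    using load_pos[of "(r, 0)"] load_eq[of "(r, 0)"] that by simp
  \<comment> \<open>The domain of integration varies with \<open>r\<close>, so measurability is read
    off an integral over the whole plane with \<open>r\<close> as a parameter.\<close>
  have rl_meas [measurable]: "radial_load \<in> borel_measurable borel"
  proof -
    have "(\<lambda>p :: real \<times> real \<times> real. if fst p < norm (snd p) then exp (- \<mu> * c * l (norm (snd p - (fst p, 0)))) else 0)
        \<in> borel_measurable (borel \<Otimes>\<^sub>M borel)"
      by measurable
    then have "(\<lambda>p :: real \<times> real \<times> real. if fst p < norm (snd p) then exp (- \<mu> * c * l (norm (snd p - (fst p, 0)))) else 0)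
        \<in> borel_measurable (borel \<Otimes>\<^sub>M lborel)"
      by (simp cong: measurable_cong_sets sets_pair_measure_cong)
    then have "(\<lambda>r. LBINT b. if r < norm (b :: real \<times> real) then exp (- \<mu> * c * l (norm (b - (r, 0)))) else 0)
        \<in> borel_measurable borel"
      by (intro lborel.borel_measurable_lebesgue_integral) (simp add: case_prod_beta')
    moreover have "radial_load = (\<lambda>r. lamL * (LBINT b. if r < norm (b :: real \<times> real) then exp (- \<mu> * c * l (norm (b - (r, 0)))) else 0))"
      unfolding radial_load_def set_lebesgue_integral_def
      by (intro ext arg_cong[where f="\<lambda>u. lamL * u"] Bochner_Integration.integral_cong)
         (auto simp: indicator_def mem_cball_0 not_le)
    ultimately show ?thesis
      by (simp only: borel_measurable_times borel_measurable_const)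
  qed
  have "(\<integral>\<^sup>+w. of_bool (access J (near w) w) \<partial>M)
      = ennreal K * (\<integral>\<^sup>+t. indicator {0..1} t * (\<integral>\<^sup>+w. survive (near w) t w \<partial>M) \<partial>lborel)"
    by (rule nn_integral_access_factor[OF K(1)])
  also have "(\<integral>\<^sup>+t. indicator {0..1} t * (\<integral>\<^sup>+w. survive (near w) t w \<partial>M) \<partial>lborel)
      = (\<integral>\<^sup>+t. \<integral>\<^sup>+z. ?g z * (indicator {0..1} t * ennreal (exp (- (t * radial_load (norm z))))) \<partial>lborel \<partial>lborel)"
    by (intro nn_integral_cong) (simp add: nn_integral_survive load_eq indicator_def)
  \<comment> \<open>The timer is integrated at a fixed location, since it is there that the
    integrand is an exponential in \<open>t\<close> with a constant rate.\<close>
  also have "\<dots> = (\<integral>\<^sup>+z. \<integral>\<^sup>+t. ?g z * (indicator {0..1} t * ennreal (exp (- (t * radial_load (norm z))))) \<partial>lborel \<partial>lborel)"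
    by (rule lborel_pair.Fubini') measurable
  also have "\<dots> = (\<integral>\<^sup>+z. ?g z * ennreal (?F (norm z)) \<partial>lborel)"
    by (intro nn_integral_cong) (simp add: nn_integral_cmult nn_integral_exp_unit_interval rl_pos)
  also have "\<dots> = (\<integral>\<^sup>+r. ennreal (2 * pi * r) * indicator {0..} r
      * (ennreal (lamL * exp (- (lamL * (pi * r\<^sup>2)))) * ennreal (?F r)) \<partial>lborel)"
    by (rule nn_integral_radial) measurable
  also have "ennreal K * \<dots> = (\<integral>\<^sup>+r. ennreal (indicator {0..} r *\<^sub>R (K * ?F r * closest_dist_density lamL r)) \<partial>lborel)"
  proof -
    \<comment> \<open>The Gaussian weight times the Jacobian \<open>2 * pi * r\<close> is
      \<open>closest_dist_density lamL r\<close>.\<close>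
    have pt: "ennreal K * (ennreal (2 * pi * r) * indicator {0..} r
      * (ennreal (lamL * exp (- (lamL * (pi * r\<^sup>2)))) * ennreal (?F r)))
      = ennreal (indicator {0..} r *\<^sub>R (K * ?F r * closest_dist_density lamL r))" for r
    proof (cases "r \<ge> 0")
      case True
      have "?F r \<ge> 0" using rl_pos[OF True] by simp
      then show ?thesis
        using True K(2) lamL
        by (simp add: closest_dist_density_def mult_ac flip: ennreal_mult')
    qed simp
    have "(\<lambda>r. ennreal (2 * pi * r) * indicator {0..} r
      * (ennreal (lamL * exp (- (lamL * (pi * r\<^sup>2)))) * ennreal (?F r))) \<in> borel_measurable lborel"
      by measurable
    from nn_integral_cmult[OF this, of "ennreal K", symmetric] show ?thesis
      by (simp only: pt)
  qed
  finally have main: "(\<integral>\<^sup>+w. of_bool (access J (near w) w) \<partial>M)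
    = (\<integral>\<^sup>+r. ennreal (indicator {0..} r *\<^sub>R (K * ?F r * closest_dist_density lamL r)) \<partial>lborel)" .
  have acc [measurable]: "Measurable.pred M (\<lambda>w. access J (near w) w)"
    by (rule measurable_compose_countable[OF measurable_access Py.measurable_nearest])
  have "(\<integral>\<^sup>+w. of_bool (access J (near w) w) \<partial>M) = (\<integral>\<^sup>+w. indicator {w \<in> space M. access J (near w) w} w \<partial>M)"
    by (intro nn_integral_cong) (auto simp: indicator_def)
  then have "prob {w \<in> space M. access J (near w) w} = enn2real (\<integral>\<^sup>+w. of_bool (access J (near w) w) \<partial>M)"
    by (simp add: measure_def)
  also have "\<dots> = (LBINT r:{0..}. K * ?F r * closest_dist_density lamL r)"
    unfolding main set_lebesgue_integral_def
  proof (rule integral_eq_nn_integral[symmetric])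
    show "(\<lambda>r. indicator {0..} r *\<^sub>R (K * ?F r * closest_dist_density lamL r)) \<in> borel_measurable lborel"
      unfolding closest_dist_density_def by measurable
    show "AE r in lborel. 0 \<le> indicator {0..} r *\<^sub>R (K * ?F r * closest_dist_density lamL r)"
    proof (rule AE_I2)
      fix r :: real
      show "0 \<le> indicator {0..} r *\<^sub>R (K * ?F r * closest_dist_density lamL r)"
        using rl_pos[of r] K(2) lamL by (cases "r \<ge> 0") (simp_all add: closest_dist_density_def)
    qed
  qed
  finally show ?thesis .
qed

end

section \<open>Exchanging the roles of the two networks\<close>

text \<open>Independence concerns finite subfamilies, and an injective renaming maps these to finite
  subfamilies with the same events.\<close>

lemma (in prob_space) indep_sets_reindex:
  assumes F: "indep_sets F J" and inj: "inj_on \<rho> I" and sub: "\<rho> ` I \<subseteq> J"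
  shows "indep_sets (\<lambda>i. F (\<rho> i)) I"
proof (rule indep_setsI)
  show "F (\<rho> i) \<subseteq> events" if "i \<in> I" for i
    using F sub that unfolding indep_sets_def by blast
  fix A K assume K: "K \<noteq> {}" "K \<subseteq> I" "finite K" and A: "\<forall>i\<in>K. A i \<in> F (\<rho> i)"
  define B where "B j = A (inv_into I \<rho> j)" for j
  have B: "B (\<rho> i) = A i" if "i \<in> K" for i
    using that K(2) inj by (simp add: B_def inv_into_f_f subset_iff)
  have "\<rho> ` K \<subseteq> J"
    using K(2) sub by blast
  then have "prob (\<Inter>j\<in>\<rho> ` K. B j) = (\<Prod>j\<in>\<rho> ` K. prob (B j))"
    by (rule indep_setsD[OF F]) (use K A B in auto)
  then show "prob (\<Inter>i\<in>K. A i) = (\<Prod>i\<in>K. prob (A i))"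
    using B inj_on_subset[OF inj K(2)] by (simp add: prod.reindex)
qed

lemma Int_stable_source_events: "Int_stable (source_events M x y tW tL GW GWL GL s)"
  by (cases s) (simp_all add: sets.Int_stable)

text \<open>After the exchange the first index of \<open>WL_fading\<close> belongs to the other
  network, so its two indices trade places as well.\<close>

fun source_swap :: "source \<Rightarrow> source" where
  "source_swap W_points = L_points"
| "source_swap L_points = W_points"
| "source_swap (W_timer i) = L_timer i"
| "source_swap (L_timer i) = W_timer i"
| "source_swap (WW_fading j i) = LL_fading j i"
| "source_swap (WL_fading j k) = WL_fading k j"
| "source_swap (LL_fading m k) = WW_fading m k"

lemma source_swap_swap: "source_swap (source_swap s) = s"
  by (cases s) simp_all

lemma source_swap_sources: "source_swap ` sources \<subseteq> sources"
proof
  fix s assume "s \<in> source_swap ` sources"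
  then obtain s' where "s' \<in> sources" "s = source_swap s'" by blast
  then show "s \<in> sources"
    by (cases s') (auto simp: sources_def)
qed

lemma source_events_swap:
  "source_events M y x tL tW GL (\<lambda>j k. GWL k j) GW
    = (\<lambda>s. source_events M x y tW tL GW GWL GL (source_swap s))"
proof
  show "source_events M y x tL tW GL (\<lambda>j k. GWL k j) GW s
    = source_events M x y tW tL GW GWL GL (source_swap s)" for s
    by (cases s) simp_all
qed

lemma path_loss_properties:
  fixes lamc \<alpha> \<mu> :: real
  assumes "lamc > 0" "\<alpha> > 0" "\<mu> > 0"
  shows "path_loss lamc \<alpha> 0 = 0" "d > 0 \<Longrightarrow> path_loss lamc \<alpha> d > 0"
    "continuous_on {0..} (path_loss lamc \<alpha>)"
    "c > 0 \<Longrightarrow> integrable lborel (\<lambda>z :: real \<times> real. exp (- \<mu> * c * path_loss lamc \<alpha> (norm z)))"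
proof -
  show "path_loss lamc \<alpha> 0 = 0" by (simp add: path_loss_def)
  show "d > 0 \<Longrightarrow> path_loss lamc \<alpha> d > 0" using assms by (simp add: path_loss_def)
  show "continuous_on {0..} (path_loss lamc \<alpha>)"
    unfolding path_loss_def[abs_def] using assms
    by (intro continuous_on_mult continuous_on_const continuous_on_powr' continuous_on_id) auto
  assume "c > 0"
  then have "\<mu> * c * (4 * pi / lamc)\<^sup>2 > 0" using assms by simp
  from integrable_exp_powr_plane[OF this assms(2)]
  show "integrable lborel (\<lambda>z :: real \<times> real. exp (- \<mu> * c * path_loss lamc \<alpha> (norm z)))"
    by (simp add: path_loss_def mult.assoc)
qed

theorem corollary8:
  fixes M :: "'a measure"
    and x y :: "nat \<Rightarrow> 'a \<Rightarrow> real \<times> real"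
    and tW tL :: "nat \<Rightarrow> 'a \<Rightarrow> real"
    and GW GWL GL :: "nat \<Rightarrow> nat \<Rightarrow> 'a \<Rightarrow> real"
    and lamW lamL PW PL lamc \<alpha> \<mu> \<Gamma>cs \<Gamma>L :: real
    and l :: "real \<Rightarrow> real"
  assumes "prob_space M"
    and "lamW > 0" and "lamL > 0" and "PW > 0" and "PL > 0" and "lamc > 0" and "\<alpha> > 0"
    and "\<mu> > 0" and "\<Gamma>cs > 0" and "\<Gamma>L > 0"
    and "l = path_loss lamc \<alpha>"
    and "poisson_point_process M lamW x"
    and "poisson_point_process M lamL y"
    and "\<And>i. distributed M lborel (tW i)
                 (\<lambda>s. indicator {0..1} s / measure lborel {0..1::real})"
    and "\<And>k. distributed M lborel (tL k)
                 (\<lambda>s. indicator {1..2} s / measure lborel {1..2::real})"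
    and "\<And>j i. j \<noteq> i \<Longrightarrow> distributed M lborel (GW j i) (exponential_density \<mu>)"
    and "\<And>j k. distributed M lborel (GWL j k) (exponential_density \<mu>)"
    and "\<And>m k. m \<noteq> k \<Longrightarrow> distributed M lborel (GL m k) (exponential_density \<mu>)"
    and "prob_space.indep_sets M (source_events M x y tW tL GW GWL GL) sources"
  shows "measure M {\<omega> \<in> space M.
           wifi_access l PW \<Gamma>cs (\<lambda>i. x i \<omega>) (\<lambda>i. tW i \<omega>) (\<lambda>j i. GW j i \<omega>)
             (closest_index (\<lambda>i. x i \<omega>)) = 1}
         = (LBINT r:{0..}. (1 - exp (- N2W l lamW \<mu> PW \<Gamma>cs r)) / N2W l lamW \<mu> PW \<Gamma>cs r
              * closest_dist_density lamW r)
       \<and> measure M {\<omega> \<in> space M.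
           lte_access l PW PL \<Gamma>L (\<lambda>i. x i \<omega>) (\<lambda>k. y k \<omega>) (\<lambda>k. tL k \<omega>)
             (\<lambda>j k. GWL j k \<omega>) (\<lambda>m k. GL m k \<omega>)
             (closest_index (\<lambda>k. y k \<omega>)) = 1}
         = (LBINT r:{0..}. exp (- N3W l lamW \<mu> PW \<Gamma>L)
              * ((1 - exp (- N1L l lamL \<mu> PL r \<Gamma>L)) / N1L l lamL \<mu> PL r \<Gamma>L)
              * closest_dist_density lamL r)"
proof -
  interpret prob_space M by fact
  note l = path_loss_properties[OF \<open>lamc > 0\<close> \<open>\<alpha> > 0\<close> \<open>\<mu> > 0\<close>, folded \<open>l = path_loss lamc \<alpha>\<close>]
  have indep: "indep_sets (source_events M x y tW tL GW GWL GL) sources" by fact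
  have indep': "indep_sets (source_events M y x tL tW GL (\<lambda>j k. GWL k j) GW) sources"
    unfolding source_events_swap[of M y x tL tW GL GWL GW]
    by (rule indep_sets_reindex[OF indep inj_on_inverseI source_swap_sources]) (rule source_swap_swap)
  interpret L: tagged_access M x y tW tL GW GWL GL lamW lamL 1 \<mu> "\<Gamma>L / PL" "\<Gamma>L / PW" l
  proof unfold_locales
    show "distributed M lborel (tL k) (\<lambda>s. indicator {1..1 + 1} s / measure lborel {1..1 + 1 :: real})" for k
      using assms(15)[of k] by simp
    show "\<Gamma>L / PL > 0" "\<Gamma>L / PW > 0"
      using \<open>\<Gamma>L > 0\<close> \<open>PL > 0\<close> \<open>PW > 0\<close> by simp_all
  qed (fact assms indep l | rule Int_stable_source_events)+
  \<comment> \<open>The access points are the tagged network when the roles are exchanged; no mark of the other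
    network enters, so the set of cross-network constraints is empty.\<close>
  interpret W: tagged_access M y x tL tW GL "\<lambda>j k. GWL k j" GW lamL lamW 0 \<mu> "\<Gamma>cs / PW" "\<Gamma>cs / PW" l
  proof unfold_locales
    show "distributed M lborel (tW k) (\<lambda>s. indicator {0..0 + 1} s / measure lborel {0..0 + 1 :: real})" for k
      using assms(14)[of k] by simp
    show "\<Gamma>cs / PW > 0"
      using \<open>\<Gamma>cs > 0\<close> \<open>PW > 0\<close> by simp
  qed (fact assms indep' l | rule Int_stable_source_events)+
  have W: "wifi_access l PW \<Gamma>cs (\<lambda>i. x i \<omega>) (\<lambda>i. tW i \<omega>) (\<lambda>j i. GW j i \<omega>) (closest_index (\<lambda>i. x i \<omega>)) = 1
      \<longleftrightarrow> W.access {} (W.near \<omega>) \<omega>" for \<omega>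
    unfolding wifi_access_def backoff_indicator_eq W.access_def L.Px.nearest_def by simp
  have L: "lte_access l PW PL \<Gamma>L (\<lambda>i. x i \<omega>) (\<lambda>k. y k \<omega>) (\<lambda>k. tL k \<omega>) (\<lambda>j k. GWL j k \<omega>) (\<lambda>m k. GL m k \<omega>)
        (closest_index (\<lambda>k. y k \<omega>)) = 1
      \<longleftrightarrow> L.access UNIV (L.near \<omega>) \<omega>" for \<omega>
    unfolding lte_access_eq_1_iff L.access_def L.Py.nearest_def by simp
  have loadW: "W.radial_load = N2W l lamW \<mu> PW \<Gamma>cs"
    by (simp add: fun_eq_iff W.radial_load_def N2W_def)
  have loadL: "L.radial_load r = N1L l lamL \<mu> PL r \<Gamma>L" for r
    by (simp add: L.radial_load_def N1L_def)
  \<comment> \<open>Over the empty set of cross-network constraints the product is 1, so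
    \<open>K = 1\<close>.\<close>
  have "prob {\<omega> \<in> space M. W.access {} (W.near \<omega>) \<omega>}
    = (LBINT r:{0..}. 1 * ((1 - exp (- W.radial_load r)) / W.radial_load r) * closest_dist_density lamW r)"
    by (rule W.prob_access_near) (simp_all add: emeasure_space_1)
  \<comment> \<open>All access points count here, and \<open>nn_integral_all_tolerance\<close>
    supplies the constant \<open>K\<close>, whose exponent is \<open>N3W\<close>.\<close>
  moreover have "prob {\<omega> \<in> space M. L.access UNIV (L.near \<omega>) \<omega>}
    = (LBINT r:{0..}. exp (- N3W l lamW \<mu> PW \<Gamma>L)
        * ((1 - exp (- L.radial_load r)) / L.radial_load r) * closest_dist_density lamL r)"
    by (rule L.prob_access_near) (simp_all add: L.nn_integral_all_tolerance N3W_def)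
  ultimately show ?thesis
    unfolding W L loadW loadL by simp
qed

end
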